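(* If $G=\operatorname{PSp}_{2l}(\mathbb C)$, then semisimple elements of $\tilde G=\operatorname{Sp}_{2l}(\mathbb C)$ are conjugate in $\tilde G$ up to a multiple of an element in $Z(\tilde G)$ if and only if they are conjugate in $\operatorname{GL}(V(\lambda_k))$ up to a constant for $k=1,\dots,l$.
   Context: $V(\lambda_1),\dots,V(\lambda_l)$ are the fundamental representations of $\tilde G$ and $Z(\tilde G)$ is its center. "$s_1,s_2$ are conjugate in $\tilde G$ up to a multiple of an element in $Z(\tilde G)$" means $s_1$ is conjugate in $\tilde G$ to $cs_2$ for some $c\in Z(\tilde G)$. "Conjugate in $\operatorname{GL}(V)$ up to a constant" means that the image of $s_1$ in $\operatorname{GL}(V)$ is conjugate to $t$ times the image of $s_2$ for some $t\in\mathbb C^*$ (which may depend on $V$). *)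

theory Defs
  imports
    "HOL-Algebra.Algebra"
    "Jordan_Normal_Form.Matrix"
    "Jordan_Normal_Form.VS_Connect"
begin

section \<open>Conjugacy and centre\<close>

definition conjugate_in :: "('a, 'b) monoid_scheme \<Rightarrow> 'a \<Rightarrow> 'a \<Rightarrow> bool" where
  "conjugate_in G x y \<longleftrightarrow>
     (\<exists>g \<in> carrier G. x = g \<otimes>\<^bsub>G\<^esub> y \<otimes>\<^bsub>G\<^esub> inv\<^bsub>G\<^esub> g)"

definition group_center :: "('a, 'b) monoid_scheme \<Rightarrow> 'a set" where
  "group_center G =
     {c \<in> carrier G. \<forall>g \<in> carrier G. c \<otimes>\<^bsub>G\<^esub> g = g \<otimes>\<^bsub>G\<^esub> c}"


section \<open>The groups GL and Sp over the complex numbers\<close>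

definition GL :: "nat \<Rightarrow> complex mat monoid" where
  "GL N = units_of (ring_mat TYPE(complex) N ())"

text \<open>
  The symplectic form on \<open>C^(2l)\<close> pairs \<open>e\<^sub>i\<close> with \<open>e\<^sub>(\<^sub>2\<^sub>l\<^sub>-\<^sub>1\<^sub>-\<^sub>i\<^sub>)\<close> (indices start at 0). With this
  choice the diagonal matrices in \<open>Sp l\<close> form a maximal torus, consisting of the matrices
  \<open>diag(t\<^sub>1, ..., t\<^sub>l, 1/t\<^sub>l, ..., 1/t\<^sub>1)\<close>, and the upper triangular matrices in \<open>Sp l\<close> form a
  Borel subgroup containing it.
\<close>

definition sympl_form :: "nat \<Rightarrow> complex mat" where
  "sympl_form l = mat (2 * l) (2 * l)
     (\<lambda>(i, j). if i + j + 1 = 2 * l then (if i < l then 1 else - 1) else 0)"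

text \<open>\<open>Sp l\<close> is the symplectic group of \<open>2l \<times> 2l\<close> matrices.\<close>

definition Sp :: "nat \<Rightarrow> complex mat monoid" where
  "Sp l = (GL (2 * l)) \<lparr>carrier :=
     {A \<in> carrier (GL (2 * l)). transpose_mat A * sympl_form l * A = sympl_form l}\<rparr>"

definition semisimple_mat :: "complex mat \<Rightarrow> bool" where
  "semisimple_mat A \<longleftrightarrow> (\<exists>D. diagonal_mat D \<and> similar_mat A D)"


section \<open>Rational representations of Sp\<close>

text \<open>Polynomial functions in the entries of an \<open>m \<times> m\<close> matrix.\<close>

inductive_set mat_poly_fun :: "nat \<Rightarrow> (complex mat \<Rightarrow> complex) set" for m :: nat where
  const: "(\<lambda>_. a) \<in> mat_poly_fun m"
| entry: "i < m \<Longrightarrow> j < m \<Longrightarrow> (\<lambda>A. A $$ (i, j)) \<in> mat_poly_fun m"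
| add: "p \<in> mat_poly_fun m \<Longrightarrow> q \<in> mat_poly_fun m \<Longrightarrow> (\<lambda>A. p A + q A) \<in> mat_poly_fun m"
| mult: "p \<in> mat_poly_fun m \<Longrightarrow> q \<in> mat_poly_fun m \<Longrightarrow> (\<lambda>A. p A * q A) \<in> mat_poly_fun m"

text \<open>
  A rational representation on \<open>C^N\<close>. As \<open>Sp l\<close> is Zariski closed in the space of all
  \<open>2l \<times> 2l\<close> matrices, its regular functions are the restrictions of polynomials in the
  matrix entries.
\<close>

definition rational_rep :: "nat \<Rightarrow> nat \<Rightarrow> (complex mat \<Rightarrow> complex mat) \<Rightarrow> bool" where
  "rational_rep l N \<rho> \<longleftrightarrow>
     \<rho> \<in> hom (Sp l) (GL N) \<and>
     (\<forall>i<N. \<forall>j<N. \<exists>p \<in> mat_poly_fun (2 * l). \<forall>A \<in> carrier (Sp l). \<rho> A $$ (i, j) = p A)"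

definition irreducible_rep :: "nat \<Rightarrow> nat \<Rightarrow> (complex mat \<Rightarrow> complex mat) \<Rightarrow> bool" where
  "irreducible_rep l N \<rho> \<longleftrightarrow>
     rational_rep l N \<rho> \<and> N > 0 \<and>
     (\<forall>W. VectorSpace.subspace class_ring W (module_vec TYPE(complex) N) \<longrightarrow>
          (\<forall>A \<in> carrier (Sp l). \<forall>w \<in> W. \<rho> A *\<^sub>v w \<in> W) \<longrightarrow>
          W = {0\<^sub>v N} \<or> W = carrier_vec N)"


section \<open>Weights and fundamental representations\<close>

text \<open>
  A weight \<open>w\<close> is given by its coordinates \<open>w 0, ..., w (l - 1)\<close> in the standard basis of the
  character lattice of the diagonal torus; its value at \<open>diag(t\<^sub>1, ..., t\<^sub>l, 1/t\<^sub>l, ..., 1/t\<^sub>1)\<close>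
  is the product of the \<open>t\<^sub>(\<^sub>i\<^sub>+\<^sub>1\<^sub>)\<close> to the power \<open>w i\<close>.
\<close>

definition weight_char :: "nat \<Rightarrow> (nat \<Rightarrow> int) \<Rightarrow> complex mat \<Rightarrow> complex" where
  "weight_char l w T = (\<Prod>i<l. (T $$ (i, i)) powi (w i))"

text \<open>\<open>highest_weight_vector l N \<rho> w v\<close>: \<open>v\<close> is nonzero, has weight \<open>w\<close> for the diagonal
  torus, and is fixed by the unipotent radical of the upper triangular Borel subgroup.\<close>

definition highest_weight_vector ::
    "nat \<Rightarrow> nat \<Rightarrow> (complex mat \<Rightarrow> complex mat) \<Rightarrow> (nat \<Rightarrow> int) \<Rightarrow> complex vec \<Rightarrow> bool" where
  "highest_weight_vector l N \<rho> w v \<longleftrightarrow>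
     v \<in> carrier_vec N \<and> v \<noteq> 0\<^sub>v N \<and>
     (\<forall>T \<in> carrier (Sp l). diagonal_mat T \<longrightarrow> \<rho> T *\<^sub>v v = weight_char l w T \<cdot>\<^sub>v v) \<and>
     (\<forall>U \<in> carrier (Sp l). upper_triangular U \<and> (\<forall>i<2 * l. U $$ (i, i) = 1) \<longrightarrow> \<rho> U *\<^sub>v v = v)"

text \<open>
  The simple roots for the upper triangular Borel subgroup are
  \<open>\<epsilon>\<^sub>1 - \<epsilon>\<^sub>2, ..., \<epsilon>\<^sub>(\<^sub>l\<^sub>-\<^sub>1\<^sub>) - \<epsilon>\<^sub>l, 2 \<epsilon>\<^sub>l\<close>. The coordinates of the \<open>j\<close>-th simple coroot,
  \<open>1 \<le> j \<le> l\<close>, are those of \<open>e\<^sub>j - e\<^sub>(\<^sub>j\<^sub>+\<^sub>1\<^sub>)\<close> for \<open>j < l\<close>, and of \<open>e\<^sub>l\<close> for \<open>j = l\<close>. The fundamental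
  weight \<open>\<lambda>\<^sub>k\<close>, \<open>1 \<le> k \<le> l\<close>, is \<open>\<epsilon>\<^sub>1 + ... + \<epsilon>\<^sub>k\<close>; these weights form the basis dual to the
  simple coroots.
\<close>

definition simple_coroot :: "nat \<Rightarrow> nat \<Rightarrow> nat \<Rightarrow> int" where
  "simple_coroot l j i = (if i + 1 = j then 1 else if j < l \<and> i = j then - 1 else 0)"

definition fundamental_weight :: "nat \<Rightarrow> nat \<Rightarrow> int" where
  "fundamental_weight k i = (if i < k then 1 else 0)"

lemma fundamental_weight_coroot:
  assumes "k \<in> {1..l}" "j \<in> {1..l}"
  shows "(\<Sum>i<l. fundamental_weight k i * simple_coroot l j i) = (if j = k then 1 else 0)"
proof -
  have eq: "fundamental_weight k i * simple_coroot l j i =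
        (if i = j - 1 then fundamental_weight k i else 0)
        - (if i = j then fundamental_weight k i else 0)" if "i < l" for i
    using assms that by (cases j) (auto simp: simple_coroot_def)
  have "(\<Sum>i<l. fundamental_weight k i * simple_coroot l j i) =
        (\<Sum>i<l. (if i = j - 1 then fundamental_weight k i else 0)
               - (if i = j then fundamental_weight k i else 0))"
    by (rule sum.cong) (use eq in auto)
  also have "\<dots> = fundamental_weight k (j - 1) - (if j < l then fundamental_weight k j else 0)"
    using assms by (cases j) (simp_all add: sum_subtractf)
  also have "\<dots> = (if j = k then 1 else 0)"
    using assms by (auto simp: fundamental_weight_def)
  finally show ?thesis .
qed

text \<open>\<open>\<rho>\<close> is a matrix realization of \<open>V(\<lambda>\<^sub>k)\<close> on \<open>C^N\<close>.\<close>

definition fundamental_rep :: "nat \<Rightarrow> nat \<Rightarrow> nat \<Rightarrow> (complex mat \<Rightarrow> complex mat) \<Rightarrow> bool" where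
  "fundamental_rep l k N \<rho> \<longleftrightarrow>
     irreducible_rep l N \<rho> \<and> (\<exists>v. highest_weight_vector l N \<rho> (fundamental_weight k) v)"


section \<open>GL and Sp are groups\<close>

lemma GL_group: "group (GL N)"
  unfolding GL_def
  by (intro monoid.units_group ring.is_monoid ring_mat)

lemma GL_simps [simp]:
  "A \<otimes>\<^bsub>GL N\<^esub> B = A * B" "\<one>\<^bsub>GL N\<^esub> = 1\<^sub>m N"
  by (simp_all add: GL_def units_of_def ring_mat_simps)

lemma GL_carrier_mat: "A \<in> carrier (GL N) \<Longrightarrow> A \<in> carrier_mat N N"
  by (simp add: GL_def units_of_def Units_def ring_mat_simps)

lemma Sp_subgroup: "subgroup (carrier (Sp l)) (GL (2 * l))"
proof -
  interpret G: group "GL (2 * l)" by (rule GL_group)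
  let ?n = "2 * l" and ?J = "sympl_form l"
  have J: "?J \<in> carrier_mat ?n ?n" by (simp add: sympl_form_def)
  show ?thesis
  proof (rule G.subgroupI)
    show "carrier (Sp l) \<subseteq> carrier (GL ?n)" by (auto simp: Sp_def)
    have "1\<^sub>m ?n \<in> carrier (Sp l)" using J G.one_closed by (simp add: Sp_def)
    then show "carrier (Sp l) \<noteq> {}" by blast
  next
    fix A assume "A \<in> carrier (Sp l)"
    then have AG: "A \<in> carrier (GL ?n)" and A: "transpose_mat A * ?J * A = ?J"
      by (auto simp: Sp_def)
    define B where "B = inv\<^bsub>GL ?n\<^esub> A"
    have BG: "B \<in> carrier (GL ?n)" using AG by (simp add: B_def)
    have AB: "A * B = 1\<^sub>m ?n" using G.r_inv[OF AG] by (simp add: B_def)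
    note c = GL_carrier_mat[OF AG] GL_carrier_mat[OF BG] J
    have tAB: "transpose_mat B * transpose_mat A = 1\<^sub>m ?n"
      using AB c by (metis transpose_mult transpose_one)
    have "transpose_mat B * ?J * B = transpose_mat B * (transpose_mat A * ?J * A) * B"
      by (simp add: A)
    also have "\<dots> = (transpose_mat B * transpose_mat A) * ?J * (A * B)"
      using c by (simp add: assoc_mult_mat[of _ ?n ?n _ ?n _ ?n])
    also have "\<dots> = ?J" using c by (simp add: AB tAB)
    finally show "inv\<^bsub>GL ?n\<^esub> A \<in> carrier (Sp l)" using BG by (simp add: Sp_def B_def)
  next
    fix A B assume "A \<in> carrier (Sp l)" "B \<in> carrier (Sp l)"
    then have AG: "A \<in> carrier (GL ?n)" and A: "transpose_mat A * ?J * A = ?J"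
      and BG: "B \<in> carrier (GL ?n)" and B: "transpose_mat B * ?J * B = ?J"
      by (auto simp: Sp_def)
    note c = GL_carrier_mat[OF AG] GL_carrier_mat[OF BG] J
    have "transpose_mat (A * B) * ?J * (A * B) =
          transpose_mat B * (transpose_mat A * ?J * A) * B"
      using c by (simp add: transpose_mult assoc_mult_mat[of _ ?n ?n _ ?n _ ?n])
    then have "transpose_mat (A * B) * ?J * (A * B) = ?J" by (simp add: A B)
    moreover have "A * B \<in> carrier (GL ?n)" using G.m_closed[OF AG BG] by simp
    ultimately show "A \<otimes>\<^bsub>GL ?n\<^esub> B \<in> carrier (Sp l)" by (simp add: Sp_def)
  qed
qed

lemma Sp_group: "group (Sp l)"
proof -
  have "group ((GL (2 * l))\<lparr>carrier := carrier (Sp l)\<rparr>)"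
    using group.subgroup_imp_group[OF GL_group Sp_subgroup] .
  then show ?thesis by (simp add: Sp_def)
qed

end

theory Submission
  imports Defs "Jordan_Normal_Form.Schur_Decomposition" "Jordan_Normal_Form.Spectral_Radius"
begin

text \<open>
From left to right the statement is Schur's lemma: a central element of \<open>Sp l\<close> commutes with an
irreducible representation, hence acts by a scalar (\<open>group_center_scalar\<close>).

From right to left, the argument rests on the first two fundamental representations. Let
\<open>a\<^sub>m = tr s\<^sub>1^m\<close> and \<open>b\<^sub>m = tr s\<^sub>2^m\<close>, traces in the natural representation. As \<open>V(\<lambda>\<^sub>1)\<close> is the
natural representation, conjugacy up to a constant \<open>t\<close> there gives \<open>a\<^sub>m = t^m b\<^sub>m\<close>. As \<open>V(\<lambda>\<^sub>2)\<close> is the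
exterior square of the natural representation without one trivial summand, its trace at \<open>s\<^sub>1^m\<close> is
\<open>(a\<^sub>m\<^sup>2 - a\<^sub>2\<^sub>m) / 2 - 1\<close>, and conjugacy up to a constant \<open>u\<close> gives a second family of relations.
Elements of \<open>Sp l\<close> have the same trace as their inverses, so \<open>m\<close> may be replaced by \<open>-m\<close> in both
families. An arithmetic argument with the greatest common divisor of all \<open>m\<close> such that \<open>b\<^sub>m \<noteq> 0\<close> then
yields a sign \<open>e\<close> with \<open>a\<^sub>m = e^m b\<^sub>m\<close> for all \<open>m\<close> (\<open>power_sums_eq_up_to_sign\<close>). Semisimple matrices whose
powers have equal traces are similar, so \<open>s\<^sub>1\<close> is similar to \<open>e s\<^sub>2\<close>. Finally, similar elements of \<open>Sp l\<close>
are conjugate in \<open>Sp l\<close> (\<open>Sp_conjugate_if_GL_conjugate\<close>): the conjugating matrix is corrected by a square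
root that is a polynomial in a self-adjoint matrix.

The two trace formulas have to be derived for an abstract irreducible rational representation \<open>\<rho>\<close> with
a highest weight vector \<open>v\<close>. The link is one matrix coefficient. There is a linear functional \<open>\<phi>\<close> that
equals 1 on all \<open>\<rho>(u) v\<close> with \<open>u\<close> lower unitriangular (\<open>lower_unipotent_functional\<close>: a one-parameter
subgroup of the torus contracts \<open>u\<close> to 1, and polynomials in the parameter are continuous at 0). Hence
\<open>\<phi>(\<rho>(A) v)\<close> is the \<open>k\<close>-th leading principal minor of \<open>A\<close> on the big cell of matrices \<open>A = L D U\<close>, and
then on all of \<open>Sp l\<close>, because \<open>Sp l\<close> is irreducible as a variety (\<open>Sp_irreducible\<close>: it is generated by
transvections, so each of its elements lies with 1 on a polynomial curve). As the vectors \<open>\<rho>(A) v\<close> and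
the functionals \<open>\<phi> \<circ> \<rho>(B)\<close> span, this coefficient determines the trace of \<open>\<rho>\<close> (\<open>coefficient_resolution\<close>);
comparing with the natural representation and with its exterior square, where the same minors occur as
matrix coefficients, gives \<open>trace_fundamental_rep_1\<close> and \<open>trace_fundamental_rep_2\<close>.
\<close>

section \<open>Separation by linear functionals\<close>

text \<open>
A vector outside a linear subspace of \<open>C^n\<close> is separated from it by a linear functional. Vectors are
functions of which only the values below \<open>n\<close> count; this makes the induction on \<open>n\<close> a matter of
forgetting the last coordinate.
\<close>

lemma separating_functional:
  fixes R :: "(nat \<Rightarrow> complex) set" and v :: "nat \<Rightarrow> complex"
  assumes "(\<lambda>_. 0) \<in> R"
    and "\<And>r s. r \<in> R \<Longrightarrow> s \<in> R \<Longrightarrow> (\<lambda>i. r i + s i) \<in> R"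
    and "\<And>c r. r \<in> R \<Longrightarrow> (\<lambda>i. c * r i) \<in> R"
    and "\<not> (\<exists>r\<in>R. \<forall>i<n. r i = v i)"
  shows "\<exists>x. (\<forall>r\<in>R. (\<Sum>i<n. r i * x i) = 0) \<and> (\<Sum>i<n. v i * x i) = 1"
proof -
  have "\<exists>x. (\<forall>r\<in>R. (\<Sum>i<n. r i * x i) = 0) \<and> (\<Sum>i<n. v i * x i) \<noteq> 0"
    using assms
  proof (induction n arbitrary: R v)
    case 0
    then show ?case by auto
  next
    case (Suc n)
    show ?case
    proof (cases "\<exists>r\<in>R. r n \<noteq> 0")
      case False
      then have R0: "r n = 0" if "r \<in> R" for r using that by auto
      show ?thesis
      proof (cases "v n = 0")
        case True
        have "\<not> (\<exists>r\<in>R. \<forall>i<n. r i = v i)"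
          using Suc.prems(4) R0 True by (auto simp: less_Suc_eq)
        from Suc.IH[OF Suc.prems(1-3) this] obtain x
          where "\<forall>r\<in>R. (\<Sum>i<n. r i * x i) = 0" "(\<Sum>i<n. v i * x i) \<noteq> 0" by auto
        then show ?thesis
          using R0 True by (intro exI[of _ x]) simp
      next
        case nz: False
        have "(\<Sum>i<Suc n. w i * (if i = n then 1 else 0)) = w n" for w :: "nat \<Rightarrow> complex"
          by simp
        then show ?thesis using R0 nz by (intro exI[of _ "\<lambda>i. if i = n then 1 else 0"]) auto
      qed
    next
      case True
      then obtain r1 where r1: "r1 \<in> R" "r1 n \<noteq> 0" by auto
      \<comment> \<open>Some element of \<open>R\<close> has last coordinate 1; subtracting multiples of it clears the last coordinate.\<close>
      define r0 where "r0 = (\<lambda>i. inverse (r1 n) * r1 i)"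
      have r0: "r0 \<in> R" "r0 n = 1" using r1 Suc.prems(3) by (auto simp: r0_def)
      let ?R = "{r\<in>R. r n = 0}"
      define v1 where "v1 = (\<lambda>i. v i + (- v n) * r0 i)"
      have nex: "\<not> (\<exists>r\<in>?R. \<forall>i<n. r i = v1 i)"
      proof
        assume "\<exists>r\<in>?R. \<forall>i<n. r i = v1 i"
        then obtain r where r: "r \<in> R" "r n = 0" "\<forall>i<n. r i = v1 i" by auto
        have "(\<lambda>i. r i + v n * r0 i) \<in> R" by (intro Suc.prems r r0)
        moreover have "\<forall>i<Suc n. r i + v n * r0 i = v i"
          using r r0 by (auto simp: less_Suc_eq v1_def)
        ultimately show False using Suc.prems(4) by (metis (no_types, lifting))
      qed
      have "\<exists>x. (\<forall>r\<in>?R. (\<Sum>i<n. r i * x i) = 0) \<and> (\<Sum>i<n. v1 i * x i) \<noteq> 0"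
        by (rule Suc.IH[OF _ _ _ nex]) (use Suc.prems in auto)
      then obtain x where x: "\<And>r. r \<in> ?R \<Longrightarrow> (\<Sum>i<n. r i * x i) = 0" "(\<Sum>i<n. v1 i * x i) \<noteq> 0"
        by auto
      \<comment> \<open>The last coordinate of the functional is chosen so that it vanishes on \<open>r0\<close>.\<close>
      define y where "y = (\<lambda>i. if i = n then - (\<Sum>i<n. r0 i * x i) else x i)"
      have y: "(\<Sum>i<Suc n. w i * y i) = (\<Sum>i<n. (w i + (- w n) * r0 i) * x i)" for w
      proof -
        have "(\<Sum>i<n. w i * y i) = (\<Sum>i<n. w i * x i)" by (auto simp: y_def)
        then show ?thesis
          by (simp add: y_def algebra_simps sum.distrib sum_subtractf sum_distrib_left)
      qed
      have "(\<Sum>i<Suc n. r i * y i) = 0" if "r \<in> R" for r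
        unfolding y using Suc.prems(2)[OF that Suc.prems(3)[OF r0(1)], of "- r n"] r0(2)
        by (intro x) simp
      moreover have "(\<Sum>i<Suc n. v i * y i) \<noteq> 0"
        unfolding y using x(2) by (simp add: v1_def)
      ultimately show ?thesis by blast
    qed
  qed
  then obtain x where x: "\<forall>r\<in>R. (\<Sum>i<n. r i * x i) = 0" "(\<Sum>i<n. v i * x i) \<noteq> 0" by auto
  let ?d = "\<Sum>i<n. v i * x i"
  have "(\<Sum>i<n. w i * (x i / ?d)) = (\<Sum>i<n. w i * x i) / ?d" for w
    by (simp add: sum_divide_distrib)
  then show ?thesis using x by (intro exI[of _ "\<lambda>i. x i / ?d"]) auto
qed

section \<open>Power sums\<close>

lemma power_eq_one_iff_dvd:
  fixes x :: "'a :: field"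
  shows "\<exists>d. \<forall>m. x ^ m = 1 \<longleftrightarrow> d dvd m"
proof (cases "\<exists>m>0. x ^ m = 1")
  case False
  then show ?thesis by (intro exI[of _ 0]) (metis dvd_0_left_iff gr0I power_0)
next
  case True
  define d where "d = (LEAST m. m > 0 \<and> x ^ m = 1)"
  have d: "d > 0" "x ^ d = 1"
    using LeastI_ex[OF True] by (auto simp: d_def)
  have "x ^ m = 1 \<longleftrightarrow> d dvd m" for m
  proof
    assume m: "x ^ m = 1"
    have "x ^ m = (x ^ d) ^ (m div d) * x ^ (m mod d)"
      by (metis div_mult_mod_eq mult.commute power_add power_mult)
    then have "x ^ (m mod d) = 1" using m d by simp
    moreover have "m mod d < d" using d by simp
    ultimately have "m mod d = 0"
      using not_less_Least[of "m mod d" "\<lambda>m. m > 0 \<and> x ^ m = 1"] by (auto simp: d_def)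
    then show "d dvd m" by auto
  qed (use d in \<open>auto elim!: dvdE simp: power_mult\<close>)
  then show ?thesis by blast
qed

text \<open>
If \<open>p m\<close> is the sum of the \<open>m\<close>-th powers of a family of numbers, then \<open>(p m ^ 2 - p (2 * m)) / 2\<close> is the
sum of the \<open>m\<close>-th powers of the products of two distinct members of the family. The summand \<open>- 1\<close> accounts
for the trivial summand that is split off from the exterior square.
\<close>

definition wedge2_power_sum :: "(nat \<Rightarrow> complex) \<Rightarrow> nat \<Rightarrow> complex" where
  "wedge2_power_sum p m = (p m ^ 2 - p (2 * m)) / 2 - 1"

text \<open>
The arithmetic core. If \<open>b m \<noteq> 0\<close> then \<open>t^(2m) = 1\<close>, so \<open>t^(2D) = 1\<close> for the greatest common divisor \<open>D\<close>
of these \<open>m\<close>. If \<open>t^D = 1\<close>, or if \<open>t^D = -1\<close> with \<open>D\<close> odd, a sign can be read off. If \<open>t^D = -1\<close> with \<open>D\<close>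
even, the relations for the exterior square at odd multiples of \<open>D/2\<close> force \<open>b\<close> to vanish at all odd
multiples of \<open>D\<close>. But then \<open>2 D\<close> divides all \<open>m\<close> with \<open>b m \<noteq> 0\<close>, contradicting the choice of \<open>D\<close>.
\<close>

lemma power_sums_eq_up_to_sign:
  fixes a b :: "nat \<Rightarrow> complex" and t u :: complex
  assumes a: "\<And>m. a m = t ^ m * b m" "\<And>m. b m = t ^ m * a m"
    and w: "\<And>m. wedge2_power_sum a m = u ^ m * wedge2_power_sum b m"
      "\<And>m. wedge2_power_sum b m = u ^ m * wedge2_power_sum a m" and u: "u \<noteq> 0"
  shows "\<exists>e \<in> {1, -1}. \<forall>m. a m = e ^ m * b m"
proof -
  define D where "D = Gcd {m. b m \<noteq> 0}"
  have D: "D dvd m" if "b m \<noteq> 0" for m using that by (auto simp: D_def)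
  have a0: "a m = 0" if "b m = 0" for m using that a(1)[of m] by simp
  obtain d where d: "\<And>m. (t ^ 2) ^ m = 1 \<longleftrightarrow> d dvd m" using power_eq_one_iff_dvd by metis
  have "d dvd m" if "b m \<noteq> 0" for m
  proof -
    have "b m = t ^ m * t ^ m * b m" using a[of m] by simp
    then have "t ^ m * t ^ m = 1" using that by simp
    then have "(t ^ 2) ^ m = 1" by (simp add: power2_eq_square power_mult_distrib)
    then show ?thesis using d by simp
  qed
  then have "d dvd D" by (auto simp: D_def intro: Gcd_greatest)
  then have "(t ^ D) ^ 2 = 1" using d[of D] by (simp add: power_mult[symmetric] mult.commute)
  then consider "t ^ D = 1" | "t ^ D = -1" "odd D" | "t ^ D = -1" "even D"
    by (auto simp: power2_eq_1_iff)
  then show ?thesis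
  proof cases
    case 1
    have "a m = 1 ^ m * b m" for m
    proof (cases "b m = 0")
      case False
      then have "t ^ m = 1" using D[of m] 1 by (auto elim!: dvdE simp: power_mult)
      then show ?thesis using a by simp
    qed (simp add: a0)
    then show ?thesis by blast
  next
    case 2
    have "a m = (-1) ^ m * b m" for m
    proof (cases "b m = 0")
      case False
      from D[OF this] obtain k where m: "m = D * k" by auto
      have "t ^ m = (-1) ^ m" using 2 by (simp add: m power_mult)
      then show ?thesis using a by simp
    qed (simp add: a0)
    then show ?thesis by blast
  next
    case 3
    then have Dpos: "D > 0" by (cases "D = 0") auto
    obtain h where h: "D = 2 * h" using 3 by auto
    have b0: "b (D * j) = 0" if "odd j" for j
    proof -
      have hj: "\<not> D dvd h * j"
      proof
        assume "D dvd h * j"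
        then have "2 * h dvd h * j" by (simp add: h)
        then have "2 dvd j" using Dpos h by (auto simp: mult.commute[of 2])
        then show False using that by simp
      qed
      then have z: "b (h * j) = 0" "a (h * j) = 0" using D a0 by blast+
      \<comment> \<open>As \<open>b\<close> vanishes at half of \<open>D j\<close>, the two relations there involve only \<open>y\<close> and \<open>U\<close>.\<close>
      define y where "y = b (D * j)"
      define U where "U = u ^ (h * j)"
      have "t ^ (D * j) = -1" using 3 that by (simp add: power_mult)
      then have ay: "a (D * j) = - y" using a(1)[of "D * j"] by (simp add: y_def)
      have "2 * (h * j) = D * j" by (simp add: h)
      then have e: "y / 2 - 1 = U * (- y / 2 - 1)" "- y / 2 - 1 = U * (y / 2 - 1)"
        using w[of "h * j", unfolded wedge2_power_sum_def \<open>2 * (h * j) = D * j\<close>] z ay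
        by (simp_all add: U_def y_def)
      have e1: "y - 2 = U * (- y - 2)" "- y - 2 = U * (y - 2)"
      proof -
        have "y - 2 = 2 * (y / 2 - 1)" by (simp add: right_diff_distrib)
        also have "\<dots> = 2 * (U * (- y / 2 - 1))" by (simp only: e(1))
        finally show "y - 2 = U * (- y - 2)" by (simp add: algebra_simps)
        have "- y - 2 = 2 * (- y / 2 - 1)" by (simp add: right_diff_distrib)
        also have "\<dots> = 2 * (U * (y / 2 - 1))" by (simp only: e(2))
        finally show "- y - 2 = U * (y - 2)" by (simp add: algebra_simps)
      qed
      have "y - 2 = U * (U * (y - 2))" by (subst e1(2)[symmetric]) (rule e1(1))
      then have "(y - 2) * (1 - U * U) = 0" by (simp add: algebra_simps)
      then consider "y = 2" | "U * U = 1" by auto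
      then have "y = 0"
      proof cases
        case 1
        then show ?thesis using e1 u by (simp add: U_def)
      next
        case 2
        then consider "U = 1" | "U = -1" by (metis power2_eq_square power2_eq_1_iff)
        then show ?thesis
        proof cases
          case 1
          with e1(1) have "y + y = 0" by (simp add: algebra_simps)
          then show ?thesis by simp
        next
          case 2
          with e1(1) show ?thesis by simp
        qed
      qed
      then show ?thesis by (simp add: y_def)
    qed
    have "2 * D dvd m" if "b m \<noteq> 0" for m
    proof -
      from D[OF that] obtain k where k: "m = D * k" by auto
      then have "even k" using b0 that by auto
      then show ?thesis by (auto simp: k)
    qed
    then have "2 * D dvd D" by (subst (2) D_def) (auto intro: Gcd_greatest)
    then show ?thesis using Dpos by (auto dest: dvd_imp_le)
  qed
qed

text \<open>
Equal power sums give equal sums of the values of any polynomial. A polynomial that vanishes at all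
entries except \<open>c\<close> then compares the multiplicities of \<open>c\<close>.
\<close>

lemma mset_eq_if_power_sums_eq:
  fixes xs ys :: "complex list"
  assumes "\<And>m. (\<Sum>x\<leftarrow>xs. x ^ m) = (\<Sum>y\<leftarrow>ys. y ^ m)"
  shows "mset xs = mset ys"
proof -
  have sp: "(\<Sum>x\<leftarrow>zs. poly p x) = (\<Sum>i\<le>degree p. coeff p i * (\<Sum>x\<leftarrow>zs. x ^ i))"
    for p :: "complex poly" and zs
    by (induction zs) (simp_all add: poly_altdef sum.distrib distrib_left)
  have eq: "(\<Sum>x\<leftarrow>xs. poly p x) = (\<Sum>x\<leftarrow>ys. poly p x)" for p
    unfolding sp assms ..
  have "count (mset xs) c = count (mset ys) c" for c
  proof -
    define S where "S = (set xs \<union> set ys) - {c}"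
    define p where "p = (\<Prod>z\<in>S. [:- z, 1:])"
    have p0: "poly p z = 0" if "z \<in> set xs \<union> set ys" "z \<noteq> c" for z
      using that by (auto simp: p_def poly_prod S_def intro!: bexI[of _ z])
    have pc: "poly p c \<noteq> 0" by (auto simp: p_def poly_prod S_def)
    have "(\<Sum>x\<leftarrow>zs. poly p x) = of_nat (count (mset zs) c) * poly p c"
      if "set zs \<subseteq> set xs \<union> set ys" for zs
      using that by (induction zs) (auto simp: p0 algebra_simps)
    from this[of xs] this[of ys] eq[of p] pc show ?thesis by simp
  qed
  then show ?thesis by (simp add: multiset_eq_iff)
qed

section \<open>Polynomial functions of one complex variable\<close>

definition polyfun :: "(complex \<Rightarrow> complex) \<Rightarrow> bool" where
  "polyfun f \<longleftrightarrow> (\<exists>p. \<forall>z. f z = poly p z)"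

lemma polyfun_const [simp, intro]: "polyfun (\<lambda>z. c)"
  unfolding polyfun_def by (rule exI[of _ "[:c:]"]) simp
lemma polyfun_id [simp, intro]: "polyfun (\<lambda>z. z)"
  unfolding polyfun_def by (rule exI[of _ "[:0, 1:]"]) simp
lemma polyfun_add [simp, intro]: "polyfun f \<Longrightarrow> polyfun g \<Longrightarrow> polyfun (\<lambda>z. f z + g z)"
  unfolding polyfun_def by (metis poly_add)
lemma polyfun_mult [simp, intro]: "polyfun f \<Longrightarrow> polyfun g \<Longrightarrow> polyfun (\<lambda>z. f z * g z)"
  unfolding polyfun_def by (metis poly_mult)
lemma polyfun_uminus [simp, intro]: "polyfun f \<Longrightarrow> polyfun (\<lambda>z. - f z)"
  using polyfun_mult[of "\<lambda>z. -1" f] by simp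
lemma polyfun_diff [simp, intro]: "polyfun f \<Longrightarrow> polyfun g \<Longrightarrow> polyfun (\<lambda>z. f z - g z)"
  using polyfun_add[of f "\<lambda>z. - g z"] by simp
lemma polyfun_power [simp, intro]: "polyfun f \<Longrightarrow> polyfun (\<lambda>z. f z ^ n)"
  by (induction n) auto
lemma polyfun_sum [intro]: "(\<And>i. i \<in> I \<Longrightarrow> polyfun (f i)) \<Longrightarrow> polyfun (\<lambda>z. \<Sum>i\<in>I. f i z)"
  by (induction I rule: infinite_finite_induct) auto
lemma polyfun_prod [intro]: "(\<And>i. i \<in> I \<Longrightarrow> polyfun (f i)) \<Longrightarrow> polyfun (\<lambda>z. \<Prod>i\<in>I. f i z)"
  by (induction I rule: infinite_finite_induct) auto

lemma polyfun_mult_eq_zero: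
  assumes "polyfun f" "polyfun g" "\<And>z. f z * g z = 0" "g z0 \<noteq> 0"
  shows "f z = 0"
proof -
  obtain p q where p: "\<And>z. f z = poly p z" and q: "\<And>z. g z = poly q z"
    using assms by (auto simp: polyfun_def)
  have "poly (p * q) z = 0" for z using assms(3) by (simp add: p q)
  then have "p * q = 0" using poly_all_0_iff_0 by blast
  then show ?thesis using assms(4) by (auto simp: p q)
qed

lemma polyfun_eq_zero_at_zero:
  assumes "polyfun f" "\<And>z. z \<noteq> 0 \<Longrightarrow> f z = 0"
  shows "f 0 = 0"
  by (rule polyfun_mult_eq_zero[OF assms(1) polyfun_id _ one_neq_zero]) (use assms(2) in auto)

section \<open>The symplectic group and its form\<close>

lemma mult_mat_vec_index:
  assumes "A \<in> carrier_mat m n" "x \<in> carrier_vec n" "i < m"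
  shows "(A *\<^sub>v x) $ i = (\<Sum>j<n. A $$ (i, j) * x $ j)"
  using assms by (auto simp: scalar_prod_def lessThan_atLeast0)

lemma mult_mat_index:
  assumes "A \<in> carrier_mat m n" "B \<in> carrier_mat n p" "i < m" "j < p"
  shows "(A * B) $$ (i, j) = (\<Sum>k<n. A $$ (i, k) * B $$ (k, j))"
  using assms by (auto simp: scalar_prod_def lessThan_atLeast0)

lemma mult_unit_vec_index:
  fixes A :: "complex mat"
  assumes "A \<in> carrier_mat m n" "i < m" "j < n"
  shows "(A *\<^sub>v unit_vec n j) $ i = A $$ (i, j)"
  using assms by simp

lemma scalar_prod_transpose:
  fixes A :: "complex mat"
  assumes "A \<in> carrier_mat n n" "x \<in> carrier_vec n" "z \<in> carrier_vec n"
  shows "x \<bullet> (transpose_mat A *\<^sub>v z) = (A *\<^sub>v x) \<bullet> z"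
proof -
  have "x \<bullet> (transpose_mat A *\<^sub>v z) = (transpose_mat A *\<^sub>v z) \<bullet> x"
    by (rule comm_scalar_prod[of _ n]) (use assms in \<open>auto intro!: mult_mat_vec_carrier[of _ n n]\<close>)
  also have "\<dots> = z \<bullet> (A *\<^sub>v x)" by (rule transpose_vec_mult_scalar) (use assms in auto)
  also have "\<dots> = (A *\<^sub>v x) \<bullet> z"
    by (rule comm_scalar_prod[of _ n]) (use assms in \<open>auto intro!: mult_mat_vec_carrier[of _ n n]\<close>)
  finally show ?thesis .
qed

text \<open>
Entries of products are expanded into sums only where this is asked for.
\<close>

declare index_mult_mat(1) [simp del] index_mult_mat_vec [simp del]

lemma sympl_form_carrier [simp]: "sympl_form l \<in> carrier_mat (2 * l) (2 * l)"
  and sympl_form_dim [simp]: "dim_row (sympl_form l) = 2 * l" "dim_col (sympl_form l) = 2 * l"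
  by (simp_all add: sympl_form_def)

lemma sympl_form_index:
  "i < 2 * l \<Longrightarrow> j < 2 * l \<Longrightarrow> sympl_form l $$ (i, j) =
     (if i + j + 1 = 2 * l then (if i < l then 1 else - 1) else 0)"
  by (simp add: sympl_form_def)

lemma sum_antidiagonal:
  fixes f :: "nat \<Rightarrow> complex"
  assumes "i < 2 * l"
  shows "(\<Sum>j<2*l. (if i + j + 1 = 2 * l then f j else 0)) = f (2 * l - 1 - i)"
proof -
  have "(\<Sum>j<2*l. (if i + j + 1 = 2 * l then f j else 0)) = (\<Sum>j<2*l. (if j = 2 * l - 1 - i then f j else 0))"
    by (rule sum.cong) (use assms in auto)
  then show ?thesis using assms by simp
qed

lemma transpose_sympl_form: "transpose_mat (sympl_form l) = - sympl_form l"
  by (rule eq_matI) (auto simp: sympl_form_def)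

lemma sympl_form_square: "sympl_form l * sympl_form l = - 1\<^sub>m (2 * l)"
proof (rule eq_matI)
  fix i j assume "i < dim_row (- 1\<^sub>m (2 * l) :: complex mat)" "j < dim_col (- 1\<^sub>m (2 * l) :: complex mat)"
  then have ij: "i < 2 * l" "j < 2 * l" by auto
  have "(sympl_form l * sympl_form l) $$ (i, j) =
      (\<Sum>k<2*l. sympl_form l $$ (i, k) * sympl_form l $$ (k, j))"
    by (rule mult_mat_index) (use ij in auto)
  also have "\<dots> = (\<Sum>k<2*l. (if i + k + 1 = 2 * l then (if i < l then 1 else - 1) * sympl_form l $$ (k, j) else 0))"
    by (rule sum.cong) (use ij in \<open>auto simp: sympl_form_index\<close>)
  also have "\<dots> = (if i < l then 1 else - 1) * sympl_form l $$ (2 * l - 1 - i, j)"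
    by (rule sum_antidiagonal[OF ij(1)])
  also have "\<dots> = (- 1\<^sub>m (2 * l) :: complex mat) $$ (i, j)"
    using ij by (auto simp: sympl_form_index)
  finally show "(sympl_form l * sympl_form l) $$ (i, j) = (- 1\<^sub>m (2 * l)) $$ (i, j)" .
qed auto

lemma sympl_form_inverse:
  obtains J' where "J' \<in> carrier_mat (2 * l) (2 * l)" "J' = - sympl_form l"
    "J' * sympl_form l = 1\<^sub>m (2 * l)" "sympl_form l * J' = 1\<^sub>m (2 * l)"
  using sympl_form_square[of l] by (intro that[of "- sympl_form l"]) simp_all

text \<open>
Invertibility is automatic, because the form is nondegenerate: \<open>- J A\<^sup>T J\<close> is a left inverse of \<open>A\<close>.
\<close>

lemma Sp_iff:
  "A \<in> carrier (Sp l) \<longleftrightarrow>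
     A \<in> carrier_mat (2 * l) (2 * l) \<and> transpose_mat A * sympl_form l * A = sympl_form l"
proof
  assume "A \<in> carrier (Sp l)"
  then show "A \<in> carrier_mat (2 * l) (2 * l) \<and> transpose_mat A * sympl_form l * A = sympl_form l"
    by (auto simp: Sp_def dest: GL_carrier_mat)
next
  assume A: "A \<in> carrier_mat (2 * l) (2 * l) \<and> transpose_mat A * sympl_form l * A = sympl_form l"
  obtain J' where J': "J' \<in> carrier_mat (2 * l) (2 * l)" "J' * sympl_form l = 1\<^sub>m (2 * l)"
    by (rule sympl_form_inverse)
  define B where "B = J' * (transpose_mat A * sympl_form l)"
  have B: "B \<in> carrier_mat (2 * l) (2 * l)" using A J' by (auto simp: B_def)
  have "B * A = J' * (transpose_mat A * sympl_form l * A)"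
    using conjunct1[OF A] J'(1) by (simp add: B_def assoc_mult_mat[of _ "2*l" "2*l" _ "2*l" _ "2*l"])
  then have l: "B * A = 1\<^sub>m (2 * l)" unfolding conjunct2[OF A] J' .
  have "A * B = 1\<^sub>m (2 * l)"
    by (rule mat_mult_left_right_inverse[OF B _ l]) (use A in auto)
  then have "A \<in> carrier (GL (2 * l))"
    using A B l by (auto simp: GL_def units_of_def Units_def ring_mat_simps)
  then show "A \<in> carrier (Sp l)" using A by (simp add: Sp_def)
qed

lemma Sp_carrier_mat: "A \<in> carrier (Sp l) \<Longrightarrow> A \<in> carrier_mat (2 * l) (2 * l)"
  by (simp add: Sp_iff)

lemma Sp_simps [simp]:
  "A \<otimes>\<^bsub>Sp l\<^esub> B = A * B" "\<one>\<^bsub>Sp l\<^esub> = 1\<^sub>m (2 * l)"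
  by (simp_all add: Sp_def)

lemma Sp_mult: "A \<in> carrier (Sp l) \<Longrightarrow> B \<in> carrier (Sp l) \<Longrightarrow> A * B \<in> carrier (Sp l)"
  using monoid.m_closed[OF group.is_monoid[OF Sp_group]] by fastforce

lemma Sp_one: "1\<^sub>m (2 * l) \<in> carrier (Sp l)"
  using monoid.one_closed[OF group.is_monoid[OF Sp_group]] by fastforce

lemma Sp_inverse:
  assumes A: "A \<in> carrier (Sp l)"
  defines "B \<equiv> (- sympl_form l) * (transpose_mat A * sympl_form l)"
  shows "B * A = 1\<^sub>m (2 * l)" "A * B = 1\<^sub>m (2 * l)" "B \<in> carrier_mat (2 * l) (2 * l)"
proof -
  obtain J' where J': "J' \<in> carrier_mat (2 * l) (2 * l)" "J' = - sympl_form l"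
    "J' * sympl_form l = 1\<^sub>m (2 * l)"
    by (rule sympl_form_inverse)
  have A': "A \<in> carrier_mat (2 * l) (2 * l)" "transpose_mat A * sympl_form l * A = sympl_form l"
    using A by (auto simp: Sp_iff)
  have B': "B = J' * (transpose_mat A * sympl_form l)" by (simp add: B_def J')
  have "B * A = J' * (transpose_mat A * sympl_form l * A)"
    using A'(1) J'(1) by (simp add: B' assoc_mult_mat[of _ "2*l" "2*l" _ "2*l" _ "2*l"])
  then show l: "B * A = 1\<^sub>m (2 * l)" unfolding A'(2) J'(3) .
  show B: "B \<in> carrier_mat (2 * l) (2 * l)" using A' J'(1) by (auto simp: B')
  show "A * B = 1\<^sub>m (2 * l)" by (rule mat_mult_left_right_inverse[OF B A'(1) l])
qed

text \<open>
This is the identity \<open>A (- J A\<^sup>T J) = 1\<close> multiplied by \<open>- J\<close> on the right. It shows that \<open>Sp l\<close> is closed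
under transposition.
\<close>

lemma Sp_transpose_form:
  assumes "A \<in> carrier (Sp l)"
  shows "A * sympl_form l * transpose_mat A = sympl_form l"
proof -
  let ?J = "sympl_form l"
  obtain J' where J': "J' \<in> carrier_mat (2 * l) (2 * l)" "J' = - ?J"
    "J' * ?J = 1\<^sub>m (2 * l)" "?J * J' = 1\<^sub>m (2 * l)"
    by (rule sympl_form_inverse)
  have A: "A \<in> carrier_mat (2 * l) (2 * l)" using assms by (rule Sp_carrier_mat)
  have JJ: "J' * J' = - 1\<^sub>m (2 * l)"
    by (simp add: J' sympl_form_square)
  have "A * (J' * (transpose_mat A * ?J)) * J' = 1\<^sub>m (2 * l) * J'"
    using Sp_inverse(2)[OF assms] by (simp add: J')
  then have "A * (J' * (transpose_mat A * (?J * J'))) = J'"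
    using A J'(1) by (simp add: assoc_mult_mat[of _ "2*l" "2*l" _ "2*l" _ "2*l"])
  then have "A * J' * transpose_mat A = J'"
    using A J'(1) by (simp add: J'(4) assoc_mult_mat[of _ "2*l" "2*l" _ "2*l" _ "2*l"])
  then have "- (A * ?J * transpose_mat A) = - ?J"
    using A by (simp add: J')
  then show ?thesis by (metis uminus_uminus_mat)
qed

lemma Sp_transpose: "A \<in> carrier (Sp l) \<Longrightarrow> transpose_mat A \<in> carrier (Sp l)"
  using Sp_transpose_form[of A l] Sp_carrier_mat[of A l] by (simp add: Sp_iff)

definition symp :: "nat \<Rightarrow> complex vec \<Rightarrow> complex vec \<Rightarrow> complex" where
  "symp l x y = (\<Sum>i<2*l. (if i < l then 1 else - 1) * x $ i * y $ (2 * l - 1 - i))"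

lemma scalar_prod_sympl_form:
  assumes "x \<in> carrier_vec (2 * l)" "y \<in> carrier_vec (2 * l)"
  shows "x \<bullet> (sympl_form l *\<^sub>v y) = symp l x y"
proof -
  have "(sympl_form l *\<^sub>v y) $ i = (if i < l then 1 else - 1) * y $ (2 * l - 1 - i)"
    if i: "i < 2 * l" for i
  proof -
    have "(sympl_form l *\<^sub>v y) $ i = (\<Sum>j<2*l. sympl_form l $$ (i, j) * y $ j)"
      by (rule mult_mat_vec_index) (use assms i in auto)
    also have "\<dots> = (\<Sum>j<2*l. (if i + j + 1 = 2 * l then (if i < l then 1 else - 1) * y $ j else 0))"
      by (rule sum.cong) (use i in \<open>auto simp: sympl_form_index\<close>)
    also have "\<dots> = (if i < l then 1 else - 1) * y $ (2 * l - 1 - i)"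
      by (rule sum_antidiagonal[OF i])
    finally show ?thesis .
  qed
  then show ?thesis
    using assms unfolding scalar_prod_def symp_def
    by (intro sum.cong) (auto simp: lessThan_atLeast0)
qed

lemma symp_add_left: "x \<in> carrier_vec (2 * l) \<Longrightarrow> y \<in> carrier_vec (2 * l) \<Longrightarrow> symp l (x + y) z = symp l x z + symp l y z"
  unfolding symp_def sum.distrib[symmetric] by (rule sum.cong) (auto simp: algebra_simps)

lemma symp_add_right: "y \<in> carrier_vec (2 * l) \<Longrightarrow> z \<in> carrier_vec (2 * l) \<Longrightarrow> symp l x (y + z) = symp l x y + symp l x z"
  unfolding symp_def sum.distrib[symmetric] by (rule sum.cong) (auto simp: algebra_simps)

lemma symp_smult_left: "x \<in> carrier_vec (2 * l) \<Longrightarrow> symp l (c \<cdot>\<^sub>v x) z = c * symp l x z"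
  unfolding symp_def sum_distrib_left by (rule sum.cong) (auto simp: algebra_simps)

lemma symp_smult_right: "y \<in> carrier_vec (2 * l) \<Longrightarrow> symp l x (c \<cdot>\<^sub>v y) = c * symp l x y"
  unfolding symp_def sum_distrib_left by (rule sum.cong) (auto simp: algebra_simps)

lemma symp_minus_left: "x \<in> carrier_vec (2 * l) \<Longrightarrow> y \<in> carrier_vec (2 * l) \<Longrightarrow> symp l (x - y) z = symp l x z - symp l y z"
  unfolding symp_def sum_subtractf[symmetric] by (rule sum.cong) (auto simp: algebra_simps)

lemma symp_minus_right: "y \<in> carrier_vec (2 * l) \<Longrightarrow> z \<in> carrier_vec (2 * l) \<Longrightarrow> symp l x (y - z) = symp l x y - symp l x z"
  unfolding symp_def sum_subtractf[symmetric] by (rule sum.cong) (auto simp: algebra_simps)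

lemmas symp_linear = symp_add_left symp_add_right symp_smult_left symp_smult_right
  symp_minus_left symp_minus_right

lemma symp_swap: "symp l y x = - symp l x y"
proof -
  have "symp l y x = (\<Sum>i<2*l. (if 2*l - Suc i < l then 1 else - 1) * y $ (2*l - Suc i) * x $ (2 * l - 1 - (2*l - Suc i)))"
    unfolding symp_def by (rule sum.nat_diff_reindex[symmetric])
  also have "\<dots> = - symp l x y"
    unfolding symp_def sum_negf[symmetric] by (rule sum.cong) auto
  finally show ?thesis .
qed

lemma symp_self [simp]: "symp l x x = 0"
  using symp_swap[of l x x] by simp

lemma symp_unit_left:
  assumes "i < 2 * l" "y \<in> carrier_vec (2 * l)"
  shows "symp l (unit_vec (2 * l) i) y = (if i < l then y $ (2 * l - 1 - i) else - y $ (2 * l - 1 - i))"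
proof -
  have "symp l (unit_vec (2 * l) i) y =
     (\<Sum>j<2*l. if j = i then (if i < l then y $ (2 * l - 1 - i) else - y $ (2 * l - 1 - i)) else 0)"
    unfolding symp_def by (rule sum.cong) (use assms in auto)
  then show ?thesis using assms by simp
qed

lemma symp_unit_right:
  assumes "i < 2 * l" "y \<in> carrier_vec (2 * l)"
  shows "symp l y (unit_vec (2 * l) i) = (if i < l then - y $ (2 * l - 1 - i) else y $ (2 * l - 1 - i))"
  using symp_swap[of l y "unit_vec (2*l) i"] symp_unit_left[OF assms] by auto

lemma transpose_form_index:
  assumes A: "A \<in> carrier_mat (2 * l) (2 * l)" and ij: "i < 2 * l" "j < 2 * l"
  shows "(transpose_mat A * sympl_form l * A) $$ (i, j) =
    symp l (A *\<^sub>v unit_vec (2 * l) i) (A *\<^sub>v unit_vec (2 * l) j)"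
proof -
  let ?u = "\<lambda>k. unit_vec (2 * l) k :: complex vec"
  have "(transpose_mat A * sympl_form l * A) $$ (i, j) =
      ?u i \<bullet> ((transpose_mat A * sympl_form l * A) *\<^sub>v ?u j)"
    using A ij by (subst scalar_prod_left_unit[of _ "2*l"])
      (auto intro!: mult_unit_vec_index[symmetric, of _ "2*l" "2*l"] mult_mat_vec_carrier[of _ _ "2*l"])
  also have "(transpose_mat A * sympl_form l * A) *\<^sub>v ?u j =
      transpose_mat A *\<^sub>v (sympl_form l *\<^sub>v (A *\<^sub>v ?u j))"
    using A by (simp add: assoc_mult_mat_vec[of _ "2*l" "2*l" _ "2*l"])
  also have "?u i \<bullet> \<dots> = (A *\<^sub>v ?u i) \<bullet> (sympl_form l *\<^sub>v (A *\<^sub>v ?u j))"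
    by (rule scalar_prod_transpose[of _ "2*l"])
      (use A ij in \<open>auto intro!: mult_mat_vec_carrier[of _ "2*l" "2*l"]\<close>)
  finally show ?thesis using A by (simp add: scalar_prod_sympl_form)
qed

lemma SpI_symp:
  assumes A: "A \<in> carrier_mat (2 * l) (2 * l)"
    and "\<And>x y. x \<in> carrier_vec (2 * l) \<Longrightarrow> y \<in> carrier_vec (2 * l) \<Longrightarrow>
      symp l (A *\<^sub>v x) (A *\<^sub>v y) = symp l x y"
  shows "A \<in> carrier (Sp l)"
proof -
  have "transpose_mat A * sympl_form l * A = sympl_form l"
  proof (rule eq_matI)
    fix i j assume "i < dim_row (sympl_form l)" "j < dim_col (sympl_form l)"
    then have ij: "i < 2 * l" "j < 2 * l" by (auto simp: sympl_form_def)
    show "(transpose_mat A * sympl_form l * A) $$ (i, j) = sympl_form l $$ (i, j)"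
      using assms ij by (auto simp: transpose_form_index symp_unit_left sympl_form_index)
  qed (use A in auto)
  then show ?thesis using A by (simp add: Sp_iff)
qed

lemma Sp_symp:
  assumes "A \<in> carrier (Sp l)" "x \<in> carrier_vec (2 * l)" "y \<in> carrier_vec (2 * l)"
  shows "symp l (A *\<^sub>v x) (A *\<^sub>v y) = symp l x y"
proof -
  have A: "A \<in> carrier_mat (2 * l) (2 * l)" "transpose_mat A * sympl_form l * A = sympl_form l"
    using assms by (auto simp: Sp_iff)
  have "symp l x y = x \<bullet> ((transpose_mat A * sympl_form l * A) *\<^sub>v y)"
    unfolding A(2) using assms by (simp add: scalar_prod_sympl_form)
  also have "\<dots> = x \<bullet> (transpose_mat A *\<^sub>v (sympl_form l *\<^sub>v (A *\<^sub>v y)))"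
    using A(1) assms by (simp add: assoc_mult_mat_vec[of _ "2*l" "2*l" _ "2*l"])
  also have "\<dots> = (A *\<^sub>v x) \<bullet> (sympl_form l *\<^sub>v (A *\<^sub>v y))"
    by (rule scalar_prod_transpose[of _ "2*l"])
      (use A(1) assms in \<open>auto intro!: mult_mat_vec_carrier[of _ "2*l" "2*l"]\<close>)
  finally show ?thesis using A assms by (simp add: scalar_prod_sympl_form)
qed

text \<open>
The matrix of the map that sends \<open>x\<close> to \<open>x + c * symp l w x * w\<close>.
\<close>

definition transvection :: "nat \<Rightarrow> complex \<Rightarrow> complex vec \<Rightarrow> complex mat" where
  "transvection l c w = mat (2 * l) (2 * l) (\<lambda>(i, j).
     (if i = j then 1 else 0) + c * w $ i * symp l w (unit_vec (2 * l) j))"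

lemma transvection_carrier [simp]: "transvection l c w \<in> carrier_mat (2 * l) (2 * l)"
  by (simp add: transvection_def)

lemma symp_expand_right:
  assumes "x \<in> carrier_vec (2 * l)" "y \<in> carrier_vec (2 * l)"
  shows "symp l x y = (\<Sum>j<2*l. symp l x (unit_vec (2 * l) j) * y $ j)"
proof -
  have "symp l x y = (\<Sum>i<2*l. (if i < l then 1 else - 1) * x $ i * y $ (2 * l - 1 - i))"
    by (simp add: symp_def)
  also have "\<dots> = (\<Sum>i<2*l. (if 2*l - Suc i < l then 1 else - 1) * x $ (2*l - Suc i) * y $ (2 * l - 1 - (2*l - Suc i)))"
    by (rule sum.nat_diff_reindex[symmetric])
  also have "\<dots> = (\<Sum>j<2*l. symp l x (unit_vec (2 * l) j) * y $ j)"
    by (rule sum.cong) (use assms in \<open>auto simp: symp_unit_right\<close>)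
  finally show ?thesis .
qed

lemma transvection_mult_vec:
  assumes "w \<in> carrier_vec (2 * l)" "x \<in> carrier_vec (2 * l)"
  shows "transvection l c w *\<^sub>v x = x + (c * symp l w x) \<cdot>\<^sub>v w"
proof (rule eq_vecI)
  fix i assume "i < dim_vec (x + (c * symp l w x) \<cdot>\<^sub>v w)"
  then have i: "i < 2 * l" using assms by auto
  have "(transvection l c w *\<^sub>v x) $ i = (\<Sum>j<2*l. transvection l c w $$ (i, j) * x $ j)"
    by (rule mult_mat_vec_index) (use i assms in auto)
  also have "\<dots> = (\<Sum>j<2*l. (if j = i then x $ j else 0) + c * w $ i * (symp l w (unit_vec (2 * l) j) * x $ j))"
    by (rule sum.cong) (use i in \<open>auto simp: transvection_def algebra_simps\<close>)
  also have "\<dots> = x $ i + c * w $ i * symp l w x"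
    using i by (simp add: sum.distrib sum_distrib_left[symmetric] symp_expand_right[OF assms])
  finally show "(transvection l c w *\<^sub>v x) $ i = (x + (c * symp l w x) \<cdot>\<^sub>v w) $ i"
    using i assms by (simp add: algebra_simps)
qed (use assms in \<open>auto simp: transvection_def\<close>)

lemma transvection_Sp:
  assumes "w \<in> carrier_vec (2 * l)"
  shows "transvection l c w \<in> carrier (Sp l)"
proof (rule SpI_symp)
  fix x y :: "complex vec" assume "x \<in> carrier_vec (2 * l)" "y \<in> carrier_vec (2 * l)"
  then show "symp l (transvection l c w *\<^sub>v x) (transvection l c w *\<^sub>v y) = symp l x y"
    using assms symp_swap[of l x w] by (simp add: transvection_mult_vec symp_linear)
qed simp

lemma mat_eq_by_vec:
  assumes "A \<in> carrier_mat m n" "B \<in> carrier_mat m n"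
    and "\<And>j. j < n \<Longrightarrow> A *\<^sub>v unit_vec n j = B *\<^sub>v unit_vec n j"
  shows "(A :: complex mat) = B"
proof (rule eq_matI)
  fix i j assume "i < dim_row B" "j < dim_col B"
  then show "A $$ (i, j) = B $$ (i, j)"
    using assms mult_unit_vec_index[of A m n i j] mult_unit_vec_index[of B m n i j] by auto
qed (use assms in auto)

lemma transvection_inverse:
  assumes "w \<in> carrier_vec (2 * l)"
  shows "transvection l (- c) w * transvection l c w = 1\<^sub>m (2 * l)"
proof (rule mat_eq_by_vec)
  fix j assume "j < 2 * l"
  let ?u = "unit_vec (2 * l) j :: complex vec"
  have "transvection l (- c) w * transvection l c w *\<^sub>v ?u
      = transvection l (- c) w *\<^sub>v (transvection l c w *\<^sub>v ?u)"
    by (rule assoc_mult_mat_vec[of _ "2*l" "2*l" _ "2*l"]) auto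
  also have "\<dots> = ?u"
    using assms by (intro eq_vecI) (auto simp: transvection_mult_vec symp_linear)
  finally show "transvection l (- c) w * transvection l c w *\<^sub>v ?u = 1\<^sub>m (2 * l) *\<^sub>v ?u" by simp
qed (auto intro!: mult_carrier_mat[of _ "2*l" "2*l"])

section \<open>Polynomial curves in the symplectic group\<close>

definition poly_curve :: "nat \<Rightarrow> (complex \<Rightarrow> complex mat) \<Rightarrow> bool" where
  "poly_curve m \<gamma> \<longleftrightarrow> (\<forall>z. \<gamma> z \<in> carrier_mat m m) \<and> (\<forall>i<m. \<forall>j<m. polyfun (\<lambda>z. \<gamma> z $$ (i, j)))"

lemma poly_curve_const: "A \<in> carrier_mat m m \<Longrightarrow> poly_curve m (\<lambda>_. A)"
  by (simp add: poly_curve_def)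

lemma poly_curve_mult:
  assumes "poly_curve m \<gamma>" "poly_curve m \<delta>"
  shows "poly_curve m (\<lambda>z. \<gamma> z * \<delta> z)"
proof -
  have c: "\<And>z. \<gamma> z \<in> carrier_mat m m" "\<And>z. \<delta> z \<in> carrier_mat m m"
    using assms by (auto simp: poly_curve_def)
  have "polyfun (\<lambda>z. (\<gamma> z * \<delta> z) $$ (i, j))" if "i < m" "j < m" for i j
    unfolding mult_mat_index[OF c that]
    by (intro polyfun_sum polyfun_mult) (use assms that in \<open>auto simp: poly_curve_def\<close>)
  then show ?thesis using c by (auto simp: poly_curve_def intro!: mult_carrier_mat[of _ m m])
qed

lemma poly_curve_transvection: "poly_curve (2 * l) (\<lambda>z. transvection l (c * z) w)"
  by (auto simp: poly_curve_def transvection_def)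

text \<open>
The only property of polynomial functions on matrices that is used below. Unlike membership in
\<open>mat_poly_fun\<close>, it is immediate for determinants of submatrices.
\<close>

definition regular_on_curves :: "nat \<Rightarrow> (complex mat \<Rightarrow> complex) \<Rightarrow> bool" where
  "regular_on_curves m p \<longleftrightarrow> (\<forall>\<gamma>. poly_curve m \<gamma> \<longrightarrow> polyfun (\<lambda>z. p (\<gamma> z)))"

lemma regular_on_curves_mat_poly_fun: "p \<in> mat_poly_fun m \<Longrightarrow> regular_on_curves m p"
  unfolding regular_on_curves_def
  by (induction rule: mat_poly_fun.induct) (auto simp: poly_curve_def)

inductive_set transvection_group :: "nat \<Rightarrow> complex mat set" for l where
  one: "1\<^sub>m (2 * l) \<in> transvection_group l"
| step: "w \<in> carrier_vec (2 * l) \<Longrightarrow> A \<in> transvection_group l \<Longrightarrow>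
    transvection l c w * A \<in> transvection_group l"

lemma transvection_group_cancel:
  assumes "w \<in> carrier_vec (2 * l)" "A \<in> carrier_mat (2 * l) (2 * l)"
    and "transvection l c w * A \<in> transvection_group l"
  shows "A \<in> transvection_group l"
proof -
  have "transvection l (- c) w * (transvection l c w * A) = A"
    using assms(2) transvection_inverse[OF assms(1)]
    by (simp add: assoc_mult_mat[of _ "2*l" "2*l" _ "2*l" _ "2*l", symmetric])
  then show ?thesis using transvection_group.step[OF assms(1,3), of "- c"] by simp
qed

text \<open>
A product of transvections is deformed to 1 by scaling the parameters of all factors.
\<close>

lemma transvection_group_connected:
  "A \<in> transvection_group l \<Longrightarrow>
    \<exists>\<gamma>. poly_curve (2 * l) \<gamma> \<and> (\<forall>z. \<gamma> z \<in> carrier (Sp l)) \<and> \<gamma> 0 = 1\<^sub>m (2 * l) \<and> \<gamma> 1 = A"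
proof (induction rule: transvection_group.induct)
  case one
  then show ?case by (intro exI[of _ "\<lambda>_. 1\<^sub>m (2 * l)"]) (simp add: poly_curve_const Sp_one)
next
  case (step w A c)
  then obtain \<gamma> where \<gamma>: "poly_curve (2 * l) \<gamma>" "\<And>z. \<gamma> z \<in> carrier (Sp l)" "\<gamma> 0 = 1\<^sub>m (2 * l)" "\<gamma> 1 = A"
    by auto
  have "transvection l 0 w = 1\<^sub>m (2 * l)" by (rule eq_matI) (auto simp: transvection_def)
  then show ?case
    using \<gamma> step.hyps
    by (intro exI[of _ "\<lambda>z. transvection l (c * z) w * \<gamma> z"])
      (auto intro!: poly_curve_mult poly_curve_transvection Sp_mult transvection_Sp)
qed

text \<open>
The first \<open>j\<close> and the last \<open>j\<close> basis vectors are fixed. They span \<open>j\<close> hyperbolic planes, whose orthogonal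
complement is \<open>inner_vec l j\<close>.
\<close>

definition fixes_outer :: "nat \<Rightarrow> nat \<Rightarrow> complex mat \<Rightarrow> bool" where
  "fixes_outer l j A \<longleftrightarrow> (\<forall>i<j. A *\<^sub>v unit_vec (2 * l) i = unit_vec (2 * l) i \<and>
     A *\<^sub>v unit_vec (2 * l) (2 * l - 1 - i) = unit_vec (2 * l) (2 * l - 1 - i))"

definition inner_vec :: "nat \<Rightarrow> nat \<Rightarrow> complex vec set" where
  "inner_vec l j = {w \<in> carrier_vec (2 * l). \<forall>i<j. w $ i = 0 \<and> w $ (2 * l - 1 - i) = 0}"

text \<open>
Along the difference \<open>u - v\<close>, a transvection adds a multiple of \<open>u - v\<close> to \<open>u\<close>. Its parameter can be
normalized so that this multiple is \<open>- (u - v)\<close>, because \<open>symp l (u - v) u = symp l u v\<close> is not zero.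
\<close>

lemma transvection_move:
  assumes "u \<in> carrier_vec (2 * l)" "v \<in> carrier_vec (2 * l)" "symp l u v \<noteq> 0"
  shows "transvection l (- 1 / symp l u v) (u - v) *\<^sub>v u = v"
proof -
  have "symp l (u - v) u = symp l u v"
    using assms symp_swap[of l v u] by (simp add: symp_linear)
  then show ?thesis
    using assms by (subst transvection_mult_vec) (auto simp: symp_linear)
qed

lemma transvection_fixes:
  assumes "w \<in> carrier_vec (2 * l)" "x \<in> carrier_vec (2 * l)" "symp l w x = 0"
  shows "transvection l c w *\<^sub>v x = x"
  using assms by (subst transvection_mult_vec) auto

lemma fixes_outer_transvection_mult:
  assumes "fixes_outer l j A" "w \<in> inner_vec l j" "A \<in> carrier_mat (2 * l) (2 * l)" "j \<le> l"
  shows "fixes_outer l j (transvection l c w * A)"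
  unfolding fixes_outer_def
proof (intro allI impI)
  fix i assume i: "i < j"
  have w: "w \<in> carrier_vec (2 * l)" "w $ i = 0" "w $ (2 * l - 1 - i) = 0"
    using assms i by (auto simp: inner_vec_def)
  have "(transvection l c w * A) *\<^sub>v unit_vec (2 * l) k = unit_vec (2 * l) k"
    if "k = i \<or> k = 2 * l - 1 - i" for k
  proof -
    have k: "k < 2 * l" using that i assms by auto
    have "(transvection l c w * A) *\<^sub>v unit_vec (2 * l) k = transvection l c w *\<^sub>v (A *\<^sub>v unit_vec (2 * l) k)"
      using assms by (simp add: assoc_mult_mat_vec[of _ "2*l" "2*l" _ "2*l"])
    also have "A *\<^sub>v unit_vec (2 * l) k = unit_vec (2 * l) k"
      using assms(1) i that by (auto simp: fixes_outer_def)
    also have "transvection l c w *\<^sub>v unit_vec (2 * l) k = unit_vec (2 * l) k"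
      by (rule transvection_fixes)
        (use w k that i assms in \<open>auto simp: symp_unit_right\<close>)
    finally show ?thesis .
  qed
  then show "transvection l c w * A *\<^sub>v unit_vec (2 * l) i = unit_vec (2 * l) i \<and>
    transvection l c w * A *\<^sub>v unit_vec (2 * l) (2 * l - 1 - i) = unit_vec (2 * l) (2 * l - 1 - i)" by blast
qed

lemma fixes_outer_inner_vec:
  assumes A: "A \<in> carrier (Sp l)" "fixes_outer l j A" "j \<le> l" and k: "j \<le> k" "k + j < 2 * l"
  shows "A *\<^sub>v unit_vec (2 * l) k \<in> inner_vec l j"
proof -
  let ?u = "unit_vec (2 * l) :: nat \<Rightarrow> complex vec"
  have Ac: "A *\<^sub>v ?u k \<in> carrier_vec (2 * l)"
    using Sp_carrier_mat[OF A(1)] by (auto intro: mult_mat_vec_carrier[of _ "2*l" "2*l"])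
  have z: "symp l (A *\<^sub>v ?u k) (?u m) = 0" if "m < j \<or> (\<exists>i<j. m = 2 * l - 1 - i)" for m
  proof -
    have "A *\<^sub>v ?u m = ?u m" using A(2) that by (auto simp: fixes_outer_def)
    then have "symp l (A *\<^sub>v ?u k) (?u m) = symp l (A *\<^sub>v ?u k) (A *\<^sub>v ?u m)" by simp
    also have "\<dots> = symp l (?u k) (?u m)" by (rule Sp_symp[OF A(1)]) auto
    also have "\<dots> = 0" using that k assms(3) by (auto simp: symp_unit_right)
    finally show ?thesis .
  qed
  have "(A *\<^sub>v ?u k) $ i = 0 \<and> (A *\<^sub>v ?u k) $ (2 * l - 1 - i) = 0" if i: "i < j" for i
  proof -
    have "symp l (A *\<^sub>v ?u k) (?u i) = 0" "symp l (A *\<^sub>v ?u k) (?u (2 * l - 1 - i)) = 0"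
      using z i by auto
    then show ?thesis using i assms(3) Ac by (auto simp: symp_unit_right split: if_splits)
  qed
  then show ?thesis using Ac by (auto simp: inner_vec_def)
qed

text \<open>
Gaussian elimination with transvections, by induction on the number of hyperbolic planes that are not yet
fixed. Given \<open>A\<close>, transvections along inner vectors move the image of the \<open>j\<close>-th basis vector back to this
vector, and then the image of its partner back to the partner. If a move is obstructed because the two
vectors are orthogonal, an intermediate vector that is orthogonal to neither of them is used.
\<close>

lemma transvection_group_elimination:
  assumes "A \<in> carrier (Sp l)" "fixes_outer l j A" "j \<le> l"
  shows "A \<in> transvection_group l"
  using assms
proof (induction "l - j" arbitrary: j A)
  case 0
  then have j: "j = l" by simp
  have A: "A \<in> carrier_mat (2 * l) (2 * l)" using 0 Sp_carrier_mat by auto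
  have "A = 1\<^sub>m (2 * l)"
  proof (rule mat_eq_by_vec[OF A one_carrier_mat])
    fix k assume k: "k < 2 * l"
    show "A *\<^sub>v unit_vec (2 * l) k = 1\<^sub>m (2 * l) *\<^sub>v unit_vec (2 * l) k"
    proof (cases "k < l")
      case True
      then show ?thesis using 0(3) j by (simp add: fixes_outer_def)
    next
      case False
      then have "2 * l - 1 - k < j" "2 * l - 1 - (2 * l - 1 - k) = k" using k j by auto
      then show ?thesis using 0(3) by (metis fixes_outer_def one_mult_mat_vec unit_vec_carrier)
    qed
  qed
  then show ?case using transvection_group.one by simp
next
  case (Suc d)
  then have j: "j < l" by simp
  let ?u = "unit_vec (2 * l) :: nat \<Rightarrow> complex vec"
  let ?j' = "2 * l - 1 - j"
  have inner_unit: "?u k \<in> inner_vec l j" if "j \<le> k" "k + j < 2 * l" for k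
    using that by (auto simp: inner_vec_def)
  have inner_minus: "u - v \<in> inner_vec l j" if "u \<in> inner_vec l j" "v \<in> inner_vec l j" for u v
    using that j by (auto simp: inner_vec_def)
  have inner_add: "u + v \<in> inner_vec l j" if "u \<in> inner_vec l j" "v \<in> inner_vec l j" for u v
    using that j by (auto simp: inner_vec_def)
  have inner_carrier: "u \<in> carrier_vec (2 * l)" if "u \<in> inner_vec l j" for u
    using that by (auto simp: inner_vec_def)
  let ?ok = "\<lambda>A. A \<in> carrier (Sp l) \<and> fixes_outer l j A"
  \<comment> \<open>One more hyperbolic plane is fixed, so the induction hypothesis applies.\<close>
  have both: "A \<in> transvection_group l" if "?ok A" "A *\<^sub>v ?u j = ?u j" "A *\<^sub>v ?u ?j' = ?u ?j'" for A
  proof (rule Suc.hyps(1)[of "Suc j"])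
    show "fixes_outer l (Suc j) A"
      using that by (auto simp: fixes_outer_def less_Suc_eq)
  qed (use Suc.hyps(2) j that in auto)
  \<comment> \<open>It suffices to treat the matrices obtained from \<open>A\<close> by a transvection that moves one image to \<open>v\<close>.\<close>
  have move: "A \<in> transvection_group l"
    if A: "?ok A" and k: "k = j \<or> k = ?j'" and v: "v \<in> inner_vec l j"
      and nz: "symp l (A *\<^sub>v ?u k) v \<noteq> 0"
      and B: "\<And>B. ?ok B \<Longrightarrow> B *\<^sub>v ?u k = v \<Longrightarrow>
        (\<And>m. A *\<^sub>v ?u m = ?u m \<Longrightarrow> symp l (A *\<^sub>v ?u k - v) (?u m) = 0 \<Longrightarrow> B *\<^sub>v ?u m = ?u m) \<Longrightarrow>
        B \<in> transvection_group l"
    for A v k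
  proof -
    define x where "x = A *\<^sub>v ?u k"
    have x: "x \<in> inner_vec l j"
      using A k j by (auto simp: x_def intro!: fixes_outer_inner_vec)
    define T where "T = transvection l (- 1 / symp l x v) (x - v)"
    have w: "x - v \<in> inner_vec l j" using x v by (rule inner_minus)
    have Ac: "A \<in> carrier_mat (2 * l) (2 * l)" using A Sp_carrier_mat by auto
    have mult: "(T * A) *\<^sub>v ?u m = T *\<^sub>v (A *\<^sub>v ?u m)" for m
      using Ac by (simp add: T_def assoc_mult_mat_vec[of _ "2*l" "2*l" _ "2*l"])
    have "T * A \<in> transvection_group l"
    proof (rule B)
      show "?ok (T * A)"
        using A w j Ac
        by (auto simp: T_def intro!: Sp_mult transvection_Sp inner_carrier fixes_outer_transvection_mult)
      show "(T * A) *\<^sub>v ?u k = v"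
        unfolding mult x_def[symmetric] unfolding T_def
        by (rule transvection_move) (use nz x v inner_carrier in \<open>auto simp: x_def\<close>)
      show "(T * A) *\<^sub>v ?u m = ?u m"
        if "A *\<^sub>v ?u m = ?u m" "symp l (A *\<^sub>v ?u k - v) (?u m) = 0" for m
        unfolding mult that(1) unfolding T_def
        by (rule transvection_fixes) (use that(2) w inner_carrier in \<open>auto simp: x_def\<close>)
    qed
    then show ?thesis
      unfolding T_def by (rule transvection_group_cancel[OF inner_carrier[OF w] Ac])
  qed
  have symp_jj': "symp l (?u j) (?u ?j') = 1" "symp l (?u ?j') (?u j) = - 1"
    using j by (auto simp: symp_unit_right)
  have unit_inner: "?u j \<in> inner_vec l j" "?u ?j' \<in> inner_vec l j"
    using j by (auto intro: inner_unit)
  \<comment> \<open>The partner vector is moved by transvections along vectors orthogonal to the vector fixed before.\<close>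
  have second: "A \<in> transvection_group l" if A: "?ok A" "A *\<^sub>v ?u j = ?u j" for A
  proof -
    have direct: "B \<in> transvection_group l"
      if B: "?ok B" "B *\<^sub>v ?u j = ?u j" and nz: "symp l (B *\<^sub>v ?u ?j') (?u ?j') \<noteq> 0" for B
    proof (rule move[OF B(1) _ unit_inner(2) nz])
      have Bc: "B *\<^sub>v ?u ?j' \<in> carrier_vec (2 * l)"
        using B Sp_carrier_mat by (auto intro!: mult_mat_vec_carrier[of _ "2*l" "2*l"])
      have "symp l (B *\<^sub>v ?u ?j') (B *\<^sub>v ?u j) = - 1"
        using B(1) symp_jj' by (subst Sp_symp) auto
      then have "symp l (B *\<^sub>v ?u ?j' - ?u ?j') (?u j) = 0"
        using B(2) Bc symp_jj' by (simp add: symp_linear)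
      then show "C \<in> transvection_group l"
        if "?ok C" "C *\<^sub>v ?u ?j' = ?u ?j'"
          "\<And>m. B *\<^sub>v ?u m = ?u m \<Longrightarrow> symp l (B *\<^sub>v ?u ?j' - ?u ?j') (?u m) = 0 \<Longrightarrow> C *\<^sub>v ?u m = ?u m" for C
        using both that B(2) by blast
    qed auto
    show ?thesis
    proof (cases "symp l (A *\<^sub>v ?u ?j') (?u ?j') = 0")
      case False
      then show ?thesis using direct A by blast
    next
      case True
      have Ac: "A *\<^sub>v ?u ?j' \<in> carrier_vec (2 * l)"
        using A Sp_carrier_mat by (auto intro!: mult_mat_vec_carrier[of _ "2*l" "2*l"])
      have s: "symp l (A *\<^sub>v ?u ?j') (A *\<^sub>v ?u j) = - 1"
        using A(1) symp_jj' by (subst Sp_symp) auto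
      \<comment> \<open>The detour goes through the sum of both basis vectors; its product with the first one is that of the partner.\<close>
      have x: "?u ?j' + ?u j \<in> inner_vec l j" by (intro inner_add unit_inner)
      have nz: "symp l (A *\<^sub>v ?u ?j') (?u ?j' + ?u j) \<noteq> 0"
        using True s A(2) Ac by (simp add: symp_linear)
      show ?thesis
      proof (rule move[OF A(1) _ x nz])
        fix B
        assume B: "?ok B" "B *\<^sub>v ?u ?j' = ?u ?j' + ?u j"
          "\<And>m. A *\<^sub>v ?u m = ?u m \<Longrightarrow> symp l (A *\<^sub>v ?u ?j' - (?u ?j' + ?u j)) (?u m) = 0 \<Longrightarrow> B *\<^sub>v ?u m = ?u m"
        have "B *\<^sub>v ?u j = ?u j"
          by (rule B(3)[OF A(2)]) (use Ac s A(2) symp_jj' in \<open>simp add: symp_linear\<close>)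
        moreover have "symp l (B *\<^sub>v ?u ?j') (?u ?j') \<noteq> 0"
          unfolding B(2) using symp_jj' by (simp add: symp_linear)
        ultimately show "B \<in> transvection_group l" using B(1) direct by blast
      qed auto
    qed
  qed
  \<comment> \<open>A direct move of the image of the \<open>j\<close>-th basis vector.\<close>
  have first: "A \<in> transvection_group l" if A: "?ok A" and nz: "symp l (A *\<^sub>v ?u j) (?u j) \<noteq> 0" for A
    by (rule move[OF A _ unit_inner(1) nz]) (use second in auto)
  define u where "u = A *\<^sub>v ?u j"
  have u: "u \<in> inner_vec l j"
    using Suc.prems j by (auto simp: u_def intro!: fixes_outer_inner_vec)
  then have uc: "u \<in> carrier_vec (2 * l)" by (rule inner_carrier)
  have ok: "?ok A" using Suc.prems by simp
  \<comment> \<open>A detour through \<open>v\<close>, which must be orthogonal neither to \<open>u\<close> nor to the \<open>j\<close>-th basis vector.\<close>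
  have via: ?case if v: "v \<in> inner_vec l j" "symp l u v \<noteq> 0" "symp l v (?u j) \<noteq> 0" for v
    by (rule move[OF ok _ v(1), of j]) (use v first u_def in auto)
  show ?case
  proof (cases "symp l u (?u j) = 0")
    case False
    then show ?thesis using first ok by (simp add: u_def)
  next
    case u0: True
    show ?thesis
    proof (cases "u $ j = 0")
      case False
      show ?thesis
        by (rule via[OF unit_inner(2)]) (use False symp_jj' j uc in \<open>auto simp: symp_unit_right\<close>)
    next
      case uj: True
      have uj': "u $ ?j' = 0" using u0 j uc by (simp add: symp_unit_right)
      have "\<exists>k<2 * l. u $ k \<noteq> 0"
      proof (rule ccontr)
        assume "\<not> ?thesis"
        then have "symp l u (A *\<^sub>v ?u ?j') = 0" by (simp add: symp_def)
        moreover have "symp l u (A *\<^sub>v ?u ?j') = 1"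
          unfolding u_def using ok symp_jj' by (subst Sp_symp) auto
        ultimately show False by simp
      qed
      then obtain k where k: "k < 2 * l" "u $ k \<noteq> 0" by auto
      have kj: "k \<noteq> j" "k \<noteq> ?j'" using uj uj' k by auto
      have kin: "j \<le> k" "k + j < 2 * l"
      proof -
        show "j \<le> k" using u k by (auto simp: inner_vec_def not_le[symmetric])
        show "k + j < 2 * l"
        proof (rule ccontr)
          assume "\<not> ?thesis"
          then have "2 * l - 1 - k < j" "2 * l - 1 - (2 * l - 1 - k) = k" using k by auto
          then show False using u k unfolding inner_vec_def by fastforce
        qed
      qed
      let ?k' = "2 * l - 1 - k"
      show ?thesis
      proof (rule via)
        show "?u ?k' + ?u ?j' \<in> inner_vec l j"
          using kin kj k j by (intro inner_add unit_inner inner_unit) auto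
        show "symp l u (?u ?k' + ?u ?j') \<noteq> 0"
          using k uj uc j by (auto simp: symp_linear symp_unit_right)
        show "symp l (?u ?k' + ?u ?j') (?u j) \<noteq> 0"
          using k kj j symp_jj' by (auto simp: symp_linear symp_unit_right)
      qed
    qed
  qed
qed

lemma transvection_group_eq_Sp: "transvection_group l = carrier (Sp l)"
proof
  show "transvection_group l \<subseteq> carrier (Sp l)"
  proof
    show "A \<in> carrier (Sp l)" if "A \<in> transvection_group l" for A
      using that by induction (auto intro: Sp_one Sp_mult transvection_Sp)
  qed
qed (auto simp: fixes_outer_def intro: transvection_group_elimination[of _ _ 0])

text \<open>
The symplectic group is irreducible as a variety: on a polynomial curve from 1 to \<open>A\<close> both functions are
polynomials in the parameter, and the product of two nonzero polynomials is not zero.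
\<close>

lemma Sp_irreducible:
  assumes "regular_on_curves (2 * l) p" "regular_on_curves (2 * l) q"
    and "\<And>A. A \<in> carrier (Sp l) \<Longrightarrow> p A * q A = 0" "q (1\<^sub>m (2 * l)) \<noteq> 0"
    and A: "A \<in> carrier (Sp l)"
  shows "p A = 0"
proof -
  obtain \<gamma> where \<gamma>: "poly_curve (2 * l) \<gamma>" "\<And>z. \<gamma> z \<in> carrier (Sp l)" "\<gamma> 0 = 1\<^sub>m (2 * l)" "\<gamma> 1 = A"
    using transvection_group_connected A unfolding transvection_group_eq_Sp by blast
  have "p (\<gamma> 1) = 0"
    by (rule polyfun_mult_eq_zero[of "\<lambda>z. p (\<gamma> z)" "\<lambda>z. q (\<gamma> z)" 0])
      (use assms \<gamma> in \<open>auto simp: regular_on_curves_def\<close>)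
  then show ?thesis by (simp add: \<gamma>)
qed

section \<open>The big cell\<close>

definition leading_minor :: "nat \<Rightarrow> complex mat \<Rightarrow> complex" where
  "leading_minor k A = det (mat k k (($$) A))"

lemma regular_on_curves_leading_minor: "k \<le> m \<Longrightarrow> regular_on_curves m (leading_minor k)"
  unfolding regular_on_curves_def leading_minor_def
proof (intro allI impI)
  fix \<gamma> assume k: "k \<le> m" and \<gamma>: "poly_curve m \<gamma>"
  have "det (mat k k (($$) (\<gamma> z))) =
    (\<Sum>p | p permutes {0..<k}. signof p * (\<Prod>i = 0..<k. \<gamma> z $$ (i, p i)))" for z
    by (subst det_def'[of _ k]) (auto intro!: sum.cong prod.cong simp: permutes_in_image
        dest: permutes_in_image[of _ _ "_::nat"])
  then show "polyfun (\<lambda>z. det (mat k k (($$) (\<gamma> z))))"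
  proof (simp only:, intro polyfun_sum polyfun_mult polyfun_const polyfun_prod)
    fix p i assume "p \<in> {p. p permutes {0..<k}}" "i \<in> {0..<k}"
    then have "p i < k" "i < k" using permutes_in_image[of p "{0..<k}" i] by auto
    then show "polyfun (\<lambda>z. \<gamma> z $$ (i, p i))" using \<gamma> k by (auto simp: poly_curve_def)
  qed
qed

lemma obtain_inverse_matrix:
  assumes "(A :: complex mat) \<in> carrier_mat n n" "det A \<noteq> 0"
  obtains B where "B \<in> carrier_mat n n" "A * B = 1\<^sub>m n" "B * A = 1\<^sub>m n"
  using det_non_zero_imp_unit[OF assms, of "()"] that by (auto simp: Units_def ring_mat_simps)

text \<open>
The step from \<open>n\<close> to \<open>n + 1\<close> borders the factors of the leading block by one row and one column, for which
linear systems with the invertible factors \<open>L\<close> and \<open>R\<close> have to be solved.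
\<close>

lemma LR_decomposition:
  assumes "A \<in> carrier_mat n n" "\<And>k. k \<le> n \<Longrightarrow> leading_minor k A \<noteq> 0"
  shows "\<exists>L R. L \<in> carrier_mat n n \<and> R \<in> carrier_mat n n \<and> A = L * R \<and>
    (\<forall>i<n. L $$ (i, i) = 1) \<and> (\<forall>j<n. \<forall>i<j. L $$ (i, j) = 0) \<and> (\<forall>i<n. \<forall>j<i. R $$ (i, j) = 0)"
  using assms
proof (induction n arbitrary: A)
  case 0
  then show ?case by (intro exI[of _ "1\<^sub>m 0"]) auto
next
  case (Suc n)
  let ?A = "mat n n (($$) A)"
  have "leading_minor k ?A \<noteq> 0" if "k \<le> n" for k
  proof -
    have "mat k k (($$) ?A) = mat k k (($$) A)" using that by (intro eq_matI) auto
    then show ?thesis using Suc.prems(2)[of k] that by (simp add: leading_minor_def)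
  qed
  from Suc.IH[OF _ this] obtain L R where
    LR: "L \<in> carrier_mat n n" "R \<in> carrier_mat n n" "?A = L * R"
    "\<forall>i<n. L $$ (i, i) = 1" "\<forall>j<n. \<forall>i<j. L $$ (i, j) = 0" "\<forall>i<n. \<forall>j<i. R $$ (i, j) = 0" by auto
  have "det L * det R \<noteq> 0"
    using Suc.prems(2)[of n] det_mult[OF LR(1,2)] LR(3) by (simp add: leading_minor_def)
  then obtain L' R' where inv: "L' \<in> carrier_mat n n" "L * L' = 1\<^sub>m n"
    "R' \<in> carrier_mat n n" "R' * R = 1\<^sub>m n"
    by (metis LR(1,2) mult_eq_0_iff obtain_inverse_matrix)
  define b where "b = mat n 1 (\<lambda>(i, _). A $$ (i, n))"
  define c where "c = mat 1 n (\<lambda>(_, j). A $$ (n, j))"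
  define d where "d = mat 1 1 (\<lambda>_. A $$ (n, n))"
  have bcd: "b \<in> carrier_mat n 1" "c \<in> carrier_mat 1 n" "d \<in> carrier_mat 1 1"
    by (auto simp: b_def c_def d_def)
  define x where "x = L' * b"
  define y where "y = c * R'"
  define s where "s = d - y * x"
  have xys: "x \<in> carrier_mat n 1" "y \<in> carrier_mat 1 n" "s \<in> carrier_mat 1 1"
    using bcd inv by (auto simp: x_def y_def s_def)
  let ?L = "four_block_mat L (0\<^sub>m n 1) y (1\<^sub>m 1)" and ?R = "four_block_mat R x (0\<^sub>m 1 n) s"
  have "?L * ?R = four_block_mat (L * R + 0\<^sub>m n 1 * 0\<^sub>m 1 n) (L * x + 0\<^sub>m n 1 * s)
      (y * R + 1\<^sub>m 1 * 0\<^sub>m 1 n) (y * x + 1\<^sub>m 1 * s)"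
    by (rule mult_four_block_mat) (use LR xys in auto)
  also have "L * x = b" using LR inv bcd by (simp add: x_def assoc_mult_mat[symmetric])
  also have "y * R = c" using LR inv bcd by (simp add: y_def assoc_mult_mat)
  also have "four_block_mat (L * R + 0\<^sub>m n 1 * 0\<^sub>m 1 n) (b + 0\<^sub>m n 1 * s)
      (c + 1\<^sub>m 1 * 0\<^sub>m 1 n) (y * x + 1\<^sub>m 1 * s) = four_block_mat ?A b c d"
    using LR bcd xys by (intro cong_four_block_mat) (auto simp: s_def)
  also have "\<dots> = A"
    using Suc.prems(1) by (intro eq_matI) (auto simp: b_def c_def d_def less_Suc_eq)
  finally have "A = ?L * ?R" ..
  then show ?case
    using LR xys by (intro exI[of _ ?L] exI[of _ ?R]) (auto simp: less_Suc_eq)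
qed

definition lower_unipotent :: "nat \<Rightarrow> complex mat set" where
  "lower_unipotent l = {L \<in> carrier (Sp l). (\<forall>i<2*l. L $$ (i, i) = 1) \<and> (\<forall>j<2*l. \<forall>i<j. L $$ (i, j) = 0)}"

definition diag_matrix :: "nat \<Rightarrow> (nat \<Rightarrow> complex) \<Rightarrow> complex mat" where
  "diag_matrix n d = mat n n (\<lambda>(i, j). if i = j then d i else 0)"

lemma diag_matrix_carrier [simp]: "diag_matrix n d \<in> carrier_mat n n"
  and diag_matrix_dim [simp]: "dim_row (diag_matrix n d) = n" "dim_col (diag_matrix n d) = n"
  by (simp_all add: diag_matrix_def)

lemma diag_matrix_mult_index:
  assumes "A \<in> carrier_mat n n" "i < n" "j < n"
  shows "(diag_matrix n d * A) $$ (i, j) = d i * A $$ (i, j)"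
    and "(A * diag_matrix n d) $$ (i, j) = A $$ (i, j) * d j"
proof -
  have "(diag_matrix n d * A) $$ (i, j) = (\<Sum>k<n. if k = i then d i * A $$ (i, j) else 0)"
    unfolding mult_mat_index[OF diag_matrix_carrier assms]
    by (rule sum.cong) (use assms in \<open>auto simp: diag_matrix_def\<close>)
  then show "(diag_matrix n d * A) $$ (i, j) = d i * A $$ (i, j)" using assms by simp
  have "(A * diag_matrix n d) $$ (i, j) = (\<Sum>k<n. if k = j then A $$ (i, j) * d j else 0)"
    unfolding mult_mat_index[OF assms(1) diag_matrix_carrier assms(2,3)]
    by (rule sum.cong) (use assms in \<open>auto simp: diag_matrix_def\<close>)
  then show "(A * diag_matrix n d) $$ (i, j) = A $$ (i, j) * d j" using assms by simp
qed

lemma diag_matrix_Sp: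
  assumes "\<And>i. i < 2 * l \<Longrightarrow> d i * d (2 * l - 1 - i) = 1"
  shows "diag_matrix (2 * l) d \<in> carrier (Sp l)"
proof (rule SpI_symp)
  fix x y :: "complex vec" assume xy: "x \<in> carrier_vec (2 * l)" "y \<in> carrier_vec (2 * l)"
  have ix: "(diag_matrix (2 * l) d *\<^sub>v x) $ i = d i * x $ i"
    if "i < 2 * l" "x \<in> carrier_vec (2 * l)" for i x
  proof -
    have "(diag_matrix (2 * l) d *\<^sub>v x) $ i = (\<Sum>k<2*l. if k = i then d i * x $ i else 0)"
      unfolding mult_mat_vec_index[OF diag_matrix_carrier that(2,1)]
      by (rule sum.cong) (use that in \<open>auto simp: diag_matrix_def\<close>)
    then show ?thesis using that by simp
  qed
  have t: "s * (d i * x $ i) * (d (2 * l - 1 - i) * y $ (2 * l - 1 - i)) = s * x $ i * y $ (2 * l - 1 - i)"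
    if "i < 2 * l" for i s
  proof -
    have "s * (d i * x $ i) * (d (2 * l - 1 - i) * y $ (2 * l - 1 - i)) =
        (d i * d (2 * l - 1 - i)) * (s * x $ i * y $ (2 * l - 1 - i))" by (simp only: ac_simps)
    then show ?thesis by (simp only: assms[OF that] mult_1)
  qed
  show "symp l (diag_matrix (2 * l) d *\<^sub>v x) (diag_matrix (2 * l) d *\<^sub>v y) = symp l x y"
    unfolding symp_def
  proof (rule sum.cong)
    fix i assume "i \<in> {..<2 * l}"
    then have i: "i < 2 * l" "2 * l - 1 - i < 2 * l" by auto
    show "(if i < l then 1 else - 1) * (diag_matrix (2 * l) d *\<^sub>v x) $ i * (diag_matrix (2 * l) d *\<^sub>v y) $ (2 * l - 1 - i)
      = (if i < l then 1 else - 1) * x $ i * y $ (2 * l - 1 - i)"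
      unfolding ix[OF i(1) xy(1)] ix[OF i(2) xy(2)] by (rule t[OF i(1)])
  qed simp
qed simp

lemma form_index_sum:
  assumes "A \<in> carrier_mat (2 * l) (2 * l)" "i < 2 * l" "j < 2 * l"
  shows "(transpose_mat A * sympl_form l * A) $$ (i, j) =
    (\<Sum>a<2*l. (if a < l then 1 else - 1) * A $$ (a, i) * A $$ (2 * l - 1 - a, j))"
  unfolding transpose_form_index[OF assms] symp_def
  by (rule sum.cong) (use assms in \<open>auto simp: mult_unit_vec_index[of _ "2*l" "2*l"]\<close>)

text \<open>
In the sum for an entry of \<open>L\<^sup>T J L\<close> on or below the antidiagonal, triangularity leaves at most the
antidiagonal term.
\<close>

lemma lower_form_index:
  assumes L: "L \<in> carrier_mat (2 * l) (2 * l)" "\<forall>i<2*l. L $$ (i, i) = 1" "\<forall>j<2*l. \<forall>i<j. L $$ (i, j) = 0"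
    and ij: "i < 2 * l" "j < 2 * l" "2 * l \<le> i + j + 1"
  shows "(transpose_mat L * sympl_form l * L) $$ (i, j) = sympl_form l $$ (i, j)"
proof -
  have "(transpose_mat L * sympl_form l * L) $$ (i, j) =
      (\<Sum>a<2*l. if a = i then sympl_form l $$ (i, j) else 0)"
    unfolding form_index_sum[OF L(1) ij(1,2)]
  proof (rule sum.cong)
    fix a assume "a \<in> {..<2 * l}"
    then have a: "a < 2 * l" by simp
    consider "a < i" | "a = i" "i + j + 1 = 2 * l" | "a = i" "2 * l < i + j + 1" | "i < a" using ij by linarith
    then show "(if a < l then 1 else - 1) * L $$ (a, i) * L $$ (2 * l - 1 - a, j) =
        (if a = i then sympl_form l $$ (i, j) else 0)"
    proof cases
      case 2
      then have "2 * l - 1 - a = j" by auto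
      then show ?thesis using 2 L ij by (simp add: sympl_form_index)
    next
      case 3
      then have "2 * l - 1 - a < j" using ij by auto
      then show ?thesis using 3 L ij by (simp add: sympl_form_index)
    next
      case 4
      then have "2 * l - 1 - a < j" using ij a by auto
      then show ?thesis using 4 L ij by simp
    qed (use L ij in auto)
  qed simp
  then show ?thesis using ij by simp
qed

lemma upper_form_index:
  assumes R: "R \<in> carrier_mat (2 * l) (2 * l)" "\<forall>i<2*l. \<forall>j<i. R $$ (i, j) = 0"
    and i: "i < 2 * l"
  shows "(transpose_mat R * sympl_form l * R) $$ (i, 2 * l - 1 - i) =
    (if i < l then 1 else - 1) * R $$ (i, i) * R $$ (2 * l - 1 - i, 2 * l - 1 - i)"
proof -
  have "(transpose_mat R * sympl_form l * R) $$ (i, 2 * l - 1 - i) =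
      (\<Sum>a<2*l. if a = i then (if i < l then 1 else - 1) * R $$ (i, i) * R $$ (2 * l - 1 - i, 2 * l - 1 - i) else 0)"
  proof (subst form_index_sum[OF R(1) i], goal_cases)
    case 2
    show ?case
    proof (rule sum.cong)
      fix a assume "a \<in> {..<2 * l}"
      then have a: "a < 2 * l" by simp
      consider "a < i" | "a = i" | "i < a" by linarith
      then show "(if a < l then 1 else - 1) * R $$ (a, i) * R $$ (2 * l - 1 - a, 2 * l - 1 - i) =
        (if a = i then (if i < l then 1 else - 1) * R $$ (i, i) * R $$ (2 * l - 1 - i, 2 * l - 1 - i) else 0)"
      proof cases
        case 1
        then have "2 * l - 1 - i < 2 * l - 1 - a" "2 * l - 1 - a < 2 * l" using i by auto
        then show ?thesis using 1 R by simp
      qed (use R a in auto)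
    qed simp
  qed (use i in auto)
  then show ?thesis using i by simp
qed

text \<open>
The entries strictly above the antidiagonal, by induction on \<open>i + j\<close>: in the entry \<open>(i, j)\<close> of
\<open>R\<^sup>T Y R\<close> only \<open>Y (i, j)\<close> itself and entries of \<open>Y\<close> with smaller index sum occur.
\<close>

lemma upper_congruence_vanish:
  assumes Y: "Y \<in> carrier_mat (2 * l) (2 * l)" and R: "R \<in> carrier_mat (2 * l) (2 * l)"
    "\<forall>i<2*l. \<forall>j<i. R $$ (i, j) = 0" "\<forall>i<2*l. R $$ (i, i) \<noteq> 0"
    and eq: "transpose_mat R * Y * R = sympl_form l"
    and ij: "i + j + 1 < 2 * l"
  shows "Y $$ (i, j) = 0"
  using ij
proof (induction "i + j" arbitrary: i j rule: less_induct)
  case less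
  then have ij: "i < 2 * l" "j < 2 * l" by auto
  have "(transpose_mat R * Y * R) $$ (i, j) = (\<Sum>b<2*l. (\<Sum>a<2*l. R $$ (a, i) * Y $$ (a, b)) * R $$ (b, j))"
  proof (subst mult_mat_index[of _ "2*l" "2*l" _ "2*l"], goal_cases)
    case 5
    show ?case
      by (rule sum.cong) (use Y R ij in \<open>auto simp: mult_mat_index[of _ "2*l" "2*l" _ "2*l"]\<close>)
  qed (use Y R ij in auto)
  also have "\<dots> = (\<Sum>b<2*l. if b = j then R $$ (i, i) * Y $$ (i, j) * R $$ (j, j) else 0)"
  proof (rule sum.cong)
    fix b assume "b \<in> {..<2 * l}"
    then have b: "b < 2 * l" by simp
    show "(\<Sum>a<2*l. R $$ (a, i) * Y $$ (a, b)) * R $$ (b, j) =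
      (if b = j then R $$ (i, i) * Y $$ (i, j) * R $$ (j, j) else 0)"
    proof (cases "b \<le> j")
      case False
      then show ?thesis using R b by auto
    next
      case True
      have "R $$ (a, i) * Y $$ (a, b) = (if a = i then R $$ (i, i) * Y $$ (i, b) else 0)"
        if "a < 2 * l" for a
      proof -
        consider "i < a" | "a = i" | "a < i" by linarith
        then show ?thesis
        proof cases
          case 1
          then have "R $$ (a, i) = 0" using R(2) that by blast
          then show ?thesis using 1 by simp
        next
          case 2
          then show ?thesis by simp
        next
          case 3
          then have "Y $$ (a, b) = 0" using True less.prems by (intro less.hyps) auto
          then show ?thesis using 3 by simp
        qed
      qed
      then have "(\<Sum>a<2*l. R $$ (a, i) * Y $$ (a, b)) = (\<Sum>a<2*l. if a = i then R $$ (i, i) * Y $$ (i, b) else 0)"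
        by (intro sum.cong) auto
      also have "\<dots> = R $$ (i, i) * Y $$ (i, b)" using ij by simp
      finally have "(\<Sum>a<2*l. R $$ (a, i) * Y $$ (a, b)) = R $$ (i, i) * Y $$ (i, b)" .
      moreover have "Y $$ (i, b) = 0" if "b < j" using that less.prems by (intro less.hyps) auto
      ultimately show ?thesis using True by auto
    qed
  qed simp
  also have "\<dots> = R $$ (i, i) * Y $$ (i, j) * R $$ (j, j)" using ij by simp
  finally have "R $$ (i, i) * Y $$ (i, j) * R $$ (j, j) = 0"
    using eq ij less.prems by (simp add: sympl_form_index)
  then show ?case using R ij by auto
qed

text \<open>
The factors of the decomposition \<open>A = L R\<close> of a symplectic matrix are again symplectic. Indeed
\<open>Y = L\<^sup>T J L\<close> satisfies \<open>R\<^sup>T Y R = J\<close>. The first description determines \<open>Y\<close> on and below the antidiagonal,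
the second one above it, and together they give \<open>Y = J\<close>. The diagonal of \<open>R\<close> is then symplectic as well and
can be split off.
\<close>

lemma Sp_big_cell:
  assumes A: "A \<in> carrier (Sp l)" and minors: "\<And>k. k \<le> 2 * l \<Longrightarrow> leading_minor k A \<noteq> 0"
  obtains L D U where "L \<in> lower_unipotent l" "D \<in> carrier (Sp l)" "diagonal_mat D"
    "U \<in> carrier (Sp l)" "upper_triangular U" "\<forall>i<2*l. U $$ (i, i) = 1" "A = L * (D * U)"
    "\<And>k. k \<le> 2 * l \<Longrightarrow> leading_minor k A = (\<Prod>i<k. D $$ (i, i))"
proof -
  let ?n = "2 * l" and ?J = "sympl_form l"
  have A': "A \<in> carrier_mat ?n ?n" "transpose_mat A * ?J * A = ?J" using A by (auto simp: Sp_iff)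
  obtain L R where LR: "L \<in> carrier_mat ?n ?n" "R \<in> carrier_mat ?n ?n" "A = L * R"
    "\<forall>i<?n. L $$ (i, i) = 1" "\<forall>j<?n. \<forall>i<j. L $$ (i, j) = 0" "\<forall>i<?n. \<forall>j<i. R $$ (i, j) = 0"
    using LR_decomposition[OF A'(1) minors] by blast
  have lm: "leading_minor k A = (\<Prod>i<k. R $$ (i, i))" if k: "k \<le> ?n" for k
  proof -
    let ?Lk = "mat k k (($$) L)" and ?Rk = "mat k k (($$) R)"
    have "mat k k (($$) A) = ?Lk * ?Rk"
    proof (rule eq_matI)
      fix i j assume "i < dim_row (?Lk * ?Rk)" "j < dim_col (?Lk * ?Rk)"
      then have ij: "i < k" "j < k" by auto
      have "A $$ (i, j) = (\<Sum>m<?n. L $$ (i, m) * R $$ (m, j))"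
        unfolding LR(3) by (rule mult_mat_index[OF LR(1,2)]) (use ij k in auto)
      also have "\<dots> = (\<Sum>m<k. L $$ (i, m) * R $$ (m, j))"
        by (rule sum.mono_neutral_right) (use k ij LR in auto)
      also have "\<dots> = (?Lk * ?Rk) $$ (i, j)"
        using ij by (simp add: mult_mat_index[of _ k k _ k])
      finally show "mat k k (($$) A) $$ (i, j) = (?Lk * ?Rk) $$ (i, j)" using ij by simp
    qed auto
    then have "leading_minor k A = det ?Lk * det ?Rk"
      by (simp add: leading_minor_def det_mult[of _ k])
    also have "det ?Lk = 1"
      using k LR by (subst det_lower_triangular[of k]) (auto simp: prod_list_diag_prod)
    also have "det ?Rk = (\<Prod>i<k. R $$ (i, i))"
      using k LR by (subst det_upper_triangular[of _ k]) (auto simp: prod_list_diag_prod lessThan_atLeast0)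
    finally show ?thesis by simp
  qed
  have Rnz: "R $$ (i, i) \<noteq> 0" if "i < ?n" for i
    using minors[of ?n] lm[of ?n] that by auto
  define Y where "Y = transpose_mat L * ?J * L"
  have Y: "Y \<in> carrier_mat ?n ?n" using LR by (auto simp: Y_def)
  have RY: "transpose_mat R * Y * R = ?J"
  proof -
    have "transpose_mat A * ?J * A = transpose_mat R * Y * R"
      using LR(1,2) mult_carrier_mat[OF sympl_form_carrier LR(1)]
        mult_carrier_mat[OF transpose_carrier_mat[THEN iffD2, OF LR(1)] mult_carrier_mat[OF sympl_form_carrier LR(1)]]
      by (simp add: LR(3) Y_def transpose_mult[of _ ?n ?n] assoc_mult_mat[of _ ?n ?n _ ?n _ ?n])
    then show ?thesis using A' by simp
  qed
  have YJ: "Y = ?J"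
  proof (rule eq_matI)
    fix i j assume "i < dim_row ?J" "j < dim_col ?J"
    then have ij: "i < ?n" "j < ?n" by auto
    show "Y $$ (i, j) = ?J $$ (i, j)"
    proof (cases "i + j + 1 < ?n")
      case True
      then show ?thesis
        using upper_congruence_vanish[OF Y LR(2) LR(6) _ RY] Rnz ij by (auto simp: sympl_form_index)
    next
      case False
      then show ?thesis unfolding Y_def by (intro lower_form_index) (use LR ij in auto)
    qed
  qed (use Y in auto)
  then have L: "L \<in> lower_unipotent l" using LR by (auto simp: lower_unipotent_def Sp_iff Y_def)
  have RS: "R \<in> carrier (Sp l)" using RY LR by (simp add: YJ Sp_iff)
  have pair: "R $$ (i, i) * R $$ (?n - 1 - i, ?n - 1 - i) = 1" if "i < ?n" for i
    using upper_form_index[OF LR(2,6) that] RS that by (auto simp: Sp_iff sympl_form_index split: if_splits)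
  define D where "D = diag_matrix ?n (\<lambda>i. R $$ (i, i))"
  define U where "U = diag_matrix ?n (\<lambda>i. inverse (R $$ (i, i))) * R"
  have D: "D \<in> carrier (Sp l)" unfolding D_def by (rule diag_matrix_Sp) (use pair in simp)
  have inv_pair: "inverse (R $$ (i, i)) * inverse (R $$ (?n - 1 - i, ?n - 1 - i)) = 1" if "i < ?n" for i
    using pair[OF that] by (metis inverse_1 inverse_mult_distrib)
  have U: "U \<in> carrier (Sp l)" unfolding U_def
    by (intro Sp_mult RS diag_matrix_Sp) (use inv_pair in simp)
  have Ui: "U $$ (i, j) = inverse (R $$ (i, i)) * R $$ (i, j)" if "i < ?n" "j < ?n" for i j
    unfolding U_def by (rule diag_matrix_mult_index(1)) (use LR that in auto)
  have Uc: "U \<in> carrier_mat ?n ?n" using U by (rule Sp_carrier_mat)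
  have "D * U = R"
  proof (rule eq_matI)
    fix i j assume "i < dim_row R" "j < dim_col R"
    then have ij: "i < ?n" "j < ?n" using LR by auto
    then show "(D * U) $$ (i, j) = R $$ (i, j)"
      unfolding D_def using Rnz by (simp add: diag_matrix_mult_index[OF Uc] Ui)
  qed (use LR Uc D in \<open>auto simp: D_def\<close>)
  then have "A = L * (D * U)" using LR by simp
  moreover have "upper_triangular U" using Uc LR by (auto intro!: upper_triangularI simp: Ui)
  moreover have "\<forall>i<2*l. U $$ (i, i) = 1" using Rnz by (simp add: Ui)
  moreover have "diagonal_mat D" by (auto simp: D_def diag_matrix_def diagonal_mat_def)
  moreover have "leading_minor k A = (\<Prod>i<k. D $$ (i, i))" if "k \<le> ?n" for k
    using lm[OF that] that by (auto simp: D_def diag_matrix_def intro!: prod.cong)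
  ultimately show ?thesis using that[OF L D _ U] by blast
qed

lemma Sp_big_cell_dense:
  assumes p: "regular_on_curves (2 * l) p"
    and cell: "\<And>A. A \<in> carrier (Sp l) \<Longrightarrow> (\<And>k. k \<le> 2 * l \<Longrightarrow> leading_minor k A \<noteq> 0) \<Longrightarrow> p A = 0"
    and A: "A \<in> carrier (Sp l)"
  shows "p A = 0"
proof (rule Sp_irreducible[OF p _ _ _ A])
  let ?q = "\<lambda>A. \<Prod>k\<le>2*l. leading_minor k A"
  show "regular_on_curves (2 * l) ?q"
    using regular_on_curves_leading_minor
    by (auto simp: regular_on_curves_def intro!: polyfun_prod)
  show "p A * ?q A = 0" if "A \<in> carrier (Sp l)" for A
    using cell[OF that] by auto
  have "mat k k (($$) (1\<^sub>m (2 * l))) = (1\<^sub>m k :: complex mat)" if "k \<le> 2 * l" for k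
    using that by (intro eq_matI) auto
  then show "?q (1\<^sub>m (2 * l)) \<noteq> 0" by (auto simp: leading_minor_def)
qed

section \<open>The matrix coefficient of a highest weight vector\<close>

lemma rational_rep_carrier:
  assumes "rational_rep l N \<rho>" "A \<in> carrier (Sp l)"
  shows "\<rho> A \<in> carrier (GL N)" "\<rho> A \<in> carrier_mat N N"
proof -
  show "\<rho> A \<in> carrier (GL N)" using assms by (auto simp: rational_rep_def hom_def)
  then show "\<rho> A \<in> carrier_mat N N" by (rule GL_carrier_mat)
qed

lemma rational_rep_entry:
  assumes "rational_rep l N \<rho>" "i < N" "j < N"
  shows "\<exists>p \<in> mat_poly_fun (2 * l). \<forall>A \<in> carrier (Sp l). \<rho> A $$ (i, j) = p A"
  using conjunct2[OF assms(1)[unfolded rational_rep_def]] assms(2,3) by simp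

lemma rational_rep_mult:
  assumes "rational_rep l N \<rho>" "A \<in> carrier (Sp l)" "B \<in> carrier (Sp l)"
  shows "\<rho> (A * B) = \<rho> A * \<rho> B"
  using assms by (auto simp: rational_rep_def hom_def)

lemma rational_rep_one:
  assumes "rational_rep l N \<rho>"
  shows "\<rho> (1\<^sub>m (2 * l)) = 1\<^sub>m N"
  using hom_one[of \<rho> "Sp l" "GL N"] assms Sp_group GL_group by (auto simp: rational_rep_def)

lemma rational_rep_mult_vec:
  assumes "rational_rep l N \<rho>" "A \<in> carrier (Sp l)" "B \<in> carrier (Sp l)" "v \<in> carrier_vec N"
  shows "\<rho> (A * B) *\<^sub>v v = \<rho> A *\<^sub>v (\<rho> B *\<^sub>v v)"
  using assms rational_rep_carrier[OF assms(1)]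
  by (simp add: rational_rep_mult assoc_mult_mat_vec[of _ N N _ N])

lemma rational_rep_vec_carrier:
  assumes "rational_rep l N \<rho>" "A \<in> carrier (Sp l)" "v \<in> carrier_vec N"
  shows "\<rho> A *\<^sub>v v \<in> carrier_vec N"
  using rational_rep_carrier(2)[OF assms(1,2)] assms(3) by (rule mult_mat_vec_carrier)

text \<open>
The exponents are odd, sum to 0 on each hyperbolic pair, and increase by 2 from one row to the next.
Conjugation by this torus element therefore multiplies the entry \<open>(i, j)\<close> by \<open>z^(2 (i - j))\<close>, and lower
unitriangular matrices are contracted to 1 as \<open>z\<close> tends to 0. The contraction is written without
negative powers as \<open>contraction_curve\<close>, so that it makes sense at \<open>z = 0\<close>.
\<close>

definition contraction_torus :: "nat \<Rightarrow> complex \<Rightarrow> complex mat" where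
  "contraction_torus l z = diag_matrix (2 * l) (\<lambda>i. z powi (2 * int i - (2 * int l - 1)))"

definition contraction_curve :: "nat \<Rightarrow> complex mat \<Rightarrow> complex \<Rightarrow> complex mat" where
  "contraction_curve l u z = mat (2 * l) (2 * l) (\<lambda>(i, j). if j \<le> i then u $$ (i, j) * z ^ (2 * (i - j)) else 0)"

lemma contraction_torus_Sp:
  assumes "z \<noteq> 0"
  shows "contraction_torus l z \<in> carrier (Sp l)"
  unfolding contraction_torus_def
proof (rule diag_matrix_Sp)
  fix i assume "i < 2 * l"
  then have "(2 * int i - (2 * int l - 1)) + (2 * int (2 * l - 1 - i) - (2 * int l - 1)) = 0" by auto
  then show "z powi (2 * int i - (2 * int l - 1)) * z powi (2 * int (2 * l - 1 - i) - (2 * int l - 1)) = 1"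
    using assms by (simp only: power_int_add[symmetric] simp_thms power_int_0_right)
qed

lemma contraction_torus_diagonal: "diagonal_mat (contraction_torus l z)"
  by (auto simp: contraction_torus_def diag_matrix_def diagonal_mat_def)

lemma poly_curve_contraction: "poly_curve (2 * l) (contraction_curve l u)"
proof -
  have "polyfun (\<lambda>z. if j \<le> i then u $$ (i, j) * z ^ (2 * (i - j)) else 0)" for i j
    by (cases "j \<le> i") auto
  then show ?thesis by (auto simp: poly_curve_def contraction_curve_def)
qed

lemma contraction_curve_zero:
  assumes "u \<in> lower_unipotent l"
  shows "contraction_curve l u 0 = 1\<^sub>m (2 * l)"
  by (rule eq_matI) (use assms in \<open>auto simp: contraction_curve_def lower_unipotent_def\<close>)

lemma contraction_curve_torus:
  assumes u: "u \<in> lower_unipotent l" and z: "z \<noteq> 0"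
  shows "contraction_curve l u z * contraction_torus l z = contraction_torus l z * u"
proof -
  have uc: "u \<in> carrier_mat (2 * l) (2 * l)"
    using u Sp_carrier_mat by (auto simp: lower_unipotent_def)
  have cc: "contraction_curve l u z \<in> carrier_mat (2 * l) (2 * l)" by (simp add: contraction_curve_def)
  show ?thesis
  proof (rule eq_matI)
    fix i j assume "i < dim_row (contraction_torus l z * u)" "j < dim_col (contraction_torus l z * u)"
    then have ij: "i < 2 * l" "j < 2 * l" using uc by (auto simp: contraction_torus_def)
    have "z ^ (2 * (i - j)) * z powi (2 * int j - (2 * int l - 1)) = z powi (2 * int i - (2 * int l - 1))"
      if "j \<le> i"
    proof -
      have "z ^ (2 * (i - j)) = z powi (2 * int i - 2 * int j)"
        using that by (simp add: power_int_of_nat[symmetric] of_nat_diff right_diff_distrib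
            del: power_int_of_nat)
      moreover have "(2 * int i - 2 * int j) + (2 * int j - (2 * int l - 1)) = 2 * int i - (2 * int l - 1)" by simp
      ultimately show ?thesis using z by (simp only: power_int_add[symmetric] simp_thms)
    qed
    then show "(contraction_curve l u z * contraction_torus l z) $$ (i, j) = (contraction_torus l z * u) $$ (i, j)"
      unfolding contraction_torus_def diag_matrix_mult_index(1)[OF uc ij] diag_matrix_mult_index(2)[OF cc ij]
      using u ij by (auto simp: contraction_curve_def lower_unipotent_def)
  qed (use uc cc in \<open>auto simp: contraction_torus_def\<close>)
qed

lemma contraction_curve_Sp:
  assumes u: "u \<in> lower_unipotent l"
  shows "contraction_curve l u z \<in> carrier (Sp l)"
proof (cases "z = 0")
  case True
  then show ?thesis using contraction_curve_zero[OF u] Sp_one by simp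
next
  case False
  interpret S: group "Sp l" by (rule Sp_group)
  let ?t = "contraction_torus l z"
  have t: "?t \<in> carrier (Sp l)" using contraction_torus_Sp[OF False] .
  have uS: "u \<in> carrier (Sp l)" using u by (simp add: lower_unipotent_def)
  have i: "inv\<^bsub>Sp l\<^esub> ?t \<in> carrier (Sp l)" using t by simp
  have "?t * inv\<^bsub>Sp l\<^esub> ?t = 1\<^sub>m (2 * l)" using S.r_inv[OF t] by simp
  moreover have cc: "contraction_curve l u z \<in> carrier_mat (2 * l) (2 * l)" by (simp add: contraction_curve_def)
  ultimately have "contraction_curve l u z = (contraction_curve l u z * ?t) * inv\<^bsub>Sp l\<^esub> ?t"
    using Sp_carrier_mat[OF t] Sp_carrier_mat[OF i]
    by (simp add: assoc_mult_mat[of _ "2*l" "2*l" _ "2*l" _ "2*l"])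
  also have "\<dots> \<in> carrier (Sp l)"
    unfolding contraction_curve_torus[OF u False] by (intro Sp_mult t uS i)
  finally show ?thesis .
qed

lemma weight_char_nonzero:
  assumes "T \<in> carrier (Sp l)" "diagonal_mat T"
  shows "weight_char l w T \<noteq> 0"
proof -
  have T: "T \<in> carrier_mat (2 * l) (2 * l)" using assms Sp_carrier_mat by blast
  have "T $$ (i, i) \<noteq> 0" if "i < l" for i
  proof
    assume z: "T $$ (i, i) = 0"
    have "transpose_mat T * sympl_form l * T = sympl_form l" using assms by (simp add: Sp_iff)
    moreover have "(transpose_mat T * sympl_form l * T) $$ (i, 2 * l - 1 - i) = 0"
      using upper_form_index[OF T] z that assms(2) T by (auto simp: diagonal_mat_def)
    ultimately show False using that by (simp add: sympl_form_index)
  qed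
  then show ?thesis by (simp add: weight_char_def power_int_eq_0_iff)
qed

lemma rational_rep_polyfun:
  assumes \<rho>: "rational_rep l N \<rho>" and \<gamma>: "poly_curve (2 * l) \<gamma>" "\<And>z. \<gamma> z \<in> carrier (Sp l)"
    and v: "v \<in> carrier_vec N" and i: "i < N"
  shows "polyfun (\<lambda>z. (\<rho> (\<gamma> z) *\<^sub>v v) $ i)"
proof -
  have "(\<rho> (\<gamma> z) *\<^sub>v v) $ i = (\<Sum>j<N. \<rho> (\<gamma> z) $$ (i, j) * v $ j)" for z
    by (rule mult_mat_vec_index) (use rational_rep_carrier[OF \<rho> \<gamma>(2)] v i in auto)
  moreover have "polyfun (\<lambda>z. \<rho> (\<gamma> z) $$ (i, j))" if "j < N" for j
  proof -
    from rational_rep_entry[OF \<rho> i that] obtain p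
      where p: "p \<in> mat_poly_fun (2 * l)" "\<And>A. A \<in> carrier (Sp l) \<Longrightarrow> \<rho> A $$ (i, j) = p A"
      by metis
    then show ?thesis
      using regular_on_curves_mat_poly_fun[OF p(1)] \<gamma> by (simp add: regular_on_curves_def)
  qed
  ultimately show ?thesis by (auto intro!: polyfun_sum polyfun_mult)
qed

text \<open>
The vector \<open>v\<close> is not a linear combination of the differences \<open>\<rho>(u) v - v\<close> with \<open>u\<close> lower unitriangular.
For suppose it were one. Conjugating all \<open>u\<close> in it by the contracting torus gives such a combination for each
\<open>z \<noteq> 0\<close>, with the same coefficients, since \<open>v\<close> is an eigenvector of the torus. It is polynomial in \<open>z\<close>
and hence persists at \<open>z = 0\<close>, where all differences vanish; but \<open>v \<noteq> 0\<close>. A functional separating \<open>v\<close> from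
the span of the differences has the required property.
\<close>

lemma lower_unipotent_functional:
  assumes \<rho>: "rational_rep l N \<rho>" and v: "highest_weight_vector l N \<rho> w v"
  obtains \<phi> where "\<And>L. L \<in> lower_unipotent l \<Longrightarrow> (\<Sum>i<N. (\<rho> L *\<^sub>v v) $ i * \<phi> i) = 1"
proof -
  have vc: "v \<in> carrier_vec N" "v \<noteq> 0\<^sub>v N" using v by (auto simp: highest_weight_vector_def)
  \<comment> \<open>Elements of the span of the differences are given by lists of coefficients and matrices.\<close>
  define S where "S = {xs :: (complex \<times> complex mat) list. \<forall>(c, u)\<in>set xs. u \<in> lower_unipotent l}"
  define r where "r xs i = (\<Sum>(c, u)\<leftarrow>xs. c * ((\<rho> u *\<^sub>v v) $ i - v $ i))" for xs i
  have one: "1\<^sub>m (2 * l) \<in> lower_unipotent l" by (auto simp: lower_unipotent_def Sp_one)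
  have "\<exists>x. (\<forall>f\<in>r ` S. (\<Sum>i<N. f i * x i) = 0) \<and> (\<Sum>i<N. v $ i * x i) = 1"
  proof (rule separating_functional)
    have "(\<lambda>_. 0) = r []" by (simp add: r_def fun_eq_iff)
    then show "(\<lambda>_. 0) \<in> r ` S" by (auto simp: S_def)
  next
    fix f g assume "f \<in> r ` S" "g \<in> r ` S"
    then obtain xs ys where xs: "f = r xs" "g = r ys" "xs \<in> S" "ys \<in> S" by auto
    then have "(\<lambda>i. f i + g i) = r (xs @ ys)" "xs @ ys \<in> S" by (auto simp: r_def S_def fun_eq_iff)
    then show "(\<lambda>i. f i + g i) \<in> r ` S" by auto
  next
    fix c f assume "f \<in> r ` S"
    then obtain xs where xs: "f = r xs" "xs \<in> S" by auto
    have "c * r xs i = r (map (\<lambda>(d, u). (c * d, u)) xs) i" for i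
      unfolding r_def by (induction xs) (auto simp: algebra_simps)
    moreover have "map (\<lambda>(d, u). (c * d, u)) xs \<in> S" using xs by (auto simp: S_def)
    ultimately show "(\<lambda>i. c * f i) \<in> r ` S" using xs by auto
  next
    show "\<not> (\<exists>f\<in>r ` S. \<forall>i<N. f i = v $ i)"
    proof
      assume "\<exists>f\<in>r ` S. \<forall>i<N. f i = v $ i"
      then obtain xs where xs: "xs \<in> S" and rv: "\<And>i. i < N \<Longrightarrow> r xs i = v $ i" by auto
      \<comment> \<open>The combination after conjugation by the torus, minus \<open>v\<close>: zero for \<open>z \<noteq> 0\<close>, and \<open>- v\<close> for \<open>z = 0\<close>.\<close>
      define g where "g i z = (\<Sum>(c, u)\<leftarrow>xs. c * ((\<rho> (contraction_curve l u z) *\<^sub>v v) $ i - v $ i)) - v $ i" for i z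
      have poly: "polyfun (g i)" if "i < N" for i
      proof -
        have "polyfun (\<lambda>z. \<Sum>(c, u)\<leftarrow>xs. c * ((\<rho> (contraction_curve l u z) *\<^sub>v v) $ i - v $ i))"
          using xs
        proof (induction xs)
          case (Cons x xs)
          obtain c u where x: "x = (c, u)" by force
          have "u \<in> lower_unipotent l" "xs \<in> S" using Cons.prems by (auto simp: S_def x)
          then show ?case
            using Cons.IH rational_rep_polyfun[OF \<rho> poly_curve_contraction contraction_curve_Sp vc(1) that]
            by (auto simp: x)
        qed simp
        then show ?thesis unfolding g_def by auto
      qed
      have nz: "g i z = 0" if i: "i < N" and z: "z \<noteq> 0" for i z
      proof -
        let ?T = "contraction_torus l z"
        let ?c = "weight_char l w ?T"
        have T: "?T \<in> carrier (Sp l)" by (rule contraction_torus_Sp[OF z])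
        have Tv: "\<rho> ?T *\<^sub>v v = ?c \<cdot>\<^sub>v v"
          using v T contraction_torus_diagonal by (auto simp: highest_weight_vector_def)
        note RT = rational_rep_carrier(2)[OF \<rho> T]
        have key: "?c * ((\<rho> (contraction_curve l u z) *\<^sub>v v) $ i) = (\<Sum>j<N. \<rho> ?T $$ (i, j) * (\<rho> u *\<^sub>v v) $ j)"
          if u: "u \<in> lower_unipotent l" for u
        proof -
          have uS: "u \<in> carrier (Sp l)" using u by (simp add: lower_unipotent_def)
          have C: "contraction_curve l u z \<in> carrier (Sp l)" by (rule contraction_curve_Sp[OF u])
          have "?c \<cdot>\<^sub>v (\<rho> (contraction_curve l u z) *\<^sub>v v) = \<rho> (contraction_curve l u z) *\<^sub>v (\<rho> ?T *\<^sub>v v)"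
            unfolding Tv using rational_rep_carrier(2)[OF \<rho> C] vc(1) by (simp add: mult_mat_vec)
          also have "\<dots> = \<rho> ?T *\<^sub>v (\<rho> u *\<^sub>v v)"
            using rational_rep_mult_vec[OF \<rho> C T vc(1)] rational_rep_mult_vec[OF \<rho> T uS vc(1)]
              contraction_curve_torus[OF u z] by simp
          finally have "?c \<cdot>\<^sub>v (\<rho> (contraction_curve l u z) *\<^sub>v v) = \<rho> ?T *\<^sub>v (\<rho> u *\<^sub>v v)" .
          then have "(?c \<cdot>\<^sub>v (\<rho> (contraction_curve l u z) *\<^sub>v v)) $ i = (\<rho> ?T *\<^sub>v (\<rho> u *\<^sub>v v)) $ i" by simp
          moreover have "(?c \<cdot>\<^sub>v (\<rho> (contraction_curve l u z) *\<^sub>v v)) $ i = ?c * ((\<rho> (contraction_curve l u z) *\<^sub>v v) $ i)"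
            using carrier_vecD[OF rational_rep_vec_carrier[OF \<rho> C vc(1)]] i
            by (simp del: dim_mult_mat_vec)
          ultimately show ?thesis
            by (simp add: mult_mat_vec_index[OF RT rational_rep_vec_carrier[OF \<rho> uS vc(1)] i])
        qed
        have key0: "?c * v $ i = (\<Sum>j<N. \<rho> ?T $$ (i, j) * v $ j)"
        proof -
          have "?c * v $ i = (\<rho> ?T *\<^sub>v v) $ i" unfolding Tv using vc i by simp
          then show ?thesis by (simp add: mult_mat_vec_index[OF RT vc(1) i])
        qed
        have "?c * (\<Sum>(c, u)\<leftarrow>xs. c * ((\<rho> (contraction_curve l u z) *\<^sub>v v) $ i - v $ i)) =
            (\<Sum>j<N. \<rho> ?T $$ (i, j) * r xs j)"
          using xs
        proof (induction xs)
          case Nil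
          then show ?case by (simp add: r_def)
        next
          case (Cons x xs)
          obtain d u where x: "x = (d, u)" by force
          have u: "u \<in> lower_unipotent l" "xs \<in> S" using Cons.prems by (auto simp: S_def x)
          have "(\<Sum>j<N. \<rho> ?T $$ (i, j) * r (x # xs) j) =
              d * ((\<Sum>j<N. \<rho> ?T $$ (i, j) * (\<rho> u *\<^sub>v v) $ j) - (\<Sum>j<N. \<rho> ?T $$ (i, j) * v $ j))
              + (\<Sum>j<N. \<rho> ?T $$ (i, j) * r xs j)"
            unfolding sum_distrib_left sum_subtractf[symmetric] sum.distrib[symmetric]
            by (rule sum.cong) (auto simp: r_def x algebra_simps)
          also have "\<dots> = d * (?c * ((\<rho> (contraction_curve l u z) *\<^sub>v v) $ i) - ?c * v $ i)
              + (\<Sum>j<N. \<rho> ?T $$ (i, j) * r xs j)"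
            by (simp only: key[OF u(1)] key0)
          finally show ?case using Cons.IH[OF u(2)] by (simp add: x algebra_simps)
        qed
        also have "\<dots> = (\<Sum>j<N. \<rho> ?T $$ (i, j) * v $ j)"
          by (rule sum.cong) (simp_all add: rv)
        also have "\<dots> = ?c * v $ i" by (simp add: key0)
        finally have "?c * g i z = 0" by (simp add: g_def right_diff_distrib)
        then show ?thesis using weight_char_nonzero[OF T contraction_torus_diagonal] by simp
      qed
      have "v $ i = 0" if i: "i < N" for i
      proof -
        have "g i 0 = 0" by (rule polyfun_eq_zero_at_zero[OF poly[OF i] nz[OF i]])
        moreover have "(\<Sum>(c, u)\<leftarrow>xs. c * ((\<rho> (contraction_curve l u 0) *\<^sub>v v) $ i - v $ i)) = 0"
          using xs
        proof (induction xs)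
          case (Cons x xs)
          obtain d u where x: "x = (d, u)" by force
          have u: "u \<in> lower_unipotent l" "xs \<in> S" using Cons.prems by (auto simp: S_def x)
          then show ?case
            using Cons.IH vc by (simp add: x contraction_curve_zero rational_rep_one[OF \<rho>])
        qed simp
        ultimately show ?thesis by (simp add: g_def)
      qed
      then have "v = 0\<^sub>v N" using vc by (intro eq_vecI) auto
      then show False using vc by simp
    qed
  qed
  then obtain x where x: "\<And>xs. xs \<in> S \<Longrightarrow> (\<Sum>i<N. r xs i * x i) = 0" "(\<Sum>i<N. v $ i * x i) = 1" by auto
  show ?thesis
  proof (rule that)
    fix L assume "L \<in> lower_unipotent l"
    then have "(\<Sum>i<N. r [(1, L)] i * x i) = 0" by (intro x) (simp add: S_def)
    then show "(\<Sum>i<N. (\<rho> L *\<^sub>v v) $ i * x i) = 1"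
      using x(2) by (simp add: r_def left_diff_distrib sum_subtractf)
  qed
qed

lemma weight_char_fundamental:
  assumes "k \<le> l"
  shows "weight_char l (fundamental_weight k) T = (\<Prod>i<k. T $$ (i, i))"
proof -
  have "weight_char l (fundamental_weight k) T = (\<Prod>i<l. if i < k then T $$ (i, i) else 1)"
    unfolding weight_char_def by (rule prod.cong) (auto simp: fundamental_weight_def)
  also have "\<dots> = (\<Prod>i<k. T $$ (i, i))"
    by (rule prod.mono_neutral_cong_right) (use assms in auto)
  finally show ?thesis .
qed

text \<open>
On the big cell, \<open>U\<close> fixes \<open>v\<close>, \<open>D\<close> multiplies it by the value of the weight, which is the leading minor of
\<open>A\<close>, and \<open>L\<close> does not change the value of \<open>\<phi>\<close>. Both sides are polynomial in \<open>A\<close>, so they agree on the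
whole group.
\<close>

lemma fundamental_rep_coefficient:
  assumes \<rho>: "rational_rep l N \<rho>" and v: "highest_weight_vector l N \<rho> (fundamental_weight k) v"
    and k: "k \<le> l"
  obtains \<phi> where "\<And>A. A \<in> carrier (Sp l) \<Longrightarrow> (\<Sum>i<N. (\<rho> A *\<^sub>v v) $ i * \<phi> i) = leading_minor k A"
proof -
  have vc: "v \<in> carrier_vec N" using v by (auto simp: highest_weight_vector_def)
  obtain \<phi> where \<phi>: "\<And>L. L \<in> lower_unipotent l \<Longrightarrow> (\<Sum>i<N. (\<rho> L *\<^sub>v v) $ i * \<phi> i) = 1"
    using lower_unipotent_functional[OF \<rho> v] by blast
  have "\<exists>p \<in> mat_poly_fun (2 * l). \<forall>A \<in> carrier (Sp l). \<rho> A $$ (i, j) = p A" if "i < N" "j < N" for i j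
    using rational_rep_entry[OF \<rho> that] .
  then obtain P where P: "\<And>i j. i < N \<Longrightarrow> j < N \<Longrightarrow> P i j \<in> mat_poly_fun (2 * l)"
    "\<And>i j A. i < N \<Longrightarrow> j < N \<Longrightarrow> A \<in> carrier (Sp l) \<Longrightarrow> \<rho> A $$ (i, j) = P i j A"
    by metis
  define p where "p A = (\<Sum>i<N. (\<Sum>j<N. P i j A * v $ j) * \<phi> i) - leading_minor k A" for A
  have pA: "p A = (\<Sum>i<N. (\<rho> A *\<^sub>v v) $ i * \<phi> i) - leading_minor k A" if A: "A \<in> carrier (Sp l)" for A
    unfolding p_def using P(2) A
    by (simp add: mult_mat_vec_index[OF rational_rep_carrier(2)[OF \<rho> A] vc])
  have "p A = 0" if A: "A \<in> carrier (Sp l)" for A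
  proof (rule Sp_big_cell_dense[OF _ _ A])
    have "polyfun (\<lambda>z. P i j (\<gamma> z))" if "i < N" "j < N" "poly_curve (2 * l) \<gamma>" for i j \<gamma>
      using regular_on_curves_mat_poly_fun[OF P(1)[OF that(1,2)]] that(3) by (simp add: regular_on_curves_def)
    moreover have "polyfun (\<lambda>z. leading_minor k (\<gamma> z))" if "poly_curve (2 * l) \<gamma>" for \<gamma>
      using regular_on_curves_leading_minor[of k "2 * l"] k that by (simp add: regular_on_curves_def)
    ultimately show "regular_on_curves (2 * l) p"
      unfolding regular_on_curves_def p_def
      by (auto intro!: polyfun_diff polyfun_sum polyfun_mult)
  next
    fix A assume A: "A \<in> carrier (Sp l)" and m: "\<And>k. k \<le> 2 * l \<Longrightarrow> leading_minor k A \<noteq> 0"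
    obtain L D U where LDU: "L \<in> lower_unipotent l" "D \<in> carrier (Sp l)" "diagonal_mat D"
      "U \<in> carrier (Sp l)" "upper_triangular U" "\<forall>i<2*l. U $$ (i, i) = 1" "A = L * (D * U)"
      "\<And>k. k \<le> 2 * l \<Longrightarrow> leading_minor k A = (\<Prod>i<k. D $$ (i, i))"
      using Sp_big_cell[OF A m] by blast
    have L: "L \<in> carrier (Sp l)" using LDU(1) by (simp add: lower_unipotent_def)
    let ?c = "leading_minor k A"
    have "\<rho> A *\<^sub>v v = \<rho> L *\<^sub>v (\<rho> D *\<^sub>v (\<rho> U *\<^sub>v v))"
      unfolding LDU(7)
      by (simp add: rational_rep_mult_vec[OF \<rho> L Sp_mult[OF LDU(2,4)] vc] rational_rep_mult_vec[OF \<rho> LDU(2,4) vc])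
    also have "\<rho> U *\<^sub>v v = v" using v LDU by (simp add: highest_weight_vector_def)
    also have "\<rho> D *\<^sub>v v = ?c \<cdot>\<^sub>v v"
      using v LDU k by (simp add: highest_weight_vector_def weight_char_fundamental)
    also have "\<rho> L *\<^sub>v (?c \<cdot>\<^sub>v v) = ?c \<cdot>\<^sub>v (\<rho> L *\<^sub>v v)"
      using rational_rep_carrier(2)[OF \<rho> L] vc by (simp add: mult_mat_vec)
    finally have Av: "\<rho> A *\<^sub>v v = ?c \<cdot>\<^sub>v (\<rho> L *\<^sub>v v)" .
    have "(\<Sum>i<N. (\<rho> A *\<^sub>v v) $ i * \<phi> i) = (\<Sum>i<N. ?c * ((\<rho> L *\<^sub>v v) $ i * \<phi> i))"
    proof (rule sum.cong)
      fix i assume "i \<in> {..<N}"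
      then have "(\<rho> A *\<^sub>v v) $ i = ?c * (\<rho> L *\<^sub>v v) $ i"
        unfolding Av using carrier_vecD[OF rational_rep_vec_carrier[OF \<rho> L vc]]
        by (simp del: dim_mult_mat_vec)
      then show "(\<rho> A *\<^sub>v v) $ i * \<phi> i = ?c * ((\<rho> L *\<^sub>v v) $ i * \<phi> i)" by simp
    qed simp
    also have "\<dots> = ?c" using \<phi>[OF LDU(1)] by (simp add: sum_distrib_left[symmetric])
    finally show "p A = 0" using pA[OF A] by simp
  qed
  then have "(\<Sum>i<N. (\<rho> A *\<^sub>v v) $ i * \<phi> i) = leading_minor k A" if "A \<in> carrier (Sp l)" for A
    using pA that by simp
  then show ?thesis by (rule that)
qed

section \<open>Recovering the trace from a matrix coefficient\<close>

lemma irreducible_subspace_eq: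
  assumes irr: "irreducible_rep l N \<rho>"
    and W: "W \<subseteq> carrier_vec N" "0\<^sub>v N \<in> W"
      "\<And>x y. x \<in> W \<Longrightarrow> y \<in> W \<Longrightarrow> x + y \<in> W" "\<And>c x. x \<in> W \<Longrightarrow> c \<cdot>\<^sub>v x \<in> W"
      "\<And>A x. A \<in> carrier (Sp l) \<Longrightarrow> x \<in> W \<Longrightarrow> \<rho> A *\<^sub>v x \<in> W"
    and x: "x \<in> W" "x \<noteq> 0\<^sub>v N"
  shows "W = carrier_vec N"
proof -
  have "VectorSpace.subspace class_ring W (module_vec TYPE(complex) N)"
    unfolding VectorSpace.subspace_def
    using W by (auto simp: vec_vs submodule_def vec_module module_vec_simps)
  then have "W = {0\<^sub>v N} \<or> W = carrier_vec N"
    using irr W(5) unfolding irreducible_rep_def by blast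
  then show ?thesis using x by auto
qed

lemma sum_sum_list_swap:
  "(\<Sum>i\<in>I. \<Sum>r\<leftarrow>rs. g i r) = (\<Sum>r\<leftarrow>rs. \<Sum>i\<in>I. (g i r :: complex))"
  by (induction rs) (simp_all add: sum.distrib)

text \<open>
Write the identity matrix as a finite sum of terms \<open>c * \<rho>(A) v * \<phi> \<rho>(B)\<close>. This is possible because the
vectors \<open>\<rho>(A) v\<close> span a nonzero subrepresentation, hence everything, and the common kernel of the
functionals \<open>\<phi> \<circ> \<rho>(B)\<close> is a proper subrepresentation, hence zero. Inserting this expression into \<open>tr \<rho>(g)\<close> and into \<open>\<phi>(\<rho>(B' A') v)\<close> leaves only values of
the coefficient \<open>f\<close>.
\<close>

lemma coefficient_resolution:
  fixes \<phi> :: "nat \<Rightarrow> complex" and f :: "complex mat \<Rightarrow> complex"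
  assumes irr: "irreducible_rep l N \<rho>" and v: "v \<in> carrier_vec N"
    and f: "\<And>A. A \<in> carrier (Sp l) \<Longrightarrow> (\<Sum>i<N. (\<rho> A *\<^sub>v v) $ i * \<phi> i) = f A"
    and nz: "f (1\<^sub>m (2 * l)) \<noteq> 0"
  obtains rs :: "(complex \<times> complex mat \<times> complex mat) list"
  where "\<And>c A B. (c, A, B) \<in> set rs \<Longrightarrow> A \<in> carrier (Sp l) \<and> B \<in> carrier (Sp l)"
    and "\<And>g. g \<in> carrier (Sp l) \<Longrightarrow> (\<Sum>i<N. \<rho> g $$ (i, i)) = (\<Sum>(c, A, B)\<leftarrow>rs. c * f (B * g * A))"
    and "\<And>A' B'. A' \<in> carrier (Sp l) \<Longrightarrow> B' \<in> carrier (Sp l) \<Longrightarrow>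
      (\<Sum>(c, A, B)\<leftarrow>rs. c * f (B' * A) * f (B * A')) = f (B' * A')"
proof -
  let ?S = "carrier (Sp l)"
  have \<rho>: "rational_rep l N \<rho>" using irr by (simp add: irreducible_rep_def)
  note carr = rational_rep_carrier(2)[OF \<rho>]
  note vcarr = rational_rep_vec_carrier[OF \<rho>]
  define \<psi> where "\<psi> B j = (\<Sum>i<N. \<phi> i * \<rho> B $$ (i, j))" for B j
  have \<psi>: "(\<Sum>j<N. \<psi> B j * x $ j) = (\<Sum>i<N. (\<rho> B *\<^sub>v x) $ i * \<phi> i)"
    if "B \<in> ?S" "x \<in> carrier_vec N" for B x
  proof -
    have "(\<Sum>j<N. \<psi> B j * x $ j) = (\<Sum>j<N. \<Sum>i<N. \<phi> i * \<rho> B $$ (i, j) * x $ j)"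
      by (simp add: \<psi>_def sum_distrib_right)
    also have "\<dots> = (\<Sum>i<N. \<Sum>j<N. \<phi> i * \<rho> B $$ (i, j) * x $ j)" by (rule sum.swap)
    also have "\<dots> = (\<Sum>i<N. (\<Sum>j<N. \<rho> B $$ (i, j) * x $ j) * \<phi> i)"
      by (simp add: sum_distrib_right sum_distrib_left algebra_simps)
    also have "\<dots> = (\<Sum>i<N. (\<rho> B *\<^sub>v x) $ i * \<phi> i)"
      by (simp add: mult_mat_vec_index[OF carr[OF that(1)] that(2)])
    finally show ?thesis .
  qed
  define R where "R = {rs :: (complex \<times> complex mat \<times> complex mat) list. \<forall>(c, A, B)\<in>set rs. A \<in> ?S \<and> B \<in> ?S}"
  define M where "M rs i j = (\<Sum>(c, A, B)\<leftarrow>rs. c * (\<rho> A *\<^sub>v v) $ i * \<psi> B j)" for rs i j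
  \<comment> \<open>The matrices that are sums of such terms.\<close>
  define good where "good m \<longleftrightarrow> (\<exists>rs\<in>R. \<forall>i<N. \<forall>j<N. m i j = M rs i j)" for m
  have good_zero: "good (\<lambda>i j. 0)"
    unfolding good_def by (rule bexI[of _ "[]"]) (auto simp: R_def M_def)
  have good_add: "good (\<lambda>i j. m i j + m' i j)" if "good m" "good m'" for m m'
  proof -
    obtain rs rs' where "rs \<in> R" "rs' \<in> R" "\<forall>i<N. \<forall>j<N. m i j = M rs i j" "\<forall>i<N. \<forall>j<N. m' i j = M rs' i j"
      using \<open>good m\<close> \<open>good m'\<close> by (auto simp: good_def)
    then show ?thesis unfolding good_def by (intro bexI[of _ "rs @ rs'"]) (auto simp: R_def M_def)
  qed
  have good_smult: "good (\<lambda>i j. c * m i j)" if "good m" for m c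
  proof -
    obtain rs where rs: "rs \<in> R" "\<forall>i<N. \<forall>j<N. m i j = M rs i j" using \<open>good m\<close> by (auto simp: good_def)
    have "M (map (\<lambda>(d, A, B). (c * d, A, B)) rs) i j = c * M rs i j" for i j
      unfolding M_def by (induction rs) (auto simp: algebra_simps)
    then show ?thesis unfolding good_def
      using rs by (intro bexI[of _ "map (\<lambda>(d, A, B). (c * d, A, B)) rs"]) (auto simp: R_def)
  qed
  have good_sum: "good (\<lambda>i j. \<Sum>k<n. m k i j)" if "\<And>k. k < n \<Longrightarrow> good (m k)" for m and n :: nat
    using that by (induction n) (auto intro: good_zero good_add)
  have good_cong: "good m" if "good m'" "\<And>i j. i < N \<Longrightarrow> j < N \<Longrightarrow> m i j = m' i j" for m m'
    using that unfolding good_def by auto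
  have good_left: "good (\<lambda>i j. \<Sum>k<N. \<rho> g $$ (i, k) * m k j)" if "good m" and g: "g \<in> ?S" for m g
  proof -
    obtain rs where rs: "rs \<in> R" "\<forall>i<N. \<forall>j<N. m i j = M rs i j" using \<open>good m\<close> by (auto simp: good_def)
    have "(\<Sum>k<N. \<rho> g $$ (i, k) * M rs k j) = M (map (\<lambda>(d, A, B). (d, g * A, B)) rs) i j"
      if "i < N" for i j
      using rs(1)
    proof (induction rs)
      case Nil
      then show ?case by (simp add: M_def)
    next
      case (Cons r rs)
      obtain c A B where r: "r = (c, A, B)" using prod_cases3 by blast
      have A: "A \<in> ?S" "rs \<in> R" using Cons.prems by (auto simp: R_def r)
      have "(\<Sum>k<N. \<rho> g $$ (i, k) * M (r # rs) k j) =
        c * (\<Sum>k<N. \<rho> g $$ (i, k) * (\<rho> A *\<^sub>v v) $ k) * \<psi> B j + (\<Sum>k<N. \<rho> g $$ (i, k) * M rs k j)"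
        by (simp add: M_def r algebra_simps sum.distrib sum_distrib_left)
      also have "(\<Sum>k<N. \<rho> g $$ (i, k) * (\<rho> A *\<^sub>v v) $ k) = (\<rho> (g * A) *\<^sub>v v) $ i"
        using mult_mat_vec_index[OF carr[OF g] vcarr[OF A(1) v] that]
          rational_rep_mult_vec[OF \<rho> g A(1) v] by simp
      finally show ?case using Cons.IH[OF A(2)] by (simp add: M_def r)
    qed
    then show ?thesis unfolding good_def
      using rs g by (intro bexI[of _ "map (\<lambda>(d, A, B). (d, g * A, B)) rs"]) (auto simp: R_def intro: Sp_mult)
  qed
  have one: "\<rho> (1\<^sub>m (2 * l)) *\<^sub>v x = x" if "x \<in> carrier_vec N" for x
    using that by (simp add: rational_rep_one[OF \<rho>])
  have v0: "v \<noteq> 0\<^sub>v N"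
    using nz one[OF v] f[OF Sp_one] by auto
  \<comment> \<open>The vectors that may replace \<open>\<rho>(A) v\<close> form a subrepresentation containing \<open>v\<close>.\<close>
  have left: "good (\<lambda>i j. x $ i * \<psi> B j)" if x: "x \<in> carrier_vec N" and B: "B \<in> ?S" for x B
  proof -
    let ?W = "{x \<in> carrier_vec N. good (\<lambda>i j. x $ i * \<psi> B j)}"
    have "?W = carrier_vec N"
    proof (rule irreducible_subspace_eq[OF irr _ _ _ _ _ _ v0])
      have "good (\<lambda>i j. 0\<^sub>v N $ i * \<psi> B j)" by (rule good_cong[OF good_zero]) auto
      then show "0\<^sub>v N \<in> ?W" by auto
    next
      fix x y assume "x \<in> ?W" "y \<in> ?W"
      then have xy: "x \<in> carrier_vec N" "y \<in> carrier_vec N" "good (\<lambda>i j. x $ i * \<psi> B j)" "good (\<lambda>i j. y $ i * \<psi> B j)" by auto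
      have "good (\<lambda>i j. (x + y) $ i * \<psi> B j)"
        by (rule good_cong[OF good_add[OF xy(3,4)]]) (use xy in \<open>auto simp: algebra_simps\<close>)
      then show "x + y \<in> ?W" using xy by auto
    next
      fix c x assume "x \<in> ?W"
      then have x: "x \<in> carrier_vec N" "good (\<lambda>i j. x $ i * \<psi> B j)" by auto
      have "good (\<lambda>i j. (c \<cdot>\<^sub>v x) $ i * \<psi> B j)"
        by (rule good_cong[OF good_smult[OF x(2), of c]]) (use x in \<open>auto simp: algebra_simps\<close>)
      then show "c \<cdot>\<^sub>v x \<in> ?W" using x by auto
    next
      fix g x assume g: "g \<in> ?S" and "x \<in> ?W"
      then have x: "x \<in> carrier_vec N" "good (\<lambda>i j. x $ i * \<psi> B j)" by auto
      have "good (\<lambda>i j. (\<rho> g *\<^sub>v x) $ i * \<psi> B j)"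
        by (rule good_cong[OF good_left[OF x(2) g]])
          (use mult_mat_vec_index[OF carr[OF g] x(1)] in \<open>simp add: sum_distrib_left sum_distrib_right algebra_simps\<close>)
      then show "\<rho> g *\<^sub>v x \<in> ?W" using vcarr[OF g x(1)] by auto
    next
      have "good (\<lambda>i j. v $ i * \<psi> B j)"
        unfolding good_def
        by (rule bexI[of _ "[(1, 1\<^sub>m (2 * l), B)]"]) (use one[OF v] B in \<open>auto simp: M_def R_def Sp_one\<close>)
      then show "v \<in> ?W" using v by auto
    qed auto
    then show ?thesis using x by auto
  qed
  \<comment> \<open>If the functionals did not span, they would have a common zero \<open>\<xi> \<noteq> 0\<close>, and then vanish at \<open>v\<close> too.\<close>
  have rank_one: "good (\<lambda>i j. x $ i * y j)" if x: "x \<in> carrier_vec N" for x and y :: "nat \<Rightarrow> complex"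
  proof (rule ccontr)
    assume bad: "\<not> good (\<lambda>i j. x $ i * y j)"
    let ?R = "{y. good (\<lambda>i j. x $ i * y j)}"
    have "\<exists>z. (\<forall>r\<in>?R. (\<Sum>i<N. r i * z i) = 0) \<and> (\<Sum>i<N. y i * z i) = 1"
    proof (rule separating_functional)
      show "(\<lambda>_. 0) \<in> ?R" using good_zero by simp
      show "(\<lambda>i. r i + s i) \<in> ?R" if "r \<in> ?R" "s \<in> ?R" for r s
        using good_add[of "\<lambda>i j. x $ i * r j" "\<lambda>i j. x $ i * s j"] that by (simp add: algebra_simps)
      show "(\<lambda>i. c * r i) \<in> ?R" if "r \<in> ?R" for c r
        using good_smult[of "\<lambda>i j. x $ i * r j" c] that by (simp add: algebra_simps)
      show "\<not> (\<exists>r\<in>?R. \<forall>i<N. r i = y i)"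
      proof
        assume "\<exists>r\<in>?R. \<forall>i<N. r i = y i"
        then obtain r where "good (\<lambda>i j. x $ i * r j)" "\<forall>i<N. r i = y i" by auto
        then have "good (\<lambda>i j. x $ i * y j)" using good_cong by auto
        with bad show False ..
      qed
    qed
    then obtain z where z: "\<And>r. good (\<lambda>i j. x $ i * r j) \<Longrightarrow> (\<Sum>i<N. r i * z i) = 0" "(\<Sum>i<N. y i * z i) = 1" by auto
    define \<xi> where "\<xi> = vec N z"
    have \<xi>: "\<xi> \<in> carrier_vec N" by (simp add: \<xi>_def)
    have \<xi>0: "\<xi> \<noteq> 0\<^sub>v N"
    proof
      assume "\<xi> = 0\<^sub>v N"
      then have "z i = 0" if "i < N" for i using that by (metis \<xi>_def index_vec index_zero_vec(1))
      then show False using z(2) by simp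
    qed
    let ?W = "{x \<in> carrier_vec N. \<forall>B\<in>?S. (\<Sum>i<N. (\<rho> B *\<^sub>v x) $ i * \<phi> i) = 0}"
    have "?W = carrier_vec N"
    proof (rule irreducible_subspace_eq[OF irr _ _ _ _ _ _ \<xi>0])
      show "0\<^sub>v N \<in> ?W" using \<psi>[of _ "0\<^sub>v N"] by auto
      show "a + b \<in> ?W" if "a \<in> ?W" "b \<in> ?W" for a b
      proof -
        have "(\<Sum>i<N. (\<rho> B *\<^sub>v (a + b)) $ i * \<phi> i) = 0" if B: "B \<in> ?S" for B
        proof -
          have "(\<Sum>i<N. (\<rho> B *\<^sub>v (a + b)) $ i * \<phi> i) = (\<Sum>j<N. \<psi> B j * (a + b) $ j)"
            using \<open>a \<in> ?W\<close> \<open>b \<in> ?W\<close> by (intro \<psi>[OF B, symmetric]) auto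
          also have "\<dots> = (\<Sum>j<N. \<psi> B j * a $ j) + (\<Sum>j<N. \<psi> B j * b $ j)"
            unfolding sum.distrib[symmetric] using \<open>a \<in> ?W\<close> \<open>b \<in> ?W\<close> by (intro sum.cong) (auto simp: algebra_simps)
          finally show ?thesis using \<psi>[OF B, of a] \<psi>[OF B, of b] \<open>a \<in> ?W\<close> \<open>b \<in> ?W\<close> B by auto
        qed
        then show ?thesis using that by auto
      qed
      show "c \<cdot>\<^sub>v a \<in> ?W" if "a \<in> ?W" for a c
      proof -
        have "(\<Sum>i<N. (\<rho> B *\<^sub>v (c \<cdot>\<^sub>v a)) $ i * \<phi> i) = 0" if B: "B \<in> ?S" for B
        proof -
          have "(\<Sum>i<N. (\<rho> B *\<^sub>v (c \<cdot>\<^sub>v a)) $ i * \<phi> i) = (\<Sum>j<N. \<psi> B j * (c \<cdot>\<^sub>v a) $ j)"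
            using \<open>a \<in> ?W\<close> by (intro \<psi>[OF B, symmetric]) auto
          also have "\<dots> = c * (\<Sum>j<N. \<psi> B j * a $ j)"
            unfolding sum_distrib_left using \<open>a \<in> ?W\<close> by (intro sum.cong) auto
          finally show ?thesis using \<psi>[OF B, of a] \<open>a \<in> ?W\<close> B by auto
        qed
        then show ?thesis using that by auto
      qed
      show "\<rho> A *\<^sub>v a \<in> ?W" if A: "A \<in> ?S" and a: "a \<in> ?W" for A a
      proof -
        have "\<rho> B *\<^sub>v (\<rho> A *\<^sub>v a) = \<rho> (B * A) *\<^sub>v a" if "B \<in> ?S" for B
          using rational_rep_mult_vec[OF \<rho> that A] a by auto
        then show ?thesis using a A vcarr[OF A] by (auto intro: Sp_mult)
      qed
      have "(\<Sum>i<N. (\<rho> B *\<^sub>v \<xi>) $ i * \<phi> i) = 0" if B: "B \<in> ?S" for B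
      proof -
        have "(\<Sum>i<N. \<psi> B i * z i) = 0" by (rule z(1)[OF left[OF x B]])
        then have "(\<Sum>i<N. \<psi> B i * \<xi> $ i) = 0" by (simp add: \<xi>_def)
        then show ?thesis using \<psi>[OF B \<xi>] by simp
      qed
      then show "\<xi> \<in> ?W" using \<xi> by auto
    qed auto
    then have "v \<in> ?W" using v by blast
    then show False using nz Sp_one[of l] f[OF Sp_one] by auto
  qed
  have "good (\<lambda>i j. \<Sum>k<N. unit_vec N k $ i * (if j = k then 1 else 0))"
    by (intro good_sum rank_one) auto
  then have "good (\<lambda>i j. if i = j then 1 else 0)"
    by (rule good_cong) (auto simp: if_distrib[of "\<lambda>x. _ * x"] cong: if_cong)
  then obtain rs where rs: "rs \<in> R" "\<And>i j. i < N \<Longrightarrow> j < N \<Longrightarrow> M rs i j = (if i = j then 1 else 0)"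
    by (auto simp: good_def)
  have F: "(\<Sum>j<N. \<psi> B j * (\<rho> A *\<^sub>v v) $ j) = f (B * A)" if "A \<in> ?S" "B \<in> ?S" for A B
    using \<psi>[OF that(2) vcarr[OF that(1) v]] rational_rep_mult_vec[OF \<rho> that(2,1) v]
      f[OF Sp_mult[OF that(2,1)]]
    by simp
  have R: "A \<in> ?S \<and> B \<in> ?S" if "(c, A, B) \<in> set rs" for c A B using rs(1) that by (auto simp: R_def)
  show ?thesis
  proof (rule that[of rs])
    show "A \<in> ?S \<and> B \<in> ?S" if "(c, A, B) \<in> set rs" for c A B using R that .
  next
    fix g assume g: "g \<in> ?S"
    have "(\<Sum>i<N. \<rho> g $$ (i, i)) = (\<Sum>i<N. \<Sum>j<N. \<rho> g $$ (i, j) * (if j = i then 1 else 0))"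
      by (simp add: if_distrib[of "\<lambda>x. _ * x"] cong: if_cong)
    also have "\<dots> = (\<Sum>i<N. \<Sum>j<N. \<rho> g $$ (i, j) * M rs j i)"
      by (intro sum.cong refl) (simp add: rs(2))
    also have "\<dots> = (\<Sum>i<N. \<Sum>j<N. \<Sum>(c, A, B)\<leftarrow>rs. \<rho> g $$ (i, j) * (c * (\<rho> A *\<^sub>v v) $ j * \<psi> B i))"
      by (simp add: M_def sum_list_const_mult[symmetric] case_prod_unfold)
    also have "\<dots> = (\<Sum>(c, A, B)\<leftarrow>rs. \<Sum>i<N. \<Sum>j<N. \<rho> g $$ (i, j) * (c * (\<rho> A *\<^sub>v v) $ j * \<psi> B i))"
      by (simp add: sum_sum_list_swap case_prod_unfold)
    also have "\<dots> = (\<Sum>(c, A, B)\<leftarrow>rs. c * f (B * g * A))"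
    proof (intro arg_cong[of _ _ sum_list] map_cong refl)
      fix r assume r: "r \<in> set rs"
      obtain c A B where rr: "r = (c, A, B)" using prod_cases3 by blast
      have AB: "A \<in> ?S" "B \<in> ?S" using R r rr by auto
      have "(\<Sum>i<N. \<Sum>j<N. \<rho> g $$ (i, j) * (c * (\<rho> A *\<^sub>v v) $ j * \<psi> B i)) =
          c * (\<Sum>i<N. \<psi> B i * (\<Sum>j<N. \<rho> g $$ (i, j) * (\<rho> A *\<^sub>v v) $ j))"
        by (simp add: sum_distrib_left algebra_simps)
      also have "\<dots> = c * (\<Sum>i<N. \<psi> B i * (\<rho> (g * A) *\<^sub>v v) $ i)"
        using mult_mat_vec_index[OF carr[OF g] vcarr[OF AB(1) v]] rational_rep_mult_vec[OF \<rho> g AB(1) v] by simp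
      also have "\<dots> = c * f (B * (g * A))" by (simp add: F AB g Sp_mult)
      also have "B * (g * A) = B * g * A"
        using Sp_carrier_mat AB g by (metis assoc_mult_mat)
      finally show "(case r of (c, A, B) \<Rightarrow> \<Sum>i<N. \<Sum>j<N. \<rho> g $$ (i, j) * (c * (\<rho> A *\<^sub>v v) $ j * \<psi> B i)) =
        (case r of (c, A, B) \<Rightarrow> c * f (B * g * A))" by (simp add: rr)
    qed
    finally show "(\<Sum>i<N. \<rho> g $$ (i, i)) = (\<Sum>(c, A, B)\<leftarrow>rs. c * f (B * g * A))" .
  next
    fix A' B' assume A': "A' \<in> ?S" and B': "B' \<in> ?S"
    have "f (B' * A') = (\<Sum>i<N. \<Sum>j<N. \<psi> B' i * (if i = j then 1 else 0) * (\<rho> A' *\<^sub>v v) $ j)"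
      by (simp add: F[OF A' B', symmetric] if_distrib[of "\<lambda>x. _ * x"] if_distrib[of "\<lambda>x. x * _"] cong: if_cong)
    also have "\<dots> = (\<Sum>i<N. \<Sum>j<N. \<psi> B' i * M rs i j * (\<rho> A' *\<^sub>v v) $ j)"
      by (intro sum.cong refl) (simp add: rs(2))
    also have "\<dots> = (\<Sum>i<N. \<Sum>j<N. \<Sum>(c, A, B)\<leftarrow>rs. \<psi> B' i * (c * (\<rho> A *\<^sub>v v) $ i * \<psi> B j) * (\<rho> A' *\<^sub>v v) $ j)"
      by (simp add: M_def sum_list_const_mult[symmetric] sum_list_mult_const[symmetric] case_prod_unfold)
    also have "\<dots> = (\<Sum>(c, A, B)\<leftarrow>rs. \<Sum>i<N. \<Sum>j<N. \<psi> B' i * (c * (\<rho> A *\<^sub>v v) $ i * \<psi> B j) * (\<rho> A' *\<^sub>v v) $ j)"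
      by (simp add: sum_sum_list_swap case_prod_unfold)
    also have "\<dots> = (\<Sum>(c, A, B)\<leftarrow>rs. c * f (B' * A) * f (B * A'))"
    proof (intro arg_cong[of _ _ sum_list] map_cong refl)
      fix r assume r: "r \<in> set rs"
      obtain c A B where rr: "r = (c, A, B)" using prod_cases3 by blast
      have AB: "A \<in> ?S" "B \<in> ?S" using R r rr by auto
      have "(\<Sum>i<N. \<Sum>j<N. \<psi> B' i * (c * (\<rho> A *\<^sub>v v) $ i * \<psi> B j) * (\<rho> A' *\<^sub>v v) $ j) =
        c * (\<Sum>i<N. \<psi> B' i * (\<rho> A *\<^sub>v v) $ i) * (\<Sum>j<N. \<psi> B j * (\<rho> A' *\<^sub>v v) $ j)"
        by (simp add: sum_product sum_distrib_left algebra_simps)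
      then show "(case r of (c, A, B) \<Rightarrow> \<Sum>i<N. \<Sum>j<N. \<psi> B' i * (c * (\<rho> A *\<^sub>v v) $ i * \<psi> B j) * (\<rho> A' *\<^sub>v v) $ j) =
        (case r of (c, A, B) \<Rightarrow> c * f (B' * A) * f (B * A'))"
        by (simp add: rr F AB A' B')
    qed
    finally show "(\<Sum>(c, A, B)\<leftarrow>rs. c * f (B' * A) * f (B * A')) = f (B' * A')" ..
  qed
qed

text \<open>
Suppose that the coefficient \<open>f\<close> also arises from another space with coordinates indexed by \<open>I\<close>, on which \<open>g\<close>
acts by the matrix \<open>\<sigma> g\<close>, through vectors \<open>W A\<close> and functionals \<open>\<Psi> B\<close>. The second space may be larger than
the representation. The matrix \<open>E\<close> is the sum of the terms \<open>c * W A * \<Psi> B\<close> of the resolution of the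
identity; it is meant to be the projection onto the span of the vectors \<open>W A\<close> along the common kernel of the
functionals \<open>\<Psi> B\<close>. The trace of \<open>\<rho>(g)\<close> is the trace of \<open>\<sigma>(g) E\<close>, and the other three properties suffice to
compute \<open>E\<close> in concrete cases.
\<close>

lemma resolution_kernel:
  fixes W \<Psi> :: "complex mat \<Rightarrow> 'i \<Rightarrow> complex" and \<sigma> :: "complex mat \<Rightarrow> 'i \<Rightarrow> 'i \<Rightarrow> complex"
  assumes irr: "irreducible_rep l N \<rho>" and v: "v \<in> carrier_vec N"
    and f: "\<And>A. A \<in> carrier (Sp l) \<Longrightarrow> (\<Sum>i<N. (\<rho> A *\<^sub>v v) $ i * \<phi> i) = f A"
    and nz: "f (1\<^sub>m (2 * l)) \<noteq> 0"
    and pair: "\<And>A B. A \<in> carrier (Sp l) \<Longrightarrow> B \<in> carrier (Sp l) \<Longrightarrow> f (B * A) = (\<Sum>p\<in>I. \<Psi> B p * W A p)"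
    and act: "\<And>g A p. g \<in> carrier (Sp l) \<Longrightarrow> A \<in> carrier (Sp l) \<Longrightarrow> p \<in> I \<Longrightarrow>
      W (g * A) p = (\<Sum>q\<in>I. \<sigma> g p q * W A q)"
  obtains E where
    "\<And>g. g \<in> carrier (Sp l) \<Longrightarrow> (\<Sum>i<N. \<rho> g $$ (i, i)) = (\<Sum>p\<in>I. \<Sum>q\<in>I. \<sigma> g p q * E q p)"
    "\<And>A B. A \<in> carrier (Sp l) \<Longrightarrow> B \<in> carrier (Sp l) \<Longrightarrow>
      (\<Sum>p\<in>I. \<Psi> B p * (\<Sum>q\<in>I. E p q * W A q)) = (\<Sum>p\<in>I. \<Psi> B p * W A p)"
    "\<And>K q. (\<And>A. A \<in> carrier (Sp l) \<Longrightarrow> (\<Sum>p\<in>I. K p * W A p) = 0) \<Longrightarrow> (\<Sum>p\<in>I. K p * E p q) = 0"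
    "\<And>K p. (\<And>B. B \<in> carrier (Sp l) \<Longrightarrow> (\<Sum>q\<in>I. \<Psi> B q * K q) = 0) \<Longrightarrow> (\<Sum>q\<in>I. E p q * K q) = 0"
proof -
  obtain rs :: "(complex \<times> complex mat \<times> complex mat) list"
  where rs: "\<And>c A B. (c, A, B) \<in> set rs \<Longrightarrow> A \<in> carrier (Sp l) \<and> B \<in> carrier (Sp l)"
    and tr: "\<And>g. g \<in> carrier (Sp l) \<Longrightarrow> (\<Sum>i<N. \<rho> g $$ (i, i)) = (\<Sum>(c, A, B)\<leftarrow>rs. c * f (B * g * A))"
    and rep: "\<And>A' B'. A' \<in> carrier (Sp l) \<Longrightarrow> B' \<in> carrier (Sp l) \<Longrightarrow>
      (\<Sum>(c, A, B)\<leftarrow>rs. c * f (B' * A) * f (B * A')) = f (B' * A')"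
    using coefficient_resolution[OF irr v f nz] by blast
  define E where "E p q = (\<Sum>(c, A, B)\<leftarrow>rs. c * W A p * \<Psi> B q)" for p q
  have cong: "(\<Sum>r\<leftarrow>rs. g r) = (\<Sum>r\<leftarrow>rs. h r)"
    if "\<And>c A B. A \<in> carrier (Sp l) \<Longrightarrow> B \<in> carrier (Sp l) \<Longrightarrow> g (c, A, B) = h (c, A, B)"
    for g h :: "_ \<Rightarrow> complex"
    by (intro arg_cong[of _ _ sum_list] map_cong refl) (use rs that in force)
  have E: "(\<Sum>p\<in>I. \<Sum>q\<in>I. k p q * E p q) = (\<Sum>(c, A, B)\<leftarrow>rs. \<Sum>p\<in>I. \<Sum>q\<in>I. k p q * (c * W A p * \<Psi> B q))" for k
    by (simp add: E_def sum_list_const_mult[symmetric] sum_sum_list_swap case_prod_unfold)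
  have E1: "(\<Sum>p\<in>I. k p * E p q) = (\<Sum>(c, A, B)\<leftarrow>rs. \<Sum>p\<in>I. k p * (c * W A p * \<Psi> B q))" for k q
    by (simp add: E_def sum_list_const_mult[symmetric] sum_sum_list_swap case_prod_unfold)
  have E2: "(\<Sum>q\<in>I. E p q * k q) = (\<Sum>(c, A, B)\<leftarrow>rs. \<Sum>q\<in>I. (c * W A p * \<Psi> B q) * k q)" for k p
    by (simp add: E_def sum_list_mult_const[symmetric] sum_sum_list_swap case_prod_unfold)
  show ?thesis
  proof (rule that[of E])
    fix g assume g: "g \<in> carrier (Sp l)"
    have "(\<Sum>i<N. \<rho> g $$ (i, i)) = (\<Sum>(c, A, B)\<leftarrow>rs. c * f (B * g * A))" by (rule tr[OF g])
    also have "\<dots> = (\<Sum>(c, A, B)\<leftarrow>rs. \<Sum>p\<in>I. \<Sum>q\<in>I. \<sigma> g q p * (c * W A p * \<Psi> B q))"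
    proof (rule cong)
      fix c A B assume A: "A \<in> carrier (Sp l)" and B: "B \<in> carrier (Sp l)"
      have "B * g * A = B * (g * A)" using Sp_carrier_mat A B g by (metis assoc_mult_mat)
      then have "f (B * g * A) = (\<Sum>q\<in>I. \<Psi> B q * (\<Sum>p\<in>I. \<sigma> g q p * W A p))"
        using pair[OF Sp_mult[OF g A] B] act[OF g A] by simp
      also have "\<dots> = (\<Sum>q\<in>I. \<Sum>p\<in>I. \<Psi> B q * (\<sigma> g q p * W A p))" by (simp add: sum_distrib_left)
      also have "\<dots> = (\<Sum>p\<in>I. \<Sum>q\<in>I. \<Psi> B q * (\<sigma> g q p * W A p))" by (rule sum.swap)
      finally show "(case (c, A, B) of (c, A, B) \<Rightarrow> c * f (B * g * A)) =
        (case (c, A, B) of (c, A, B) \<Rightarrow> \<Sum>p\<in>I. \<Sum>q\<in>I. \<sigma> g q p * (c * W A p * \<Psi> B q))"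
        by (simp add: sum_distrib_left ac_simps)
    qed
    also have "\<dots> = (\<Sum>p\<in>I. \<Sum>q\<in>I. \<sigma> g q p * E p q)" by (rule E[symmetric])
    also have "\<dots> = (\<Sum>p\<in>I. \<Sum>q\<in>I. \<sigma> g p q * E q p)" by (rule sum.swap)
    finally show "(\<Sum>i<N. \<rho> g $$ (i, i)) = (\<Sum>p\<in>I. \<Sum>q\<in>I. \<sigma> g p q * E q p)" .
  next
    fix A' B' assume A': "A' \<in> carrier (Sp l)" and B': "B' \<in> carrier (Sp l)"
    have "(\<Sum>p\<in>I. \<Psi> B' p * (\<Sum>q\<in>I. E p q * W A' q)) = (\<Sum>p\<in>I. \<Sum>q\<in>I. (\<Psi> B' p * W A' q) * E p q)"
      by (simp add: sum_distrib_left ac_simps)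
    also have "\<dots> = (\<Sum>(c, A, B)\<leftarrow>rs. \<Sum>p\<in>I. \<Sum>q\<in>I. (\<Psi> B' p * W A' q) * (c * W A p * \<Psi> B q))" by (rule E)
    also have "\<dots> = (\<Sum>(c, A, B)\<leftarrow>rs. c * f (B' * A) * f (B * A'))"
    proof (rule cong)
      fix c A B assume A: "A \<in> carrier (Sp l)" and B: "B \<in> carrier (Sp l)"
      show "(case (c, A, B) of (c, A, B) \<Rightarrow> \<Sum>p\<in>I. \<Sum>q\<in>I. (\<Psi> B' p * W A' q) * (c * W A p * \<Psi> B q)) =
        (case (c, A, B) of (c, A, B) \<Rightarrow> c * f (B' * A) * f (B * A'))"
        by (simp add: pair[OF A B'] pair[OF A' B] sum_product sum_distrib_left ac_simps)
    qed
    also have "\<dots> = (\<Sum>p\<in>I. \<Psi> B' p * W A' p)" using rep[OF A' B'] pair[OF A' B'] by simp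
    finally show "(\<Sum>p\<in>I. \<Psi> B' p * (\<Sum>q\<in>I. E p q * W A' q)) = (\<Sum>p\<in>I. \<Psi> B' p * W A' p)" .
  next
    fix K q assume K: "\<And>A. A \<in> carrier (Sp l) \<Longrightarrow> (\<Sum>p\<in>I. K p * W A p) = 0"
    have "(\<Sum>(c, A, B)\<leftarrow>rs. \<Sum>p\<in>I. K p * (c * W A p * \<Psi> B q)) = (\<Sum>r\<leftarrow>rs. 0)"
    proof (rule cong)
      fix c A B assume A: "A \<in> carrier (Sp l)"
      have "(\<Sum>p\<in>I. K p * (c * W A p * \<Psi> B q)) = c * \<Psi> B q * (\<Sum>p\<in>I. K p * W A p)"
        by (simp add: sum_distrib_left ac_simps)
      then show "(case (c, A, B) of (c, A, B) \<Rightarrow> \<Sum>p\<in>I. K p * (c * W A p * \<Psi> B q)) = 0" by (simp add: K[OF A])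
    qed
    then show "(\<Sum>p\<in>I. K p * E p q) = 0" by (simp add: E1)
  next
    fix K p assume K: "\<And>B. B \<in> carrier (Sp l) \<Longrightarrow> (\<Sum>q\<in>I. \<Psi> B q * K q) = 0"
    have "(\<Sum>(c, A, B)\<leftarrow>rs. \<Sum>q\<in>I. (c * W A p * \<Psi> B q) * K q) = (\<Sum>r\<leftarrow>rs. 0)"
    proof (rule cong)
      fix c A B assume B: "B \<in> carrier (Sp l)"
      have "(\<Sum>q\<in>I. (c * W A p * \<Psi> B q) * K q) = c * W A p * (\<Sum>q\<in>I. \<Psi> B q * K q)"
        by (simp add: sum_distrib_left ac_simps)
      then show "(case (c, A, B) of (c, A, B) \<Rightarrow> \<Sum>q\<in>I. (c * W A p * \<Psi> B q) * K q) = 0" by (simp add: K[OF B])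
    qed
    then show "(\<Sum>q\<in>I. E p q * K q) = 0" by (simp add: E2)
  qed
qed

section \<open>The trace on the first fundamental representation\<close>

text \<open>
The first rows of symplectic matrices span. It is enough to use transvections along vectors whose first
coordinate is 1.
\<close>

lemma Sp_row_separates:
  assumes l: "l \<ge> 1" and y: "\<And>B. B \<in> carrier (Sp l) \<Longrightarrow> (\<Sum>i<2*l. B $$ (0, i) * y i) = 0"
    and k: "k < 2 * l"
  shows "y k = 0"
proof -
  define Y where "Y = vec (2 * l) y"
  have Y: "Y \<in> carrier_vec (2 * l)" by (simp add: Y_def)
  have z: "(B *\<^sub>v Y) $ 0 = 0" if "B \<in> carrier (Sp l)" for B
    using y[OF that] l by (subst mult_mat_vec_index[OF Sp_carrier_mat[OF that] Y]) (auto simp: Y_def)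
  have Y0: "Y $ 0 = 0" using z[OF Sp_one] Y by simp
  have w: "symp l w Y = 0" if w: "w \<in> carrier_vec (2 * l)" "w $ 0 = 1" for w
  proof -
    have "(transvection l 1 w *\<^sub>v Y) $ 0 = symp l w Y"
      using w Y Y0 l by (subst transvection_mult_vec) auto
    then show ?thesis using z[OF transvection_Sp[OF w(1)]] by simp
  qed
  let ?u = "unit_vec (2 * l) :: nat \<Rightarrow> complex vec"
  have u0: "symp l (?u 0) Y = 0" by (rule w) (use l in auto)
  have "symp l (?u i) Y = 0" if i: "i < 2 * l" for i
  proof (cases "i = 0")
    case False
    have "symp l (?u 0 + ?u i) Y = 0" by (rule w) (use l i False in auto)
    then show ?thesis using u0 by (simp add: symp_add_left)
  qed (use u0 in simp)
  from this[of "2 * l - 1 - k"] have "Y $ k = 0"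
    using k Y by (simp add: symp_unit_left split: if_splits)
  then show ?thesis using k by (simp add: Y_def)
qed

lemma sum_mult_delta:
  fixes x :: "nat \<Rightarrow> complex"
  assumes "i < n"
  shows "(\<Sum>j<n. (if i = j then 1 else 0) * x j) = x i" "(\<Sum>j<n. x j * (if i = j then 1 else 0)) = x i"
    "(\<Sum>j<n. (if j = i then 1 else 0) * x j) = x i" "(\<Sum>j<n. x j * (if j = i then 1 else 0)) = x i"
  using assms by (simp_all add: if_distrib[of "\<lambda>a. a * _"] if_distrib[of "\<lambda>a. _ * a"] cong: if_cong)

text \<open>
Here the second space is the natural representation, and the projection \<open>E\<close> is the identity.
\<close>

lemma trace_fundamental_rep_1:
  assumes l: "l \<ge> 1" and fr: "fundamental_rep l 1 N \<rho>" and g: "g \<in> carrier (Sp l)"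
  shows "(\<Sum>i<N. \<rho> g $$ (i, i)) = (\<Sum>i<2*l. g $$ (i, i))"
proof -
  obtain v where v: "highest_weight_vector l N \<rho> (fundamental_weight 1) v" and irr: "irreducible_rep l N \<rho>"
    using fr by (auto simp: fundamental_rep_def)
  have vc: "v \<in> carrier_vec N" using v by (simp add: highest_weight_vector_def)
  have rat: "rational_rep l N \<rho>" using irr by (simp add: irreducible_rep_def)
  obtain \<phi> where \<phi>: "\<And>A. A \<in> carrier (Sp l) \<Longrightarrow> (\<Sum>i<N. (\<rho> A *\<^sub>v v) $ i * \<phi> i) = leading_minor 1 A"
    using fundamental_rep_coefficient[OF rat v l] by blast
  have lm: "leading_minor 1 A = A $$ (0, 0)" for A
    using det_single[of "mat 1 1 (($$) A)"] by (simp add: leading_minor_def)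
  have prod: "(A * B) $$ (i, j) = (\<Sum>k<2*l. A $$ (i, k) * B $$ (k, j))"
    if "A \<in> carrier (Sp l)" "B \<in> carrier (Sp l)" "i < 2 * l" "j < 2 * l" for A B i j
    by (rule mult_mat_index) (use that Sp_carrier_mat in auto)
  obtain E where E:
    "\<And>g. g \<in> carrier (Sp l) \<Longrightarrow> (\<Sum>i<N. \<rho> g $$ (i, i)) = (\<Sum>p<2*l. \<Sum>q<2*l. g $$ (p, q) * E q p)"
    "\<And>A B. A \<in> carrier (Sp l) \<Longrightarrow> B \<in> carrier (Sp l) \<Longrightarrow>
      (\<Sum>p<2*l. B $$ (0, p) * (\<Sum>q<2*l. E p q * A $$ (q, 0))) = (\<Sum>p<2*l. B $$ (0, p) * A $$ (p, 0))"
  proof (rule resolution_kernel[OF irr vc \<phi>, where I = "{..<2*l}" and W = "\<lambda>A p. A $$ (p, 0)"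
        and \<Psi> = "\<lambda>B p. B $$ (0, p)" and \<sigma> = "\<lambda>g p q. g $$ (p, q)"])
    show "leading_minor 1 (1\<^sub>m (2 * l)) \<noteq> 0" unfolding lm using l by simp
    show "leading_minor 1 (B * A) = (\<Sum>p<2*l. B $$ (0, p) * A $$ (p, 0))"
      if "A \<in> carrier (Sp l)" "B \<in> carrier (Sp l)" for A B
      unfolding lm using prod[OF that(2,1)] l by simp
    show "(g * A) $$ (p, 0) = (\<Sum>q<2*l. g $$ (p, q) * A $$ (q, 0))"
      if "g \<in> carrier (Sp l)" "A \<in> carrier (Sp l)" "p \<in> {..<2*l}" for g A p
      using prod[OF that(1,2)] that(3) l by simp
  next
    fix E
    assume "\<And>g. g \<in> carrier (Sp l) \<Longrightarrow> (\<Sum>i<N. \<rho> g $$ (i, i)) = (\<Sum>p<2*l. \<Sum>q<2*l. g $$ (p, q) * E q p)"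
      "\<And>A B. A \<in> carrier (Sp l) \<Longrightarrow> B \<in> carrier (Sp l) \<Longrightarrow>
        (\<Sum>p<2*l. B $$ (0, p) * (\<Sum>q<2*l. E p q * A $$ (q, 0))) = (\<Sum>p<2*l. B $$ (0, p) * A $$ (p, 0))"
    then show thesis by (rule that)
  qed
  have EW: "(\<Sum>q<2*l. E p q * A $$ (q, 0)) - A $$ (p, 0) = 0" if A: "A \<in> carrier (Sp l)" and p: "p < 2 * l" for A p
    by (rule Sp_row_separates[OF l _ p])
      (use E(2)[OF A] in \<open>simp add: right_diff_distrib sum_subtractf\<close>)
  have E1: "E p q = (if p = q then 1 else 0)" if p: "p < 2 * l" and q: "q < 2 * l" for p q
  proof -
    have "E p q - (if p = q then 1 else 0) = 0"
    proof (rule Sp_row_separates[OF l _ q])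
      fix B assume B: "B \<in> carrier (Sp l)"
      have "(\<Sum>i<2*l. B $$ (0, i) * (E p i - (if p = i then 1 else 0))) =
         (\<Sum>i<2*l. E p i * transpose_mat B $$ (i, 0)) - (\<Sum>i<2*l. transpose_mat B $$ (i, 0) * (if p = i then 1 else 0))"
        unfolding sum_subtractf[symmetric]
        by (rule sum.cong) (use Sp_carrier_mat[OF B] l in \<open>auto simp: algebra_simps\<close>)
      also have "\<dots> = 0" using EW[OF Sp_transpose[OF B] p] by (simp only: sum_mult_delta[OF p])
      finally show "(\<Sum>i<2*l. B $$ (0, i) * (E p i - (if p = i then 1 else 0))) = 0" .
    qed
    then show ?thesis by simp
  qed
  have "(\<Sum>p<2*l. \<Sum>q<2*l. g $$ (p, q) * E q p) = (\<Sum>p<2*l. \<Sum>q<2*l. g $$ (p, q) * (if q = p then 1 else 0))"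
    by (intro sum.cong refl) (simp add: E1)
  also have "\<dots> = (\<Sum>p<2*l. g $$ (p, p))" by (intro sum.cong refl) (simp add: sum_mult_delta)
  finally show ?thesis using E(1)[OF g] by simp
qed

section \<open>The trace on the second fundamental representation\<close>

lemma leading_minor_2: "leading_minor 2 A = A $$ (0, 0) * A $$ (1, 1) - A $$ (0, 1) * A $$ (1, 0)"
proof -
  let ?M = "mat 2 2 (($$) A)"
  have "(\<Sum>i<2. ?M $$ (i, 0) * cofactor ?M i 0) = det ?M"
    by (rule laplace_expansion_column[symmetric]) auto
  moreover have "det (mat_delete ?M 0 0) = A $$ (1, 1)" "det (mat_delete ?M 1 0) = A $$ (0, 1)"
    by (subst det_single; simp add: mat_delete_def)+
  ultimately show ?thesis
    by (simp add: leading_minor_def cofactor_def numeral_2_eq_2 lessThan_Suc algebra_simps)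
qed

definition wedge_form :: "nat \<Rightarrow> (nat \<Rightarrow> nat \<Rightarrow> complex) \<Rightarrow> complex vec \<Rightarrow> complex vec \<Rightarrow> complex" where
  "wedge_form n Y x y = (\<Sum>i<n. \<Sum>j<n. x $ i * y $ j * Y i j)"

lemma wedge_form_add_left: "x \<in> carrier_vec n \<Longrightarrow> x' \<in> carrier_vec n \<Longrightarrow>
    wedge_form n Y (x + x') y = wedge_form n Y x y + wedge_form n Y x' y"
  unfolding wedge_form_def sum.distrib[symmetric] by (intro sum.cong refl) (auto simp: algebra_simps)

lemma wedge_form_add_right: "y \<in> carrier_vec n \<Longrightarrow> y' \<in> carrier_vec n \<Longrightarrow>
    wedge_form n Y x (y + y') = wedge_form n Y x y + wedge_form n Y x y'"
  unfolding wedge_form_def sum.distrib[symmetric] by (intro sum.cong refl) (auto simp: algebra_simps)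

lemma wedge_form_smult_left: "x \<in> carrier_vec n \<Longrightarrow> wedge_form n Y (c \<cdot>\<^sub>v x) y = c * wedge_form n Y x y"
  unfolding wedge_form_def sum_distrib_left by (intro sum.cong refl) (auto simp: algebra_simps)

lemma wedge_form_smult_right: "y \<in> carrier_vec n \<Longrightarrow> wedge_form n Y x (c \<cdot>\<^sub>v y) = c * wedge_form n Y x y"
  unfolding wedge_form_def sum_distrib_left by (intro sum.cong refl) (auto simp: algebra_simps)

lemma wedge_form_minus_left: "x \<in> carrier_vec n \<Longrightarrow> x' \<in> carrier_vec n \<Longrightarrow>
    wedge_form n Y (x - x') y = wedge_form n Y x y - wedge_form n Y x' y"
  unfolding wedge_form_def sum_subtractf[symmetric] by (intro sum.cong refl) (auto simp: algebra_simps)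

lemmas wedge_form_linear = wedge_form_add_left wedge_form_add_right wedge_form_smult_left
  wedge_form_smult_right wedge_form_minus_left

lemma wedge_form_swap:
  assumes "\<And>i j. i < n \<Longrightarrow> j < n \<Longrightarrow> Y j i = - Y i j"
  shows "wedge_form n Y y x = - wedge_form n Y x y"
proof -
  have "wedge_form n Y y x = (\<Sum>j<n. \<Sum>i<n. y $ i * x $ j * Y i j)"
    unfolding wedge_form_def by (rule sum.swap)
  also have "\<dots> = - wedge_form n Y x y"
    unfolding wedge_form_def sum_negf[symmetric]
  proof (intro sum.cong refl)
    fix a b assume "a \<in> {..<n}" "b \<in> {..<n}"
    then have "Y b a = - Y a b" by (intro assms) auto
    then show "y $ b * x $ a * Y b a = - (x $ a * y $ b * Y a b)" by simp
  qed
  finally show ?thesis .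
qed

lemma wedge_form_unit:
  assumes "i < n" "j < n"
  shows "wedge_form n Y (unit_vec n i) (unit_vec n j) = Y i j"
proof -
  have "wedge_form n Y (unit_vec n i) (unit_vec n j) =
      (\<Sum>a<n. \<Sum>b<n. (if a = i then 1 else 0) * ((if b = j then 1 else 0) * Y a b))"
    unfolding wedge_form_def by (intro sum.cong refl) (use assms in auto)
  also have "\<dots> = Y i j"
    using assms by (simp add: sum_distrib_left[symmetric] sum_mult_delta)
  finally show ?thesis .
qed

text \<open>
An alternating form that vanishes on the first two columns of every symplectic matrix is a multiple of the
symplectic form. Vanishing at \<open>(A x, A y)\<close> for all \<open>A\<close> is inherited by other pairs of vectors, when \<open>A\<close>
is replaced by its product with a transvection; this is \<open>step\<close>. Starting from the first two basis vectors, it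
leads to all pairs of orthogonal vectors exactly one of which is orthogonal to the first basis vector. Linear
combinations of such pairs determine the form up to a factor.
\<close>

lemma Sp_decomposable_separates:
  assumes l: "l \<ge> 2" and anti: "\<And>i j. i < 2 * l \<Longrightarrow> j < 2 * l \<Longrightarrow> Y j i = - Y i j"
    and van: "\<And>A. A \<in> carrier (Sp l) \<Longrightarrow> (\<Sum>i<2*l. \<Sum>j<2*l. A $$ (i, 0) * A $$ (j, 1) * Y i j) = 0"
    and ij: "i < 2 * l" "j < 2 * l"
  shows "Y i j = Y 0 (2 * l - 1) * sympl_form l $$ (i, j)"
proof -
  let ?n = "2 * l" and ?u = "unit_vec (2 * l) :: nat \<Rightarrow> complex vec"
  let ?b = "wedge_form (2 * l) Y"
  let ?S = "carrier (Sp l)"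
  have swap: "?b y x = - ?b x y" for x y by (rule wedge_form_swap) (rule anti)
  have self: "?b x x = 0" for x using swap[of x x] by simp
  have Ac: "A *\<^sub>v x \<in> carrier_vec ?n" if "A \<in> ?S" "x \<in> carrier_vec ?n" for A x
    using Sp_carrier_mat[OF that(1)] that(2) by (rule mult_mat_vec_carrier)
  have step: "symp l w y * ?b (A *\<^sub>v x) (A *\<^sub>v w) + symp l w x * ?b (A *\<^sub>v w) (A *\<^sub>v y) = 0"
    if H: "\<And>A. A \<in> ?S \<Longrightarrow> ?b (A *\<^sub>v x) (A *\<^sub>v y) = 0"
      and xy: "x \<in> carrier_vec ?n" "y \<in> carrier_vec ?n" "w \<in> carrier_vec ?n" and A: "A \<in> ?S" for w x y A
  proof -
    have T: "transvection l 1 w \<in> ?S" by (rule transvection_Sp[OF xy(3)])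
    have AT: "(A * transvection l 1 w) *\<^sub>v z = A *\<^sub>v z + symp l w z \<cdot>\<^sub>v (A *\<^sub>v w)"
      if z: "z \<in> carrier_vec ?n" for z
    proof -
      have "(A * transvection l 1 w) *\<^sub>v z = A *\<^sub>v (transvection l 1 w *\<^sub>v z)"
        using Sp_carrier_mat[OF A] z by (simp add: assoc_mult_mat_vec[of _ ?n ?n _ ?n])
      also have "\<dots> = A *\<^sub>v (z + symp l w z \<cdot>\<^sub>v w)" using z xy by (simp add: transvection_mult_vec)
      also have "\<dots> = A *\<^sub>v z + symp l w z \<cdot>\<^sub>v (A *\<^sub>v w)"
        using Sp_carrier_mat[OF A] z xy by (simp add: mult_add_distrib_mat_vec[of _ ?n ?n] mult_mat_vec[of _ ?n ?n])
      finally show ?thesis .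
    qed
    have "0 = ?b (A *\<^sub>v x + symp l w x \<cdot>\<^sub>v (A *\<^sub>v w)) (A *\<^sub>v y + symp l w y \<cdot>\<^sub>v (A *\<^sub>v w))"
      using H[OF Sp_mult[OF A T]] AT[OF xy(1)] AT[OF xy(2)] by simp
    also have "\<dots> = symp l w y * ?b (A *\<^sub>v x) (A *\<^sub>v w) + symp l w x * ?b (A *\<^sub>v w) (A *\<^sub>v y)"
      using Ac[OF A xy(1)] Ac[OF A xy(2)] Ac[OF A xy(3)] H[OF A] self
      by (simp add: wedge_form_linear algebra_simps)
    finally show ?thesis by simp
  qed
  have H01: "?b (A *\<^sub>v ?u 0) (A *\<^sub>v ?u 1) = 0" if A: "A \<in> ?S" for A
  proof -
    have "?b (A *\<^sub>v ?u 0) (A *\<^sub>v ?u 1) = (\<Sum>i<?n. \<Sum>j<?n. A $$ (i, 0) * A $$ (j, 1) * Y i j)"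
      unfolding wedge_form_def
      by (intro sum.cong refl) (use Sp_carrier_mat[OF A] l in \<open>auto simp: mult_unit_vec_index[of _ ?n ?n]\<close>)
    then show ?thesis using van[OF A] by simp
  qed
  have H0_aux: "?b (A *\<^sub>v ?u 0) (A *\<^sub>v w) = 0"
    if w: "w \<in> carrier_vec ?n" "symp l w (?u 0) = 0" "symp l w (?u 1) \<noteq> 0" and A: "A \<in> ?S" for w A
    using step[OF H01 _ _ w(1) A] w(2,3) by auto
  have H0: "?b (A *\<^sub>v ?u 0) (A *\<^sub>v w) = 0"
    if w: "w \<in> carrier_vec ?n" "symp l w (?u 0) = 0" and A: "A \<in> ?S" for w A
  proof (cases "symp l w (?u 1) = 0")
    case False
    then show ?thesis using H0_aux w A by blast
  next
    case True
    \<comment> \<open>Adding \<open>?e\<close>, which is orthogonal to the first but not to the second basis vector, reduces to \<open>H0_aux\<close>.\<close>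
    let ?e = "?u (?n - 2)"
    have e: "symp l ?e (?u 0) = 0" "symp l ?e (?u 1) = - 1"
      using l by (auto simp: symp_unit_right)
    have "?b (A *\<^sub>v ?u 0) (A *\<^sub>v (w + ?e)) = 0"
      by (rule H0_aux) (use w e True A in \<open>auto simp: symp_add_left\<close>)
    moreover have "A *\<^sub>v (w + ?e) = A *\<^sub>v w + A *\<^sub>v ?e"
      using Sp_carrier_mat[OF A] w by (simp add: mult_add_distrib_mat_vec[of _ ?n ?n])
    moreover have "?b (A *\<^sub>v ?u 0) (A *\<^sub>v ?e) = 0" by (rule H0_aux) (use e A in auto)
    ultimately show ?thesis using Ac[OF A] w by (simp add: wedge_form_add_right)
  qed
  have one: "1\<^sub>m ?n *\<^sub>v x = x" if "x \<in> carrier_vec ?n" for x :: "complex vec" using that by simp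
  have B0: "?b (?u 0) w = 0" if w: "w \<in> carrier_vec ?n" "symp l w (?u 0) = 0" for w
    using H0[OF w Sp_one] w by simp
  have B: "?b x w = 0"
    if w: "w \<in> carrier_vec ?n" "symp l w (?u 0) = 0" and x: "x \<in> carrier_vec ?n" "symp l x w = 0" "symp l x (?u 0) \<noteq> 0" for x w
    using step[OF H0[OF w] _ w(1) x(1) Sp_one] x w by auto
  \<comment> \<open>Basis vectors that are orthogonal to each other.\<close>
  have off: "Y i j = 0" if ij: "i < ?n" "j < ?n" "i + j + 1 \<noteq> ?n" "j \<noteq> ?n - 1" for i j
  proof -
    \<comment> \<open>The partner of the first basis vector supplies the product with it that \<open>B\<close> requires.\<close>
    let ?f = "?u (?n - 1)"
    have w: "symp l (?u j) (?u 0) = 0" using ij l by (simp add: symp_unit_right)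
    have f: "symp l ?f (?u 0) = - 1" using l by (simp add: symp_unit_right)
    consider "i = ?n - 1" | "j = 0" "i \<noteq> ?n - 1" | "j \<noteq> 0" "i \<noteq> ?n - 1" by blast
    then have "?b (?u i) (?u j) = 0"
    proof cases
      case 1
      then show ?thesis using ij f w l
        by (intro B) (auto simp: symp_unit_right)
    next
      case 2
      have "?b (?u 0) (?u i) = 0" using 2 ij l by (intro B0) (auto simp: symp_unit_right)
      then show ?thesis using swap[of "?u 0" "?u i"] 2 by simp
    next
      case 3
      have fj: "symp l ?f (?u j) = 0" "symp l (?u i) (?u j) = 0"
        using 3 ij l by (auto simp: symp_unit_right)
      have "?b ?f (?u j) = 0" using w f fj l ij by (intro B) auto
      moreover have "?b (?u i + ?f) (?u j) = 0"
      proof (rule B)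
        show "symp l (?u i + ?f) (?u 0) \<noteq> 0"
          using 3 ij f l by (simp add: symp_add_left symp_unit_right)
      qed (use w fj in \<open>auto simp: symp_add_left\<close>)
      ultimately show ?thesis by (simp add: wedge_form_add_left)
    qed
    then show ?thesis using ij by (simp add: wedge_form_unit)
  qed
  have off': "Y i j = 0" if ij: "i < ?n" "j < ?n" "i + j + 1 \<noteq> ?n" for i j
  proof (cases "j = ?n - 1")
    case True
    show ?thesis
    proof (cases "i = ?n - 1")
      case i: True
      then show ?thesis using True anti[of i i] ij by simp
    next
      case False
      then have "Y j i = 0" using ij by (intro off) auto
      then show ?thesis using anti[of i j] ij by simp
    qed
  qed (use off ij in blast)
  \<comment> \<open>The hyperbolic pairs are compared through orthogonal vectors formed from two of them.\<close>
  have diag: "Y j (?n - 1 - j) = Y 0 (?n - 1)" if j: "j < l" for j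
  proof (cases "j = 0")
    case False
    let ?w = "?u 0 + ?u j" and ?x = "?u (?n - 1) - ?u (?n - 1 - j)"
    have "?b ?x ?w = 0"
    proof (rule B)
      show "symp l ?w (?u 0) = 0" using j False l by (simp add: symp_add_left symp_unit_right)
      show "symp l ?x ?w = 0" using j False l by (auto simp: symp_linear symp_unit_right)
      show "symp l ?x (?u 0) \<noteq> 0" using j False l by (auto simp: symp_linear symp_unit_right)
    qed auto
    then have "Y (?n - 1) 0 - Y (?n - 1 - j) 0 + (Y (?n - 1) j - Y (?n - 1 - j) j) = 0"
      using j l by (simp add: wedge_form_linear wedge_form_unit)
    moreover have "Y (?n - 1) j = 0" "Y (?n - 1 - j) 0 = 0" using j False l by (auto intro!: off')
    moreover have "Y (?n - 1) 0 = - Y 0 (?n - 1)" "Y (?n - 1 - j) j = - Y j (?n - 1 - j)"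
      using j l by (auto intro!: anti)
    ultimately have "Y j (?n - 1 - j) - Y 0 (?n - 1) = 0" by simp
    then show ?thesis by simp
  qed simp
  show ?thesis
  proof (cases "i + j + 1 = ?n")
    case False
    then show ?thesis using off' ij by (simp add: sympl_form_index)
  next
    case True
    show ?thesis
    proof (cases "i < l")
      case i: True
      then have "j = ?n - 1 - i" using True by auto
      then show ?thesis using diag[OF i] ij i by (simp add: sympl_form_index)
    next
      case i: False
      then have "j < l" "i = ?n - 1 - j" using True by auto
      then show ?thesis using diag[of j] anti[of j i] ij i True by (simp add: sympl_form_index)
    qed
  qed
qed

lemma congruence_index_sum:
  assumes "A \<in> carrier_mat n n" "J \<in> carrier_mat n n" "i < n" "j < n"
  shows "(A * J * transpose_mat A) $$ (i, j) = (\<Sum>k<n. \<Sum>m<n. A $$ (i, k) * J $$ (k, m) * (A $$ (j, m) :: complex))"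
proof -
  have "(A * J * transpose_mat A) $$ (i, j) = (\<Sum>m<n. (A * J) $$ (i, m) * transpose_mat A $$ (m, j))"
    by (rule mult_mat_index) (use assms in auto)
  also have "\<dots> = (\<Sum>m<n. \<Sum>k<n. A $$ (i, k) * J $$ (k, m) * A $$ (j, m))"
    by (intro sum.cong refl) (use assms in \<open>simp add: mult_mat_index[of _ n n _ n] sum_distrib_right\<close>)
  also have "\<dots> = (\<Sum>k<n. \<Sum>m<n. A $$ (i, k) * J $$ (k, m) * A $$ (j, m))" by (rule sum.swap)
  finally show ?thesis .
qed

text \<open>
The coordinates of the exterior product of the first two columns. The exterior square is viewed inside the
space of families indexed by pairs.
\<close>

definition wedge :: "complex mat \<Rightarrow> nat \<times> nat \<Rightarrow> complex" where
  "wedge A = (\<lambda>(i, j). A $$ (i, 0) * A $$ (j, 1) - A $$ (j, 0) * A $$ (i, 1))"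

lemma sum_pairs: "(\<Sum>p\<in>{..<n} \<times> {..<n}. F p) = (\<Sum>i<n. \<Sum>j<n. F (i, j))" for n :: nat
  by (simp add: sum.cartesian_product)

lemma sum_pair_delta:
  fixes h :: "'i \<Rightarrow> complex"
  assumes "finite I" "a \<in> I"
  shows "(\<Sum>p\<in>I. (if p = a then 1 else 0) * h p) = h a"
  using assms by (simp add: if_distrib[of "\<lambda>x. x * _"] cong: if_cong)

lemma wedge_separates:
  assumes l: "l \<ge> 2" and anti: "\<And>i j. i < 2 * l \<Longrightarrow> j < 2 * l \<Longrightarrow> Y (j, i) = - Y (i, j)"
    and van: "\<And>A. A \<in> carrier (Sp l) \<Longrightarrow> (\<Sum>p\<in>{..<2*l} \<times> {..<2*l}. Y p * wedge A p) = 0"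
    and ij: "i < 2 * l" "j < 2 * l"
  shows "Y (i, j) = Y (0, 2 * l - 1) * sympl_form l $$ (i, j)"
proof (rule Sp_decomposable_separates[OF l, where Y = "\<lambda>i j. Y (i, j)"])
  fix A assume A: "A \<in> carrier (Sp l)"
  let ?s = "\<Sum>i<2*l. \<Sum>j<2*l. A $$ (i, 0) * A $$ (j, 1) * Y (i, j)"
  have "0 = ?s - (\<Sum>i<2*l. \<Sum>j<2*l. A $$ (j, 0) * A $$ (i, 1) * Y (i, j))"
    using van[OF A] by (simp add: sum_pairs wedge_def sum_subtractf algebra_simps)
  also have "(\<Sum>i<2*l. \<Sum>j<2*l. A $$ (j, 0) * A $$ (i, 1) * Y (i, j)) =
      (\<Sum>j<2*l. \<Sum>i<2*l. A $$ (j, 0) * A $$ (i, 1) * Y (i, j))" by (rule sum.swap)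
  also have "\<dots> = - ?s"
    unfolding sum_negf[symmetric]
  proof (intro sum.cong refl)
    fix a b assume "a \<in> {..<2*l}" "b \<in> {..<2*l}"
    then have "Y (b, a) = - Y (a, b)" by (intro anti) auto
    then show "A $$ (a, 0) * A $$ (b, 1) * Y (b, a) = - (A $$ (a, 0) * A $$ (b, 1) * Y (a, b))" by simp
  qed
  finally show "?s = 0" by simp
next
  show "Y (b, a) = - Y (a, b)" if "a < 2 * l" "b < 2 * l" for a b by (rule anti[OF that])
qed (rule ij)+

lemma sympl_form_norm: "(\<Sum>p\<in>{..<2*l} \<times> {..<2*l}. sympl_form l $$ p * sympl_form l $$ p) = of_nat (2 * l)"
proof -
  have "(\<Sum>j<2*l. sympl_form l $$ (i, j) * sympl_form l $$ (i, j)) = 1" if i: "i < 2 * l" for i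
  proof -
    have "(\<Sum>j<2*l. sympl_form l $$ (i, j) * sympl_form l $$ (i, j)) = (\<Sum>j<2*l. if i + j + 1 = 2 * l then 1 else 0)"
      by (intro sum.cong refl) (use i in \<open>auto simp: sympl_form_index\<close>)
    also have "\<dots> = 1" by (rule sum_antidiagonal[OF i])
    finally show ?thesis .
  qed
  then show ?thesis by (simp add: sum_pairs)
qed

lemma sympl_form_anti: "i < 2 * l \<Longrightarrow> j < 2 * l \<Longrightarrow> sympl_form l $$ (j, i) = - sympl_form l $$ (i, j)"
  by (auto simp: sympl_form_index)

lemma wedge_isotropic:
  assumes l: "l \<ge> 2" and A: "A \<in> carrier (Sp l)"
  shows "(\<Sum>p\<in>{..<2*l} \<times> {..<2*l}. sympl_form l $$ p * wedge A p) = 0"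
proof -
  have At: "transpose_mat A \<in> carrier (Sp l)" by (rule Sp_transpose[OF A])
  have A': "A \<in> carrier_mat (2 * l) (2 * l)" by (rule Sp_carrier_mat[OF A])
  have e: "(\<Sum>k<2*l. \<Sum>m<2*l. A $$ (k, i) * sympl_form l $$ (k, m) * A $$ (m, j)) = 0"
    if ij: "i < 2" "j < 2" for i j
  proof -
    have "(\<Sum>k<2*l. \<Sum>m<2*l. A $$ (k, i) * sympl_form l $$ (k, m) * A $$ (m, j)) =
        (\<Sum>k<2*l. \<Sum>m<2*l. transpose_mat A $$ (i, k) * sympl_form l $$ (k, m) * transpose_mat A $$ (j, m))"
      by (intro sum.cong refl) (use A' ij l in auto)
    also have "\<dots> = (transpose_mat A * sympl_form l * transpose_mat (transpose_mat A)) $$ (i, j)"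
      by (rule congruence_index_sum[symmetric]) (use A' ij l in auto)
    also have "\<dots> = sympl_form l $$ (i, j)" using Sp_transpose_form[OF At] by simp
    also have "\<dots> = 0" using ij l by (auto simp: sympl_form_index)
    finally show ?thesis .
  qed
  have "(\<Sum>p\<in>{..<2*l} \<times> {..<2*l}. sympl_form l $$ p * wedge A p) =
     (\<Sum>k<2*l. \<Sum>m<2*l. A $$ (k, 0) * sympl_form l $$ (k, m) * A $$ (m, 1))
     - (\<Sum>k<2*l. \<Sum>m<2*l. A $$ (k, 1) * sympl_form l $$ (k, m) * A $$ (m, 0))"
    by (simp add: sum_pairs wedge_def sum_subtractf algebra_simps)
  then show ?thesis using e[of 0 1] e[of 1 0] by simp
qed

lemma wedge_mult:
  assumes "g \<in> carrier_mat n n" "A \<in> carrier_mat n n" "p \<in> {..<n} \<times> {..<n}" "n \<ge> 2"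
  shows "wedge (g * A) p = (\<Sum>q\<in>{..<n} \<times> {..<n}. (g $$ (fst p, fst q) * g $$ (snd p, snd q)) * wedge A q)"
proof -
  obtain i j where p: "p = (i, j)" "i < n" "j < n" using assms by auto
  have ix: "(g * A) $$ (a, b) = (\<Sum>k<n. g $$ (a, k) * A $$ (k, b))" if "a < n" "b < n" for a b
    by (rule mult_mat_index[OF assms(1,2) that])
  have "wedge (g * A) p = (\<Sum>k<n. g $$ (i, k) * A $$ (k, 0)) * (\<Sum>m<n. g $$ (j, m) * A $$ (m, 1))
      - (\<Sum>k<n. g $$ (i, k) * A $$ (k, 1)) * (\<Sum>m<n. g $$ (j, m) * A $$ (m, 0))"
    using p assms(4) by (simp add: wedge_def ix)
  also have "\<dots> = (\<Sum>k<n. \<Sum>m<n. (g $$ (i, k) * g $$ (j, m)) * wedge A (k, m))"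
    unfolding sum_product sum_subtractf[symmetric]
    by (intro sum.cong refl) (simp add: wedge_def algebra_simps)
  finally show ?thesis by (simp add: sum_pairs p)
qed

lemma wedge_pairing:
  assumes "B \<in> carrier_mat n n" "A \<in> carrier_mat n n" "n \<ge> 2"
  shows "leading_minor 2 (B * A) = (\<Sum>p\<in>{..<n} \<times> {..<n}. (wedge (transpose_mat B) p / 2) * wedge A p)"
proof -
  have ix: "(B * A) $$ (a, b) = (\<Sum>k<n. B $$ (a, k) * A $$ (k, b))" if "a < n" "b < n" for a b
    by (rule mult_mat_index[OF assms(1,2) that])
  have "(\<Sum>p\<in>{..<n} \<times> {..<n}. (wedge (transpose_mat B) p / 2) * wedge A p) =
    (\<Sum>i<n. \<Sum>j<n. ((B $$ (0, i) * A $$ (i, 0)) * (B $$ (1, j) * A $$ (j, 1)) - (B $$ (0, i) * A $$ (i, 1)) * (B $$ (1, j) * A $$ (j, 0))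
      - (B $$ (1, i) * A $$ (i, 0)) * (B $$ (0, j) * A $$ (j, 1)) + (B $$ (1, i) * A $$ (i, 1)) * (B $$ (0, j) * A $$ (j, 0))) / 2)"
    unfolding sum_pairs
    by (intro sum.cong refl) (use assms in \<open>simp add: wedge_def algebra_simps add_divide_distrib diff_divide_distrib\<close>)
  also have "\<dots> = ((B * A) $$ (0, 0) * (B * A) $$ (1, 1) - (B * A) $$ (0, 1) * (B * A) $$ (1, 0)
      - (B * A) $$ (1, 0) * (B * A) $$ (0, 1) + (B * A) $$ (1, 1) * (B * A) $$ (0, 0)) / 2"
  proof -
    have ixs: "(B * A) $$ (0, 0) = (\<Sum>k<n. B $$ (0, k) * A $$ (k, 0))" "(B * A) $$ (0, 1) = (\<Sum>k<n. B $$ (0, k) * A $$ (k, 1))"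
      "(B * A) $$ (1, 0) = (\<Sum>k<n. B $$ (1, k) * A $$ (k, 0))" "(B * A) $$ (1, 1) = (\<Sum>k<n. B $$ (1, k) * A $$ (k, 1))"
      using assms(3) by (auto intro!: ix)
    show ?thesis
      unfolding ixs sum_product
      by (simp only: sum_divide_distrib sum.distrib sum_subtractf add_divide_distrib diff_divide_distrib)
  qed
  also have "\<dots> = leading_minor 2 (B * A)" by (simp add: leading_minor_2 field_simps)
  finally show ?thesis ..
qed

text \<open>
Here the second space consists of the families indexed by pairs, with \<open>g\<close> acting on both indices. The matrix
\<open>E\<close> is computed to be \<open>E0\<close>, the projection to alternating families that are orthogonal to \<open>J\<close>: first \<open>E\<close>
fixes all \<open>wedge A\<close>, then its rows agree with those of \<open>E0\<close>, both times because \<open>wedge_separates\<close> leaves only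
multiples of \<open>J\<close>, and these are excluded by orthogonality to \<open>J\<close>. The part of \<open>E0\<close> that antisymmetrizes
contributes the trace of the exterior square, the part along \<open>J\<close> contributes the subtracted 1.
\<close>

lemma trace_fundamental_rep_2:
  assumes l: "l \<ge> 2" and fr: "fundamental_rep l 2 N \<rho>" and g: "g \<in> carrier (Sp l)"
  shows "(\<Sum>i<N. \<rho> g $$ (i, i)) = ((\<Sum>i<2*l. g $$ (i, i)) ^ 2 - (\<Sum>i<2*l. (g * g) $$ (i, i))) / 2 - 1"
proof -
  let ?I = "{..<2*l} \<times> {..<2*l}" and ?J = "sympl_form l" and ?S = "carrier (Sp l)"
  obtain v where v: "highest_weight_vector l N \<rho> (fundamental_weight 2) v" and irr: "irreducible_rep l N \<rho>"
    using fr by (auto simp: fundamental_rep_def)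
  have vc: "v \<in> carrier_vec N" using v by (simp add: highest_weight_vector_def)
  have rat: "rational_rep l N \<rho>" using irr by (simp add: irreducible_rep_def)
  obtain \<phi> where \<phi>: "\<And>A. A \<in> ?S \<Longrightarrow> (\<Sum>i<N. (\<rho> A *\<^sub>v v) $ i * \<phi> i) = leading_minor 2 A"
    using fundamental_rep_coefficient[OF rat v l] by blast
  obtain E where
    trE: "\<And>g. g \<in> ?S \<Longrightarrow> (\<Sum>i<N. \<rho> g $$ (i, i)) =
      (\<Sum>p\<in>?I. \<Sum>q\<in>?I. (g $$ (fst p, fst q) * g $$ (snd p, snd q)) * E q p)"
    and EW': "\<And>A B. A \<in> ?S \<Longrightarrow> B \<in> ?S \<Longrightarrow>
      (\<Sum>p\<in>?I. (wedge (transpose_mat B) p / 2) * (\<Sum>q\<in>?I. E p q * wedge A q)) =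
      (\<Sum>p\<in>?I. (wedge (transpose_mat B) p / 2) * wedge A p)"
    and left: "\<And>K q. (\<And>A. A \<in> ?S \<Longrightarrow> (\<Sum>p\<in>?I. K p * wedge A p) = 0) \<Longrightarrow> (\<Sum>p\<in>?I. K p * E p q) = 0"
    and right': "\<And>K p. (\<And>B. B \<in> ?S \<Longrightarrow> (\<Sum>q\<in>?I. (wedge (transpose_mat B) q / 2) * K q) = 0) \<Longrightarrow>
      (\<Sum>q\<in>?I. E p q * K q) = 0"
  proof (rule resolution_kernel[OF irr vc, where f = "leading_minor 2" and \<phi> = \<phi> and I = "?I" and W = wedge
        and \<Psi> = "\<lambda>B p. wedge (transpose_mat B) p / 2"
        and \<sigma> = "\<lambda>g p q. g $$ (fst p, fst q) * g $$ (snd p, snd q)"], goal_cases)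
    case (1 A)
    show ?case by (rule \<phi>[OF 1(2)])
  next
    case 2
    show ?case using l by (simp add: leading_minor_2)
  next
    case (3 A B)
    show ?case using 3(2,3) l by (intro wedge_pairing Sp_carrier_mat) auto
  next
    case (4 g A p)
    show ?case using 4(2-4) l by (intro wedge_mult Sp_carrier_mat) auto
  next
    case (5 E)
    show ?case by (rule 5(1)[OF 5(2-5)])
  qed
  have wedge_half: "(\<Sum>p\<in>?I. (wedge A p / 2) * K p) = (\<Sum>p\<in>?I. K p * wedge A p) / 2" for K A
    by (simp add: sum_divide_distrib mult.commute)
  have EW: "(\<Sum>p\<in>?I. (\<Sum>q\<in>?I. E p q * wedge A q) * wedge B p) = (\<Sum>p\<in>?I. wedge A p * wedge B p)"
    if "A \<in> ?S" "B \<in> ?S" for A B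
    using EW'[OF that(1) Sp_transpose[OF that(2)]] unfolding transpose_transpose wedge_half by simp
  have right: "(\<Sum>q\<in>?I. E p q * K q) = 0" if "\<And>B. B \<in> ?S \<Longrightarrow> (\<Sum>q\<in>?I. K q * wedge B q) = 0" for K p
    by (rule right', unfold wedge_half) (simp add: that Sp_transpose)
  have wanti: "wedge A (j, i) = - wedge A (i, j)" for A i j by (simp add: wedge_def)
  have pairK: "(\<Sum>p\<in>?I. ((if p = (i, j) then 1 else 0) + (if p = (j, i) then 1 else 0)) * h p) = h (i, j) + h (j, i)"
    if "i < 2 * l" "j < 2 * l" for i j and h :: "nat \<times> nat \<Rightarrow> complex"
    using that by (simp add: distrib_right sum.distrib sum_pair_delta)
  have Eanti1: "E (j, i) q = - E (i, j) q" if "i < 2 * l" "j < 2 * l" for i j q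
  proof -
    have "(\<Sum>p\<in>?I. ((if p = (i, j) then 1 else 0) + (if p = (j, i) then 1 else 0)) * E p q) = 0"
      by (rule left) (simp only: pairK[OF that] wanti[of _ j i], simp)
    then have "E (i, j) q + E (j, i) q = 0" by (simp only: pairK[OF that])
    then show ?thesis by (simp add: eq_neg_iff_add_eq_0 add.commute)
  qed
  have Eanti2: "E p (j, i) = - E p (i, j)" if "i < 2 * l" "j < 2 * l" for i j p
  proof -
    have "(\<Sum>q\<in>?I. E p q * ((if q = (i, j) then 1 else 0) + (if q = (j, i) then 1 else 0))) = 0"
      by (rule right) (simp only: pairK[OF that] wanti[of _ j i], simp)
    then have "E p (i, j) + E p (j, i) = 0" by (simp only: mult.commute[of "E p _"] pairK[OF that])
    then show ?thesis by (simp add: eq_neg_iff_add_eq_0 add.commute)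
  qed
  have EJ: "(\<Sum>q\<in>?I. E p q * ?J $$ q) = 0" for p by (rule right) (rule wedge_isotropic[OF l])
  have JE: "(\<Sum>p\<in>?I. ?J $$ p * E p q) = 0" for q by (rule left) (rule wedge_isotropic[OF l])
  \<comment> \<open>A multiple of \<open>J\<close> that is orthogonal to \<open>J\<close> vanishes, because \<open>J\<close> has norm \<open>2 l \<noteq> 0\<close>.\<close>
  have zero: "Y (i, j) = 0"
    if anti: "\<And>i j. i < 2 * l \<Longrightarrow> j < 2 * l \<Longrightarrow> Y (j, i) = - Y (i, j)"
      and van: "\<And>A. A \<in> ?S \<Longrightarrow> (\<Sum>p\<in>?I. Y p * wedge A p) = 0"
      and J: "(\<Sum>p\<in>?I. Y p * ?J $$ p) = 0"
      and ij: "i < 2 * l" "j < 2 * l" for Y i j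
  proof -
    define c where "c = Y (0, 2 * l - 1)"
    have Yc: "Y (i, j) = c * ?J $$ (i, j)" if "i < 2 * l" "j < 2 * l" for i j
      unfolding c_def by (rule wedge_separates[OF l anti van that])
    have "(\<Sum>p\<in>?I. Y p * ?J $$ p) = (\<Sum>p\<in>?I. c * (?J $$ p * ?J $$ p))"
      by (intro sum.cong refl) (use Yc in auto)
    then have "c * of_nat (2 * l) = 0"
      using J by (simp only: sum_distrib_left[symmetric] sympl_form_norm)
    then have "c = 0" using l by simp
    then show ?thesis using Yc[OF ij] by simp
  qed
  have Efix: "(\<Sum>q\<in>?I. E p q * wedge A q) = wedge A p" if A: "A \<in> ?S" and p: "p \<in> ?I" for A p
  proof -
    let ?Y = "\<lambda>p. (\<Sum>q\<in>?I. E p q * wedge A q) - wedge A p"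
    obtain i j where ij: "p = (i, j)" "i < 2 * l" "j < 2 * l" using p by auto
    have "?Y (i, j) = 0"
    proof (rule zero[OF _ _ _ ij(2,3)])
      show "?Y (b, a) = - ?Y (a, b)" if "a < 2 * l" "b < 2 * l" for a b
        using Eanti1[OF that] wanti[of A b a] by (simp add: sum_negf)
      show "(\<Sum>p\<in>?I. ?Y p * wedge B p) = 0" if "B \<in> ?S" for B
        using EW[OF A that] by (simp add: left_diff_distrib sum_subtractf)
      have "(\<Sum>p\<in>?I. (\<Sum>q\<in>?I. E p q * wedge A q) * ?J $$ p) = (\<Sum>p\<in>?I. \<Sum>q\<in>?I. ?J $$ p * E p q * wedge A q)"
        by (simp add: sum_distrib_left sum_distrib_right ac_simps)
      also have "\<dots> = (\<Sum>q\<in>?I. \<Sum>p\<in>?I. ?J $$ p * E p q * wedge A q)" by (rule sum.swap)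
      also have "\<dots> = 0" by (simp only: sum_distrib_right[symmetric] JE) simp
      finally have e: "(\<Sum>p\<in>?I. (\<Sum>q\<in>?I. E p q * wedge A q) * ?J $$ p) = 0" .
      show "(\<Sum>p\<in>?I. ?Y p * ?J $$ p) = 0"
        unfolding left_diff_distrib sum_subtractf e
        using wedge_isotropic[OF l A] by (simp add: mult.commute)
    qed
    then show ?thesis by (simp add: ij)
  qed
  define E0 :: "nat \<times> nat \<Rightarrow> nat \<times> nat \<Rightarrow> complex" where
    "E0 p q = ((if q = p then 1 else 0) - (if q = (snd p, fst p) then 1 else 0)) / 2 - ?J $$ p * ?J $$ q / of_nat (2 * l)" for p q
  have E0sum: "(\<Sum>q\<in>?I. E0 (i, j) q * h q) = (h (i, j) - h (j, i)) / 2 - ?J $$ (i, j) * (\<Sum>q\<in>?I. ?J $$ q * h q) / of_nat (2 * l)"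
    if "i < 2 * l" "j < 2 * l" for i j h
  proof -
    have "(\<Sum>q\<in>?I. E0 (i, j) q * h q) = (\<Sum>q\<in>?I. ((if q = (i, j) then 1 else 0) * h q - (if q = (j, i) then 1 else 0) * h q) / 2
        - ?J $$ (i, j) * (?J $$ q * h q) / of_nat (2 * l))"
      by (intro sum.cong refl) (simp add: E0_def left_diff_distrib)
    also have "\<dots> = ((\<Sum>q\<in>?I. (if q = (i, j) then 1 else 0) * h q) - (\<Sum>q\<in>?I. (if q = (j, i) then 1 else 0) * h q)) / 2
        - ?J $$ (i, j) * (\<Sum>q\<in>?I. ?J $$ q * h q) / of_nat (2 * l)"
      by (simp only: sum_subtractf sum_divide_distrib sum_distrib_left diff_divide_distrib)
    finally show ?thesis using that by (simp add: sum_pair_delta)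
  qed
  have EE0: "E p q = E0 p q" if p: "p \<in> ?I" and q: "q \<in> ?I" for p q
  proof -
    obtain i j where ij: "p = (i, j)" "i < 2 * l" "j < 2 * l" using p by auto
    obtain k m where km: "q = (k, m)" "k < 2 * l" "m < 2 * l" using q by auto
    have "E p (k, m) - E0 p (k, m) = 0"
    proof (rule zero[where Y = "\<lambda>q. E p q - E0 p q", OF _ _ _ km(2,3)])
      show "E p (b, a) - E0 p (b, a) = - (E p (a, b) - E0 p (a, b))" if "a < 2 * l" "b < 2 * l" for a b
      proof -
        have "E0 p (b, a) = - E0 p (a, b)"
        proof -
          have "((b, a) = p) = ((a, b) = (snd p, fst p))" "((b, a) = (snd p, fst p)) = ((a, b) = p)"
            by (auto simp: ij)
          then have "E0 p (b, a) = ((if (a, b) = (snd p, fst p) then 1 else 0) - (if (a, b) = p then 1 else 0)) / 2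
              - ?J $$ p * (- ?J $$ (a, b)) / of_nat (2 * l)"
            by (simp only: E0_def sympl_form_anti[OF that])
          also have "\<dots> = - E0 p (a, b)"
            unfolding E0_def by (simp only: minus_diff_eq diff_divide_distrib mult_minus_right minus_divide_left[symmetric])
              (simp only: diff_conv_add_uminus minus_add_distrib minus_minus add.commute add.left_commute)
          finally show ?thesis .
        qed
        then show ?thesis unfolding Eanti2[OF that] by simp
      qed
      show "(\<Sum>q\<in>?I. (E p q - E0 p q) * wedge A q) = 0" if A: "A \<in> ?S" for A
        using Efix[OF A p] E0sum[OF ij(2,3), of "wedge A"] wedge_isotropic[OF l A] wanti[of A j i]
        by (simp add: left_diff_distrib sum_subtractf ij)
      show "(\<Sum>q\<in>?I. (E p q - E0 p q) * ?J $$ q) = 0"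
        using EJ[of p] E0sum[OF ij(2,3), of "\<lambda>q. ?J $$ q"] sympl_form_norm[of l] sympl_form_anti[OF ij(2,3)] l
        by (simp add: left_diff_distrib sum_subtractf ij)
    qed
    then show ?thesis by (simp add: km)
  qed
  have g': "g \<in> carrier_mat (2 * l) (2 * l)" by (rule Sp_carrier_mat[OF g])
  have inner: "(\<Sum>q\<in>?I. (g $$ (i, fst q) * g $$ (j, snd q)) * E q (i, j)) =
      (g $$ (i, i) * g $$ (j, j) - g $$ (i, j) * g $$ (j, i)) / 2 - ?J $$ (i, j) * ?J $$ (i, j) / of_nat (2 * l)"
    if ij: "i < 2 * l" "j < 2 * l" for i j
  proof -
    have "E q (i, j) = E0 (i, j) q" if "q \<in> ?I" for q
    proof -
      have "((i, j) = q) = (q = (i, j))" "((i, j) = (snd q, fst q)) = (q = (snd (i, j), fst (i, j)))" by auto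
      then have "E0 q (i, j) = E0 (i, j) q"
        by (simp only: E0_def mult.commute[of "?J $$ q"])
      then show ?thesis using EE0[OF that, of "(i, j)"] ij by simp
    qed
    then have "(\<Sum>q\<in>?I. (g $$ (i, fst q) * g $$ (j, snd q)) * E q (i, j)) =
        (\<Sum>q\<in>?I. E0 (i, j) q * (g $$ (i, fst q) * g $$ (j, snd q)))"
      by (intro sum.cong refl) (simp add: mult.commute)
    also have "\<dots> = (g $$ (i, i) * g $$ (j, j) - g $$ (i, j) * g $$ (j, i)) / 2
        - ?J $$ (i, j) * (\<Sum>q\<in>?I. ?J $$ q * (g $$ (i, fst q) * g $$ (j, snd q))) / of_nat (2 * l)"
      unfolding E0sum[OF ij] by simp
    also have "(\<Sum>q\<in>?I. ?J $$ q * (g $$ (i, fst q) * g $$ (j, snd q))) = (g * ?J * transpose_mat g) $$ (i, j)"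
      unfolding congruence_index_sum[OF g' sympl_form_carrier ij] sum_pairs
      by (intro sum.cong refl) simp
    also have "\<dots> = ?J $$ (i, j)" using Sp_transpose_form[OF g] by simp
    finally show ?thesis .
  qed
  have "(\<Sum>i<N. \<rho> g $$ (i, i)) = (\<Sum>i<2*l. \<Sum>j<2*l. \<Sum>q\<in>?I. (g $$ (i, fst q) * g $$ (j, snd q)) * E q (i, j))"
    unfolding trE[OF g] sum_pairs[of _ "2 * l"] by simp
  also have "\<dots> = (\<Sum>i<2*l. \<Sum>j<2*l. (g $$ (i, i) * g $$ (j, j) - g $$ (i, j) * g $$ (j, i)) / 2 - ?J $$ (i, j) * ?J $$ (i, j) / of_nat (2 * l))"
    by (intro sum.cong refl) (simp add: inner)
  also have "\<dots> = ((\<Sum>i<2*l. \<Sum>j<2*l. g $$ (i, i) * g $$ (j, j)) - (\<Sum>i<2*l. \<Sum>j<2*l. g $$ (i, j) * g $$ (j, i))) / 2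
      - (\<Sum>i<2*l. \<Sum>j<2*l. ?J $$ (i, j) * ?J $$ (i, j)) / of_nat (2 * l)"
    by (simp only: sum_subtractf sum_divide_distrib diff_divide_distrib)
  also have "(\<Sum>i<2*l. \<Sum>j<2*l. g $$ (i, i) * g $$ (j, j)) = (\<Sum>i<2*l. g $$ (i, i)) ^ 2"
    by (simp add: power2_eq_square sum_product)
  also have "(\<Sum>i<2*l. \<Sum>j<2*l. g $$ (i, j) * g $$ (j, i)) = (\<Sum>i<2*l. (g * g) $$ (i, i))"
    by (intro sum.cong refl) (simp add: mult_mat_index[OF g' g'])
  also have "(\<Sum>i<2*l. \<Sum>j<2*l. ?J $$ (i, j) * ?J $$ (i, j)) = of_nat (2 * l)"
    using sympl_form_norm[of l] by (simp add: sum_pairs)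
  also have "of_nat (2 * l) / (of_nat (2 * l) :: complex) = 1" using l by simp
  finally show ?thesis .
qed

section \<open>Polynomials in a matrix and square roots\<close>

lemma scalar_mat_arith:
  fixes P Q :: "complex mat"
  assumes "P \<in> carrier_mat n n" "Q \<in> carrier_mat n n"
  shows "(a + b) \<cdot>\<^sub>m 1\<^sub>m n + (P + Q) = (a \<cdot>\<^sub>m 1\<^sub>m n + P) + (b \<cdot>\<^sub>m 1\<^sub>m n + Q)"
    and "(c * a) \<cdot>\<^sub>m 1\<^sub>m n + c \<cdot>\<^sub>m P = c \<cdot>\<^sub>m (a \<cdot>\<^sub>m 1\<^sub>m n + P)"
    and "P + (0 \<cdot>\<^sub>m 1\<^sub>m n + Q) = P + Q"
    and "P * (a \<cdot>\<^sub>m 1\<^sub>m n) = a \<cdot>\<^sub>m P" "(a \<cdot>\<^sub>m 1\<^sub>m n) * P = a \<cdot>\<^sub>m P"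
proof -
  show "P * (a \<cdot>\<^sub>m 1\<^sub>m n) = a \<cdot>\<^sub>m P"
    using assms mult_smult_distrib[OF assms(1) one_carrier_mat] by simp
  show "(a \<cdot>\<^sub>m 1\<^sub>m n) * P = a \<cdot>\<^sub>m P"
    using assms mult_smult_assoc_mat[OF one_carrier_mat assms(1)] by simp
qed (use assms in \<open>auto intro!: eq_matI simp: algebra_simps\<close>)

definition mat_eval :: "nat \<Rightarrow> complex mat \<Rightarrow> complex poly \<Rightarrow> complex mat" where
  "mat_eval n A p = fold_coeffs (\<lambda>a M. a \<cdot>\<^sub>m 1\<^sub>m n + A * M) p (0\<^sub>m n n)"

lemma mat_eval_0: "mat_eval n A 0 = 0\<^sub>m n n"
  by (simp add: mat_eval_def)

lemma mat_eval_pCons: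
  assumes "A \<in> carrier_mat n n"
  shows "mat_eval n A (pCons a p) = a \<cdot>\<^sub>m 1\<^sub>m n + A * mat_eval n A p"
  using assms by (cases "p = 0 \<and> a = 0") (auto simp: mat_eval_def)

lemma mat_eval_carrier [simp]:
  assumes "A \<in> carrier_mat n n"
  shows "mat_eval n A p \<in> carrier_mat n n"
  by (induction p) (use assms in \<open>auto simp: mat_eval_0 mat_eval_pCons\<close>)

lemma mat_eval_add:
  assumes A: "A \<in> carrier_mat n n"
  shows "mat_eval n A (p + q) = mat_eval n A p + mat_eval n A q"
proof (induction p arbitrary: q)
  case 0
  then show ?case using A by (simp add: mat_eval_0)
next
  case (pCons a p)
  obtain b q' where q: "q = pCons b q'" by (cases q)
  have "mat_eval n A (pCons a p + q) = (a + b) \<cdot>\<^sub>m 1\<^sub>m n + A * (mat_eval n A p + mat_eval n A q')"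
    by (simp add: q mat_eval_pCons[OF A] pCons.IH)
  also have "\<dots> = (a + b) \<cdot>\<^sub>m 1\<^sub>m n + (A * mat_eval n A p + A * mat_eval n A q')"
    by (subst mult_add_distrib_mat[of _ n n _ n]) (use A in auto)
  also have "\<dots> = (a \<cdot>\<^sub>m 1\<^sub>m n + A * mat_eval n A p) + (b \<cdot>\<^sub>m 1\<^sub>m n + A * mat_eval n A q')"
    using A by (intro scalar_mat_arith(1)) auto
  finally show ?case by (simp add: q mat_eval_pCons[OF A])
qed

lemma mat_eval_smult:
  assumes A: "A \<in> carrier_mat n n"
  shows "mat_eval n A (Polynomial.smult c p) = c \<cdot>\<^sub>m mat_eval n A p"
proof (induction p)
  case 0
  then show ?case by (simp add: mat_eval_0)
next
  case (pCons a p)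
  have "mat_eval n A (Polynomial.smult c (pCons a p)) = (c * a) \<cdot>\<^sub>m 1\<^sub>m n + A * (c \<cdot>\<^sub>m mat_eval n A p)"
    by (simp add: mat_eval_pCons[OF A] pCons.IH)
  also have "A * (c \<cdot>\<^sub>m mat_eval n A p) = c \<cdot>\<^sub>m (A * mat_eval n A p)"
    by (rule mult_smult_distrib[of _ n n _ n]) (use A in auto)
  also have "(c * a) \<cdot>\<^sub>m 1\<^sub>m n + c \<cdot>\<^sub>m (A * mat_eval n A p) = c \<cdot>\<^sub>m (a \<cdot>\<^sub>m 1\<^sub>m n + A * mat_eval n A p)"
    using A by (intro scalar_mat_arith(2)[where Q = A]) auto
  finally show ?case by (simp add: mat_eval_pCons[OF A])
qed

lemma mat_eval_mult:
  assumes A: "A \<in> carrier_mat n n"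
  shows "mat_eval n A (p * q) = mat_eval n A p * mat_eval n A q"
proof (induction p)
  case 0
  then show ?case using mat_eval_carrier[OF A, of q] by (simp add: mat_eval_0)
next
  case (pCons a p)
  let ?P = "mat_eval n A p" and ?Q = "mat_eval n A q"
  have c: "?P \<in> carrier_mat n n" "?Q \<in> carrier_mat n n" using A by auto
  have "mat_eval n A (pCons a p * q) = a \<cdot>\<^sub>m ?Q + (0 \<cdot>\<^sub>m 1\<^sub>m n + A * (?P * ?Q))"
    by (simp add: mat_eval_add[OF A] mat_eval_smult[OF A] mat_eval_pCons[OF A] pCons.IH)
  also have "\<dots> = a \<cdot>\<^sub>m ?Q + A * (?P * ?Q)"
    using A c by (intro scalar_mat_arith(3)) (auto intro!: mult_carrier_mat[of _ n n])
  also have "\<dots> = (a \<cdot>\<^sub>m 1\<^sub>m n) * ?Q + (A * ?P) * ?Q"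
    using A c by (simp add: scalar_mat_arith(5)[OF c(2) c(2)] assoc_mult_mat[of _ n n _ n _ n])
  also have "\<dots> = (a \<cdot>\<^sub>m 1\<^sub>m n + A * ?P) * ?Q"
    by (rule add_mult_distrib_mat[symmetric, of _ n n _ _ n]) (use A c in auto)
  finally show ?case by (simp add: mat_eval_pCons[OF A])
qed

lemma mat_eval_one: "A \<in> carrier_mat n n \<Longrightarrow> mat_eval n A 1 = 1\<^sub>m n"
  by (intro eq_matI) (auto simp: mat_eval_pCons mat_eval_0 one_pCons)

lemma mat_eval_linear: "A \<in> carrier_mat n n \<Longrightarrow> mat_eval n A [:a, 1:] = a \<cdot>\<^sub>m 1\<^sub>m n + A"
  using mat_eval_pCons[of A n a 1] by (simp add: mat_eval_one one_pCons[symmetric])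

lemma mat_eval_X: "A \<in> carrier_mat n n \<Longrightarrow> mat_eval n A [:0, 1:] = A"
  by (intro eq_matI) (auto simp: mat_eval_linear)

lemma mat_eval_commute:
  assumes A: "A \<in> carrier_mat n n" and B: "B \<in> carrier_mat n n" and AB: "A * B = B * A"
  shows "mat_eval n A p * B = B * mat_eval n A p"
proof (induction p)
  case 0
  then show ?case using B by (simp add: mat_eval_0)
next
  case (pCons a p)
  let ?P = "mat_eval n A p"
  have P: "?P \<in> carrier_mat n n" using A by auto
  have "(a \<cdot>\<^sub>m 1\<^sub>m n + A * ?P) * B = (a \<cdot>\<^sub>m 1\<^sub>m n) * B + A * ?P * B"
    by (rule add_mult_distrib_mat[of _ n n]) (use A B P in auto)
  also have "A * ?P * B = A * (B * ?P)" using A B P pCons.IH by (simp add: assoc_mult_mat[of _ n n _ n _ n])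
  also have "\<dots> = B * (A * ?P)"
    using A B P AB by (simp add: assoc_mult_mat[of _ n n _ n _ n, symmetric])
  also have "(a \<cdot>\<^sub>m 1\<^sub>m n) * B = B * (a \<cdot>\<^sub>m 1\<^sub>m n)"
    by (simp only: scalar_mat_arith(4,5)[OF B B])
  also have "B * (a \<cdot>\<^sub>m 1\<^sub>m n) + B * (A * ?P) = B * (a \<cdot>\<^sub>m 1\<^sub>m n + A * ?P)"
    by (rule mult_add_distrib_mat[symmetric, of _ n n]) (use A B P in auto)
  finally show ?case by (simp add: mat_eval_pCons[OF A])
qed

lemma mat_eval_selfadjoint:
  assumes A: "A \<in> carrier_mat n n" and S: "S \<in> carrier_mat n n" and SA: "S * A = transpose_mat A * S"
  shows "S * mat_eval n A p = transpose_mat (mat_eval n A p) * S"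
proof (induction p)
  case 0
  then show ?case using S by (simp add: mat_eval_0)
next
  case (pCons a p)
  let ?P = "mat_eval n A p"
  have P: "?P \<in> carrier_mat n n" using A by auto
  have PA: "?P * A = A * ?P" by (rule mat_eval_commute[OF A A refl])
  have "S * (a \<cdot>\<^sub>m 1\<^sub>m n + A * ?P) = S * (a \<cdot>\<^sub>m 1\<^sub>m n) + S * (A * ?P)"
    by (rule mult_add_distrib_mat[of _ n n]) (use A S P in auto)
  also have "S * (A * ?P) = transpose_mat A * S * ?P"
    using A S P SA by (simp add: assoc_mult_mat[of _ n n _ n _ n, symmetric])
  also have "\<dots> = transpose_mat A * (transpose_mat ?P * S)"
    using A S P pCons.IH by (simp add: assoc_mult_mat[of _ n n _ n _ n])
  also have "\<dots> = transpose_mat (?P * A) * S"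
    using A S P by (simp add: transpose_mult[of _ n n] assoc_mult_mat[of _ n n _ n _ n])
  also have "S * (a \<cdot>\<^sub>m 1\<^sub>m n) = transpose_mat (a \<cdot>\<^sub>m 1\<^sub>m n) * S"
  proof -
    have "transpose_mat (a \<cdot>\<^sub>m 1\<^sub>m n) = (a \<cdot>\<^sub>m 1\<^sub>m n :: complex mat)" by (rule eq_matI) auto
    then show ?thesis by (simp only: scalar_mat_arith(4,5)[OF S S])
  qed
  also have "transpose_mat (a \<cdot>\<^sub>m 1\<^sub>m n) * S + transpose_mat (?P * A) * S
      = (transpose_mat (a \<cdot>\<^sub>m 1\<^sub>m n) + transpose_mat (?P * A)) * S"
    by (rule add_mult_distrib_mat[symmetric, of _ n n]) (use A S P in \<open>auto intro!: mult_carrier_mat[of _ n n]\<close>)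
  also have "transpose_mat (a \<cdot>\<^sub>m 1\<^sub>m n) + transpose_mat (?P * A) = transpose_mat (a \<cdot>\<^sub>m 1\<^sub>m n + A * ?P)"
    unfolding PA by (rule transpose_add[symmetric, of _ n n]) (use A P in \<open>auto intro!: mult_carrier_mat[of _ n n]\<close>)
  finally show ?case by (simp add: mat_eval_pCons[OF A])
qed

lemma mat_eval_similar:
  assumes T: "T \<in> carrier_mat n n" and PQ: "P \<in> carrier_mat n n" "Q \<in> carrier_mat n n" "P * Q = 1\<^sub>m n" "Q * P = 1\<^sub>m n"
  shows "mat_eval n (P * T * Q) p = P * mat_eval n T p * Q"
proof (induction p)
  case 0
  then show ?case using PQ by (simp add: mat_eval_0)
next
  case (pCons a p)
  let ?M = "mat_eval n T p"
  have M: "?M \<in> carrier_mat n n" using T by auto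
  have A: "P * T * Q \<in> carrier_mat n n" using T PQ by auto
  have "(P * T * Q) * (P * ?M * Q) = P * T * (Q * P) * ?M * Q"
    using T PQ(1,2) M by (simp add: assoc_mult_mat[of _ n n _ n _ n] mult_carrier_mat[of _ n n _ n])
  also have "\<dots> = P * (T * ?M) * Q"
    unfolding PQ(4) using T PQ(1,2) M by (simp add: assoc_mult_mat[of _ n n _ n _ n] mult_carrier_mat[of _ n n _ n])
  finally have 1: "(P * T * Q) * (P * ?M * Q) = P * (T * ?M) * Q" .
  have "P * (a \<cdot>\<^sub>m 1\<^sub>m n + T * ?M) * Q = (P * (a \<cdot>\<^sub>m 1\<^sub>m n) + P * (T * ?M)) * Q"
    using T PQ M by (subst mult_add_distrib_mat[of _ n n]) auto
  also have "\<dots> = P * (a \<cdot>\<^sub>m 1\<^sub>m n) * Q + P * (T * ?M) * Q"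
    by (rule add_mult_distrib_mat[of _ n n]) (use T PQ M in auto)
  also have "P * (a \<cdot>\<^sub>m 1\<^sub>m n) * Q = a \<cdot>\<^sub>m 1\<^sub>m n"
    using PQ by (simp add: scalar_mat_arith(4)[OF PQ(1,1)] mult_smult_assoc_mat[of _ n n])
  finally show ?case by (simp add: mat_eval_pCons[OF A] mat_eval_pCons[OF T] pCons.IH 1)
qed

text \<open>
The product of the first \<open>k\<close> factors kills the span of the first \<open>k\<close> basis vectors, because the \<open>k\<close>-th factor
maps this span into the preceding one.
\<close>

lemma mat_eval_upper_triangular:
  assumes T: "T \<in> carrier_mat n n" "upper_triangular T"
  shows "mat_eval n T (\<Prod>a\<leftarrow>diag_mat T. [:- a, 1:]) = 0\<^sub>m n n"
proof -
  define D where "D k = map (\<lambda>i. T $$ (i, i)) [0..<k]" for k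
  define M where "M k = mat_eval n T (\<Prod>a\<leftarrow>D k. [:- a, 1:])" for k
  have Mc: "M k \<in> carrier_mat n n" for k using T by (simp add: M_def)
  have kill: "M k *\<^sub>v u = 0\<^sub>v n" if "k \<le> n" "u \<in> carrier_vec n" "\<forall>i<n. k \<le> i \<longrightarrow> u $ i = 0" for k u
    using that
  proof (induction k arbitrary: u)
    case 0
    then have "u = 0\<^sub>v n" by (intro eq_vecI) auto
    then show ?case using Mc[of 0] by (intro eq_vecI) (auto simp: mult_mat_vec_index[of _ n n])
  next
    case (Suc k)
    let ?B = "- T $$ (k, k) \<cdot>\<^sub>m 1\<^sub>m n + T"
    have B: "?B \<in> carrier_mat n n" using T by auto
    have "(\<Prod>a\<leftarrow>D (Suc k). [:- a, 1:]) = (\<Prod>a\<leftarrow>D k. [:- a, 1:]) * [:- T $$ (k, k), 1:]"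
      by (simp only: D_def upt_Suc_append zero_le map_append prod_list.append list.map prod_list.Cons prod_list.Nil mult_1_right)
    then have "M (Suc k) = M k * ?B"
      unfolding M_def by (simp only: mat_eval_mult[OF T(1)] mat_eval_linear[OF T(1)])
    then have "M (Suc k) *\<^sub>v u = M k *\<^sub>v (?B *\<^sub>v u)"
      using Mc B Suc.prems(2) by (simp add: assoc_mult_mat_vec[of _ n n _ n])
    also have "\<dots> = 0\<^sub>v n"
    proof (rule Suc.IH)
      show "?B *\<^sub>v u \<in> carrier_vec n" using B Suc.prems by (auto intro: mult_mat_vec_carrier)
      show "\<forall>i<n. k \<le> i \<longrightarrow> (?B *\<^sub>v u) $ i = 0"
      proof (intro allI impI)
        fix i assume i: "i < n" "k \<le> i"
        have "(?B *\<^sub>v u) $ i = (\<Sum>j<n. ?B $$ (i, j) * u $ j)"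
          by (rule mult_mat_vec_index[OF B Suc.prems(2) i(1)])
        also have "\<dots> = 0"
        proof (rule sum.neutral, intro ballI)
          fix j assume "j \<in> {..<n}"
          then have j: "j < n" by simp
          consider "Suc k \<le> j" | "j < i" | "j = k" "i = k" using i by linarith
          then show "?B $$ (i, j) * u $ j = 0"
          proof cases
            case 1
            then show ?thesis using Suc.prems(3) j by simp
          next
            case 2
            then show ?thesis using T i j by (auto simp: upper_triangularD)
          next
            case 3
            then show ?thesis using T i j by simp
          qed
        qed
        finally show "(?B *\<^sub>v u) $ i = 0" .
      qed
    qed (use Suc.prems in auto)
    finally show ?case .
  qed
  have "M n = 0\<^sub>m n n"
  proof (rule mat_eq_by_vec[OF Mc])
    fix j assume "j < n"
    have "M n *\<^sub>v unit_vec n j = 0\<^sub>v n" by (rule kill) auto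
    also have "\<dots> = 0\<^sub>m n n *\<^sub>v unit_vec n j"
      by (intro eq_vecI) (auto simp: mult_mat_vec_index[of _ n n])
    finally show "M n *\<^sub>v unit_vec n j = 0\<^sub>m n n *\<^sub>v unit_vec n j" .
  qed simp
  then show ?thesis using T by (simp add: M_def D_def diag_mat_def)
qed

lemma square_shift:
  fixes p q h k z :: "'a :: comm_ring_1"
  assumes "q * q - z = p * h"
  shows "(q + k * p) * (q + k * p) - z = p * (h + 2 * (k * q) + k * k * p)"
proof -
  have "(q + k * p) * (q + k * p) - z = (q * q - z) + p * (2 * (k * q) + k * k * p)"
    by (simp add: algebra_simps mult_2)
  then show ?thesis unfolding assms by (simp add: algebra_simps)
qed

text \<open>
A square root of \<open>X\<close> modulo a product of linear factors is lifted along one further factor \<open>X - a\<close> by adding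
a multiple of the old product \<open>P\<close>. If \<open>P\<close> does not vanish at \<open>a\<close>, the multiple makes the value at \<open>a\<close> a square
root of \<open>a\<close>. If it does, the equation for the multiple is linear with leading coefficient \<open>2 q(a)\<close>, and
\<open>q(a)\<^sup>2 = a \<noteq> 0\<close>.
\<close>

lemma poly_sqrt_X_mod:
  assumes "\<forall>a\<in>set as. a \<noteq> (0::complex)"
  shows "\<exists>q. (\<Prod>a\<leftarrow>as. [:- a, 1:]) dvd q * q - [:0, 1:]"
  using assms
proof (induction as)
  case (Cons a as)
  let ?P = "\<Prod>a\<leftarrow>as. [:- a, 1:]"
  obtain q h where h: "q * q - [:0, 1:] = ?P * h" using Cons by (auto simp: dvd_def)
  have ha: "poly q a * poly q a - a = poly ?P a * poly h a"
    using arg_cong[OF h, of "\<lambda>p. poly p a"] by simp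
  define r where "r c = h + 2 * ([:c:] * q) + [:c:] * [:c:] * ?P" for c
  have r: "(q + [:c:] * ?P) * (q + [:c:] * ?P) - [:0, 1:] = ?P * r c" for c
    unfolding r_def by (rule square_shift[OF h])
  obtain c where c: "poly (r c) a = 0"
  proof (cases "poly ?P a = 0")
    case True
    then have "poly q a \<noteq> 0" using ha Cons.prems by auto
    then show ?thesis using True by (intro that[of "- poly h a / (2 * poly q a)"]) (simp add: r_def)
  next
    case False
    define c where "c = (csqrt a - poly q a) / poly ?P a"
    have e: "poly q a + c * poly ?P a = csqrt a" using False by (simp add: c_def)
    have "poly ?P a * poly (r c) a = (poly q a + c * poly ?P a) * (poly q a + c * poly ?P a) - a"
      using arg_cong[OF r[of c], of "\<lambda>p. poly p a"] by simp
    also have "\<dots> = 0" unfolding e by (simp add: power2_eq_square[symmetric])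
    finally show ?thesis using False that by simp
  qed
  then have "[:- a, 1:] dvd r c" by (simp only: poly_eq_0_iff_dvd)
  then have "?P * [:- a, 1:] dvd ?P * r c" by (rule mult_dvd_mono[OF dvd_refl])
  then have "[:- a, 1:] * ?P dvd (q + [:c:] * ?P) * (q + [:c:] * ?P) - [:0, 1:]"
    unfolding r by (simp only: mult.commute[of "[:- a, 1:]"])
  then show ?case by auto
qed auto

lemma invertible_mat_sqrt:
  assumes A: "A \<in> carrier_mat n n" and det: "det A \<noteq> 0"
  obtains q where "mat_eval n A q * mat_eval n A q = A"
proof -
  obtain es where es: "char_poly A = (\<Prod>a\<leftarrow>es. [:- a, 1:])" using char_poly_factorized[OF A] by blast
  obtain T where T: "T \<in> carrier_mat n n" "upper_triangular T" "similar_mat A T"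
    using schur_decomposition_exists[OF A es] by blast
  obtain P Q where PQ: "P \<in> carrier_mat n n" "Q \<in> carrier_mat n n" "P * Q = 1\<^sub>m n" "Q * P = 1\<^sub>m n" "A = P * T * Q"
    using T(3) A unfolding similar_mat_def similar_mat_wit_def Let_def by auto
  let ?p = "\<Prod>a\<leftarrow>diag_mat T. [:- a, 1:]"
  have "det A = det T" by (rule det_similar[OF T(3)])
  then have "0 \<notin> set (diag_mat T)"
    using det det_upper_triangular[OF T(2,1)] by (auto simp: prod_list_zero_iff)
  then obtain q h where q: "q * q - [:0, 1:] = ?p * h"
    using poly_sqrt_X_mod[of "diag_mat T"] unfolding dvd_def by (metis)
  have p0: "mat_eval n A ?p = 0\<^sub>m n n"
    using PQ(1-4) T by (simp add: PQ(5) mat_eval_similar mat_eval_upper_triangular del: assoc_mult_mat)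
  have "mat_eval n A q * mat_eval n A q = mat_eval n A ([:0, 1:] + ?p * h)"
    unfolding q[symmetric] using A by (simp add: mat_eval_mult)
  also have "\<dots> = A + 0\<^sub>m n n * mat_eval n A h"
    using A by (simp only: mat_eval_add mat_eval_mult mat_eval_X p0)
  also have "\<dots> = A" using A left_mult_zero_mat[OF mat_eval_carrier[OF A, of h], of n] by simp
  finally show ?thesis by (rule that)
qed

section \<open>Conjugacy in the symplectic group\<close>

text \<open>
Let \<open>s = g r g\<^sup>-\<^sup>1\<close> in the general linear group. Both \<open>J\<close> and \<open>K = g\<^sup>T J g\<close> are forms preserved by \<open>r\<close>, so
\<open>x = J\<^sup>-\<^sup>1 K\<close> commutes with \<open>r\<close>; moreover \<open>J x = x\<^sup>T J\<close>. A square root \<open>y\<close> of \<open>x\<close> that is a polynomial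
in \<open>x\<close> inherits both properties, so \<open>y\<^sup>T J y = J y\<^sup>2 = K\<close>. Therefore \<open>h = g y\<^sup>-\<^sup>1\<close> is symplectic, and it still
conjugates \<open>r\<close> to \<open>s\<close>.
\<close>

lemma Sp_conjugate_if_GL_conjugate:
  assumes s: "s \<in> carrier (Sp l)" and r: "r \<in> carrier (Sp l)" and sim: "similar_mat s r"
  shows "conjugate_in (Sp l) s r"
proof -
  let ?n = "2 * l" and ?J = "sympl_form l"
  obtain J' where J': "J' \<in> carrier_mat ?n ?n" "J' * ?J = 1\<^sub>m ?n" "?J * J' = 1\<^sub>m ?n"
    by (rule sympl_form_inverse)
  have J: "?J \<in> carrier_mat ?n ?n" by simp
  note as = assoc_mult_mat[of _ ?n ?n _ ?n _ ?n]
  note c = mult_carrier_mat[of _ ?n ?n _ ?n]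
  have sc: "s \<in> carrier_mat ?n ?n" "transpose_mat s * ?J * s = ?J" using s by (auto simp: Sp_iff)
  have rc: "r \<in> carrier_mat ?n ?n" "transpose_mat r * ?J * r = ?J" using r by (auto simp: Sp_iff)
  obtain g g' where g: "g \<in> carrier_mat ?n ?n" "g' \<in> carrier_mat ?n ?n" "g * g' = 1\<^sub>m ?n" "g' * g = 1\<^sub>m ?n" "s = g * r * g'"
    using sim sc unfolding similar_mat_def similar_mat_wit_def Let_def by auto
  have sg: "s * g = g * r"
    using g(1,2,4) rc by (simp add: g(5) as)
  define K where "K = transpose_mat g * ?J * g"
  have K: "K \<in> carrier_mat ?n ?n" using g by (auto simp: K_def)
  have rK: "transpose_mat r * K * r = K"
  proof -
    have "transpose_mat r * K * r = transpose_mat (g * r) * ?J * (g * r)"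
      using g(1) rc(1) by (simp add: K_def transpose_mult[of _ ?n ?n] as c)
    also have "\<dots> = transpose_mat g * (transpose_mat s * ?J * s) * g"
      unfolding sg[symmetric] using g(1) sc(1) by (simp add: transpose_mult[of _ ?n ?n] as c)
    finally show ?thesis by (simp add: sc K_def)
  qed
  define x where "x = J' * K"
  have x: "x \<in> carrier_mat ?n ?n" using J' K by (auto simp: x_def)
  have Jx: "?J * x = K"
  proof -
    have "?J * x = (?J * J') * K" using J'(1) J K by (simp add: x_def as)
    then show ?thesis using J' K by simp
  qed
  have KT: "transpose_mat K = - K"
  proof -
    have "transpose_mat K = transpose_mat g * transpose_mat (transpose_mat g * ?J)"
      unfolding K_def by (rule transpose_mult[of _ ?n ?n _ ?n]) (use g in auto)
    also have "transpose_mat (transpose_mat g * ?J) = - ?J * g"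
      using g(1) by (subst transpose_mult[of _ ?n ?n _ ?n]) (auto simp: transpose_sympl_form)
    also have "transpose_mat g * (- ?J * g) = - K"
      using g(1) by (simp add: K_def as)
    finally show ?thesis .
  qed
  have xT: "transpose_mat x * ?J = K"
  proof -
    have "transpose_mat x * - ?J = transpose_mat (?J * x)"
      using x by (simp add: transpose_mult[of _ ?n ?n] transpose_sympl_form)
    then have "- (transpose_mat x * ?J) = - K" using x by (simp add: Jx KT)
    then show ?thesis by (metis uminus_uminus_mat)
  qed
  have xr: "x * r = r * x"
  proof -
    \<comment> \<open>Both \<open>x r\<close> and \<open>r x\<close> are mapped to \<open>J x\<close> by the invertible matrix \<open>r\<^sup>T J\<close>.\<close>
    define M where "M = transpose_mat r * ?J"
    have M: "M \<in> carrier_mat ?n ?n" using rc by (auto simp: M_def)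
    have "M * (r * J') = (transpose_mat r * ?J * r) * J'" using rc(1) J'(1) by (simp add: M_def as c)
    then have "M * (r * J') = 1\<^sub>m ?n" by (simp add: rc J')
    then have N: "(r * J') * M = 1\<^sub>m ?n"
      by (rule mat_mult_left_right_inverse[OF M c[OF rc(1) J'(1)]])
    have "M * (x * r) = transpose_mat r * (?J * x) * r" using rc(1) x by (simp add: M_def as c)
    also have "\<dots> = ?J * x" by (simp add: Jx rK)
    also have "\<dots> = (transpose_mat r * ?J * r) * x" by (simp add: rc)
    also have "\<dots> = M * (r * x)" using rc(1) x by (simp add: M_def as c)
    finally have "(r * J') * (M * (x * r)) = (r * J') * (M * (r * x))" by simp
    then have "((r * J') * M) * (x * r) = ((r * J') * M) * (r * x)"
      using rc(1) x M J'(1) by (simp only: as c)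
    then show ?thesis using rc(1) x by (simp add: N c)
  qed
  have "det J' \<noteq> 0" "det ?J \<noteq> 0" using det_mult[OF J'(1) J] J'(2) by auto
  moreover have "det g \<noteq> 0" using det_mult[OF g(1,2)] g(3) by auto
  ultimately have "det x \<noteq> 0"
    using g(1) J'(1) K by (simp add: x_def det_mult[of _ ?n] K_def det_transpose[of _ ?n] c)
  from invertible_mat_sqrt[OF x this] obtain q where q: "mat_eval ?n x q * mat_eval ?n x q = x" .
  define y where "y = mat_eval ?n x q"
  have y: "y \<in> carrier_mat ?n ?n" using x by (simp add: y_def)
  have "det y * det y = det x" using det_mult[OF y y] q by (simp add: y_def)
  with \<open>det x \<noteq> 0\<close> have "det y \<noteq> 0" by auto
  then obtain z where z: "z \<in> carrier_mat ?n ?n" "y * z = 1\<^sub>m ?n" "z * y = 1\<^sub>m ?n"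
    using obtain_inverse_matrix[OF y] by blast
  have yK: "transpose_mat y * ?J * y = K"
  proof -
    have "?J * y = transpose_mat y * ?J"
      unfolding y_def by (rule mat_eval_selfadjoint[OF x J]) (simp add: Jx xT)
    then have "transpose_mat y * ?J * y = ?J * y * y" by simp
    also have "\<dots> = ?J * (y * y)" using y by (simp add: as)
    finally show ?thesis using q Jx by (simp add: y_def)
  qed
  have yr: "y * r = r * y" unfolding y_def by (rule mat_eval_commute[OF x rc(1) xr])
  have zr: "z * r = r * z"
  proof -
    have "z * r = z * (r * (y * z))" using rc(1) z by simp
    also have "\<dots> = z * (r * y) * z" using rc(1) z(1) y by (simp add: as c)
    also have "\<dots> = z * (y * r) * z" by (simp add: yr)
    also have "\<dots> = (z * y) * (r * z)" using rc(1) z(1) y by (simp add: as c)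
    finally show ?thesis using rc(1) z by (simp add: c)
  qed
  define h where "h = g * z"
  have hc: "h \<in> carrier_mat ?n ?n" using g z by (auto simp: h_def)
  have "transpose_mat h * ?J * h = transpose_mat z * K * z"
    using g(1) z(1) by (simp add: h_def K_def transpose_mult[of _ ?n ?n] as c)
  also have "\<dots> = transpose_mat (y * z) * ?J * (y * z)"
    using y z(1) by (simp add: yK[symmetric] transpose_mult[of _ ?n ?n] as c)
  also have "\<dots> = ?J" by (simp add: z)
  finally have h: "h \<in> carrier (Sp l)" using hc by (simp add: Sp_iff)
  interpret S: group "Sp l" by (rule Sp_group)
  have "s * h = (s * g) * z" using sc(1) g(1) z(1) by (simp add: h_def as)
  also have "\<dots> = g * (r * z)" unfolding sg using g(1) rc(1) z(1) by (simp add: as)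
  also have "\<dots> = h * r" unfolding zr[symmetric] using g(1) rc(1) z(1) by (simp add: h_def as)
  finally have "s \<otimes>\<^bsub>Sp l\<^esub> h = h \<otimes>\<^bsub>Sp l\<^esub> r" by simp
  then have "s = h \<otimes>\<^bsub>Sp l\<^esub> r \<otimes>\<^bsub>Sp l\<^esub> inv\<^bsub>Sp l\<^esub> h"
    using s r h by (metis S.inv_solve_right S.m_closed)
  then show ?thesis using h by (auto simp: conjugate_in_def)
qed

section \<open>Traces of powers\<close>

definition mtrace :: "complex mat \<Rightarrow> complex" where
  "mtrace A = (\<Sum>i<dim_row A. A $$ (i, i))"

lemma mtrace_comm:
  assumes "A \<in> carrier_mat n n" "B \<in> carrier_mat n n"
  shows "mtrace (A * B) = mtrace (B * A)"
proof -
  have "mtrace (A * B) = (\<Sum>i<n. \<Sum>j<n. A $$ (i, j) * B $$ (j, i))"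
    using assms by (simp add: mtrace_def mult_mat_index[of _ n n _ n])
  also have "\<dots> = (\<Sum>j<n. \<Sum>i<n. A $$ (i, j) * B $$ (j, i))" by (rule sum.swap)
  also have "\<dots> = mtrace (B * A)"
    using assms by (simp add: mtrace_def mult_mat_index[of _ n n _ n] mult.commute)
  finally show ?thesis .
qed

lemma mtrace_smult: "A \<in> carrier_mat n n \<Longrightarrow> mtrace (c \<cdot>\<^sub>m A) = c * mtrace A"
  by (simp add: mtrace_def sum_distrib_left)

lemma mtrace_similar_pow:
  assumes "similar_mat A B"
  shows "mtrace (A ^\<^sub>m m) = mtrace (B ^\<^sub>m m)"
proof -
  obtain P Q where w: "similar_mat_wit A B P Q" using assms by (auto simp: similar_mat_def)
  define n where "n = dim_row A"
  have c: "B \<in> carrier_mat n n" "P \<in> carrier_mat n n" "Q \<in> carrier_mat n n" "Q * P = 1\<^sub>m n"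
    using similar_mat_witD[OF n_def w] by simp_all
  have "mtrace (A ^\<^sub>m m) = mtrace (P * (B ^\<^sub>m m * Q))"
    using similar_mat_wit_pow_id[OF w, of m] c by (simp add: assoc_mult_mat[of _ n n _ n _ n])
  also have "\<dots> = mtrace (B ^\<^sub>m m * Q * P)"
    by (rule mtrace_comm[of _ n]) (use c in \<open>auto intro!: mult_carrier_mat[of _ n n _ n]\<close>)
  also have "B ^\<^sub>m m * Q * P = B ^\<^sub>m m * (Q * P)"
    by (rule assoc_mult_mat[of _ n n _ n _ n]) (use c in auto)
  also have "\<dots> = B ^\<^sub>m m" unfolding c(4) using c(1) by simp
  finally show ?thesis .
qed

lemma pow_mat_smult:
  assumes "A \<in> carrier_mat n n"
  shows "(c \<cdot>\<^sub>m A) ^\<^sub>m m = (c ^ m :: complex) \<cdot>\<^sub>m (A ^\<^sub>m m)"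
proof (induction m)
  case 0
  show ?case using assms by (intro eq_matI) auto
next
  case (Suc m)
  have "(c \<cdot>\<^sub>m A) ^\<^sub>m Suc m = c \<cdot>\<^sub>m ((c ^ m \<cdot>\<^sub>m A ^\<^sub>m m) * A)"
    using assms by (simp add: Suc mult_smult_distrib[of _ n n _ n])
  also have "(c ^ m \<cdot>\<^sub>m A ^\<^sub>m m) * A = c ^ m \<cdot>\<^sub>m (A ^\<^sub>m m * A)"
    by (rule mult_smult_assoc_mat[of _ n n _ n]) (use assms in auto)
  finally show ?case by (auto intro!: eq_matI)
qed

lemma pow_mat_add:
  assumes "A \<in> carrier_mat n n"
  shows "A ^\<^sub>m (k + m) = A ^\<^sub>m k * A ^\<^sub>m m"
proof (induction m)
  case (Suc m)
  then show ?case using assms by (simp add: assoc_mult_mat[of _ n n _ n _ n])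
qed (use assms in simp)

lemma pow_mat_inverse:
  assumes A: "A \<in> carrier_mat n n" and B: "B \<in> carrier_mat n n" and AB: "A * B = 1\<^sub>m n"
  shows "A ^\<^sub>m m * B ^\<^sub>m m = 1\<^sub>m n"
proof (induction m)
  case 0
  then show ?case using A B by simp
next
  case (Suc m)
  have "B ^\<^sub>m Suc m = B * B ^\<^sub>m m" using pow_mat_add[OF B, of 1 m] B by simp
  then have "A ^\<^sub>m Suc m * B ^\<^sub>m Suc m = A ^\<^sub>m m * (A * B) * B ^\<^sub>m m"
    using A B by (simp add: assoc_mult_mat[of _ n n _ n _ n] mult_carrier_mat[of _ n n _ n])
  also have "\<dots> = 1\<^sub>m n" unfolding AB using A by (simp add: Suc)
  finally show ?case .
qed

lemma similar_diagonal_if_mset_eq: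
  assumes "mset xs = mset ys"
  shows "similar_mat (diag_matrix (length xs) ((!) xs)) (diag_matrix (length xs) ((!) ys))"
proof -
  let ?n = "length xs"
  have len: "length ys = ?n" using assms mset_eq_length by metis
  obtain p where p: "p permutes {..<length ys}" "permute_list p ys = xs"
    using mset_eq_permutation[OF assms] .
  have pi: "p i < ?n" if "i < ?n" for i using p(1) that len by (metis lessThan_iff permutes_in_image)
  have xi: "xs ! i = ys ! p i" if "i < ?n" for i
    using permute_list_nth[OF p(1), of i] that len p(2) by simp
  define P :: "complex mat" where "P = mat ?n ?n (\<lambda>(i, j). if p i = j then 1 else 0)"
  have P: "P \<in> carrier_mat ?n ?n" by (simp add: P_def)
  have PPT: "P * transpose_mat P = 1\<^sub>m ?n"
  proof (rule eq_matI)
    fix i j assume "i < dim_row (1\<^sub>m ?n :: complex mat)" "j < dim_col (1\<^sub>m ?n :: complex mat)"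
    then have ij: "i < ?n" "j < ?n" by auto
    have "(P * transpose_mat P) $$ (i, j) = (\<Sum>k<?n. (if p i = k then 1 else 0) * P $$ (j, k))"
      unfolding mult_mat_index[OF P transpose_carrier_mat[THEN iffD2, OF P] ij]
      by (intro sum.cong refl) (use ij in \<open>simp add: P_def\<close>)
    also have "\<dots> = P $$ (j, p i)" by (rule sum_mult_delta(1)[OF pi[OF ij(1)]])
    also have "\<dots> = 1\<^sub>m ?n $$ (i, j)"
      using ij pi permutes_inj[OF p(1)] by (auto simp: P_def dest: injD)
    finally show "(P * transpose_mat P) $$ (i, j) = 1\<^sub>m ?n $$ (i, j)" .
  qed (use P in auto)
  have PTP: "transpose_mat P * P = 1\<^sub>m ?n"
    by (rule mat_mult_left_right_inverse[OF P _ PPT]) (use P in simp)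
  have "P * diag_matrix ?n ((!) ys) = diag_matrix ?n ((!) xs) * P"
  proof (rule eq_matI)
    fix i j assume "i < dim_row (diag_matrix ?n ((!) xs) * P)" "j < dim_col (diag_matrix ?n ((!) xs) * P)"
    then have ij: "i < ?n" "j < ?n" using P by auto
    show "(P * diag_matrix ?n ((!) ys)) $$ (i, j) = (diag_matrix ?n ((!) xs) * P) $$ (i, j)"
      unfolding diag_matrix_mult_index[OF P ij] using ij xi by (simp add: P_def)
  qed (use P in auto)
  then have "diag_matrix ?n ((!) xs) * (P * transpose_mat P) = P * diag_matrix ?n ((!) ys) * transpose_mat P"
    using P by (simp add: assoc_mult_mat[of _ ?n ?n _ ?n _ ?n])
  then have "diag_matrix ?n ((!) xs) = P * diag_matrix ?n ((!) ys) * transpose_mat P"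
    by (simp add: PPT right_mult_one_mat[of _ ?n ?n])
  then show ?thesis using P PPT PTP by (intro similar_matI[of _ _ P "transpose_mat P" ?n]) auto
qed

lemma diag_matrix_pow:
  "diag_matrix n d ^\<^sub>m m = diag_matrix n (\<lambda>i. d i ^ m)"
proof (induction m)
  case 0
  show ?case by (rule eq_matI) (auto simp: diag_matrix_def)
next
  case (Suc m)
  show ?case
  proof (rule eq_matI)
    fix i j assume "i < dim_row (diag_matrix n (\<lambda>i. d i ^ Suc m))" "j < dim_col (diag_matrix n (\<lambda>i. d i ^ Suc m))"
    then have ij: "i < n" "j < n" by auto
    then show "(diag_matrix n d ^\<^sub>m Suc m) $$ (i, j) = diag_matrix n (\<lambda>i. d i ^ Suc m) $$ (i, j)"
      by (simp add: Suc diag_matrix_mult_index(2)[OF diag_matrix_carrier]) (simp add: diag_matrix_def)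
  qed auto
qed

text \<open>
The traces of the powers are the power sums of the eigenvalues, which determine them with multiplicities.
\<close>

lemma semisimple_similar_if_traces_eq:
  assumes A: "A \<in> carrier_mat n n" "semisimple_mat A" and B: "B \<in> carrier_mat n n" "semisimple_mat B"
    and tr: "\<And>m. mtrace (A ^\<^sub>m m) = mtrace (B ^\<^sub>m m)"
  shows "similar_mat A B"
proof -
  have diag: "\<exists>xs. length xs = n \<and> similar_mat C (diag_matrix n ((!) xs)) \<and> (\<forall>m. mtrace (C ^\<^sub>m m) = (\<Sum>x\<leftarrow>xs. x ^ m))"
    if C: "C \<in> carrier_mat n n" "semisimple_mat C" for C
  proof -
    obtain D where D: "diagonal_mat D" "similar_mat C D" using C by (auto simp: semisimple_mat_def)
    have Dc: "D \<in> carrier_mat n n"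
      using D(2) C(1) by (auto simp: similar_mat_def similar_mat_wit_def Let_def)
    let ?xs = "diag_mat D"
    have len: "length ?xs = n" using Dc by (simp add: diag_mat_def)
    have DD: "D = diag_matrix n ((!) ?xs)"
      by (rule eq_matI) (use Dc D(1) in \<open>auto simp: diag_matrix_def diag_mat_def diagonal_mat_def\<close>)
    have "mtrace (C ^\<^sub>m m) = (\<Sum>x\<leftarrow>?xs. x ^ m)" for m
    proof -
      have "mtrace (C ^\<^sub>m m) = mtrace (diag_matrix n ((!) ?xs) ^\<^sub>m m)"
        using mtrace_similar_pow[OF D(2)] DD by simp
      also have "\<dots> = (\<Sum>i<n. ?xs ! i ^ m)"
        by (simp add: diag_matrix_pow mtrace_def) (simp add: diag_matrix_def)
      also have "\<dots> = (\<Sum>x\<leftarrow>?xs. x ^ m)"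
        by (simp add: sum_list_sum_nth len lessThan_atLeast0)
      finally show ?thesis .
    qed
    then show ?thesis using len D(2) DD by (intro exI[of _ ?xs]) auto
  qed
  obtain xs where xs: "length xs = n" "similar_mat A (diag_matrix n ((!) xs))"
    "\<And>m. mtrace (A ^\<^sub>m m) = (\<Sum>x\<leftarrow>xs. x ^ m)" using diag[OF A] by blast
  obtain ys where ys: "length ys = n" "similar_mat B (diag_matrix n ((!) ys))"
    "\<And>m. mtrace (B ^\<^sub>m m) = (\<Sum>x\<leftarrow>ys. x ^ m)" using diag[OF B] by blast
  have "mset xs = mset ys"
    by (rule mset_eq_if_power_sums_eq) (use tr xs(3) ys(3) in simp)
  then have "similar_mat (diag_matrix n ((!) xs)) (diag_matrix n ((!) ys))"
    using similar_diagonal_if_mset_eq xs(1) by blast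
  then show ?thesis using xs(2) ys(2) similar_mat_trans similar_mat_sym by metis
qed

section \<open>Central elements act by scalars\<close>

text \<open>
An eigenspace of \<open>\<rho>(c)\<close> is a nonzero subrepresentation.
\<close>

lemma group_center_scalar:
  assumes irr: "irreducible_rep l N \<rho>" and c: "c \<in> group_center (Sp l)"
  obtains t where "t \<noteq> 0" "\<rho> c = t \<cdot>\<^sub>m 1\<^sub>m N"
proof -
  have \<rho>: "rational_rep l N \<rho>" and N: "N > 0" using irr by (auto simp: irreducible_rep_def)
  have cS: "c \<in> carrier (Sp l)" and comm: "\<And>g. g \<in> carrier (Sp l) \<Longrightarrow> c * g = g * c"
    using c by (auto simp: group_center_def)
  have C: "\<rho> c \<in> carrier_mat N N" by (rule rational_rep_carrier(2)[OF \<rho> cS])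
  obtain t where "eigenvalue (\<rho> c) t" using spectrum_non_empty[OF C N] by (auto simp: spectrum_def)
  then obtain x where x: "x \<in> carrier_vec N" "x \<noteq> 0\<^sub>v N" "\<rho> c *\<^sub>v x = t \<cdot>\<^sub>v x"
    using C by (auto simp: eigenvalue_def eigenvector_def)
  let ?W = "{x \<in> carrier_vec N. \<rho> c *\<^sub>v x = t \<cdot>\<^sub>v x}"
  have "?W = carrier_vec N"
  proof (rule irreducible_subspace_eq[OF irr _ _ _ _ _ _ x(2)])
    show "0\<^sub>v N \<in> ?W" using C by (auto intro!: eq_vecI simp: mult_mat_vec_index[of _ N N])
    show "a + b \<in> ?W" if "a \<in> ?W" "b \<in> ?W" for a b
      using that C by (auto simp: mult_add_distrib_mat_vec[of _ N N] smult_add_distrib_vec[of _ N])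
    show "d \<cdot>\<^sub>v a \<in> ?W" if "a \<in> ?W" for a d
      using that C by (auto simp: mult_mat_vec[of _ N N] smult_smult_assoc mult.commute)
    show "\<rho> g *\<^sub>v a \<in> ?W" if g: "g \<in> carrier (Sp l)" and a: "a \<in> ?W" for g a
    proof -
      have "\<rho> c *\<^sub>v (\<rho> g *\<^sub>v a) = \<rho> g *\<^sub>v (\<rho> c *\<^sub>v a)"
        using rational_rep_mult_vec[OF \<rho> cS g, of a] rational_rep_mult_vec[OF \<rho> g cS, of a] a comm[OF g] by auto
      also have "\<dots> = t \<cdot>\<^sub>v (\<rho> g *\<^sub>v a)"
        using a rational_rep_carrier(2)[OF \<rho> g] by (auto simp: mult_mat_vec[of _ N N])
      finally show ?thesis using a rational_rep_vec_carrier[OF \<rho> g] by auto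
    qed
  qed (use x in auto)
  then have all: "\<rho> c *\<^sub>v y = t \<cdot>\<^sub>v y" if "y \<in> carrier_vec N" for y using that by blast
  have eq: "\<rho> c = t \<cdot>\<^sub>m 1\<^sub>m N"
  proof (rule mat_eq_by_vec[OF C])
    fix j assume j: "j < N"
    have "t \<cdot>\<^sub>m 1\<^sub>m N *\<^sub>v unit_vec N j = t \<cdot>\<^sub>v unit_vec N j"
      by (rule eq_vecI) (use j in \<open>auto simp: mult_unit_vec_index[of _ N N]\<close>)
    then show "\<rho> c *\<^sub>v unit_vec N j = t \<cdot>\<^sub>m 1\<^sub>m N *\<^sub>v unit_vec N j" using all by simp
  qed simp
  have "t \<noteq> 0"
  proof
    assume "t = 0"
    interpret S: group "Sp l" by (rule Sp_group)
    have "c * inv\<^bsub>Sp l\<^esub> c = 1\<^sub>m (2 * l)" using S.r_inv[OF cS] by simp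
    then have "\<rho> c * \<rho> (inv\<^bsub>Sp l\<^esub> c) = 1\<^sub>m N"
      using rational_rep_mult[OF \<rho> cS S.inv_closed[OF cS]] rational_rep_one[OF \<rho>] by simp
    moreover have "\<rho> c = 0\<^sub>m N N" unfolding eq \<open>t = 0\<close> by (rule eq_matI) auto
    ultimately have "0\<^sub>m N N = (1\<^sub>m N :: complex mat)"
      using rational_rep_carrier(2)[OF \<rho> S.inv_closed[OF cS]] by simp
    then have "(0\<^sub>m N N :: complex mat) $$ (0, 0) = 1\<^sub>m N $$ (0, 0)" by simp
    then show False using N by simp
  qed
  then show ?thesis using eq by (rule that)
qed

lemma conjugate_rep_if_conjugate_up_to_center:
  assumes irr: "irreducible_rep l N \<rho>" and s: "s \<in> carrier (Sp l)" "r \<in> carrier (Sp l)"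
    and c: "c \<in> group_center (Sp l)" and conj: "conjugate_in (Sp l) s (c \<otimes>\<^bsub>Sp l\<^esub> r)"
  shows "\<exists>t. t \<noteq> 0 \<and> conjugate_in (GL N) (\<rho> s) (t \<cdot>\<^sub>m \<rho> r)"
proof -
  have \<rho>: "rational_rep l N \<rho>" using irr by (auto simp: irreducible_rep_def)
  then have hom: "\<rho> \<in> hom (Sp l) (GL N)" by (simp add: rational_rep_def)
  interpret h: group_hom "Sp l" "GL N" \<rho>
    by (intro group_hom.intro Sp_group GL_group group_hom_axioms.intro hom)
  have cS: "c \<in> carrier (Sp l)" using c by (simp add: group_center_def)
  obtain t where t: "t \<noteq> 0" "\<rho> c = t \<cdot>\<^sub>m 1\<^sub>m N" using group_center_scalar[OF irr c] .
  obtain g where g: "g \<in> carrier (Sp l)" "s = g \<otimes>\<^bsub>Sp l\<^esub> (c \<otimes>\<^bsub>Sp l\<^esub> r) \<otimes>\<^bsub>Sp l\<^esub> inv\<^bsub>Sp l\<^esub> g"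
    using conj by (auto simp: conjugate_in_def)
  have R: "\<rho> r \<in> carrier_mat N N" by (rule rational_rep_carrier(2)[OF \<rho> s(2)])
  have "\<rho> (c \<otimes>\<^bsub>Sp l\<^esub> r) = t \<cdot>\<^sub>m \<rho> r"
    using cS s R by (simp add: rational_rep_mult[OF \<rho>] t(2) mult_smult_assoc_mat[of _ N N])
  then have "\<rho> s = \<rho> g \<otimes>\<^bsub>GL N\<^esub> (t \<cdot>\<^sub>m \<rho> r) \<otimes>\<^bsub>GL N\<^esub> inv\<^bsub>GL N\<^esub> (\<rho> g)"
    using g cS s by (simp only: h.hom_mult h.hom_inv h.G.m_closed h.G.inv_closed)
  then show ?thesis
    unfolding conjugate_in_def using t(1) rational_rep_carrier(1)[OF \<rho> g(1)] by blast
qed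

section \<open>Traces of representations that are conjugate up to a constant\<close>

lemma conjugate_GL_similar:
  assumes "conjugate_in (GL N) A B" "B \<in> carrier_mat N N"
  shows "\<exists>P Q. P \<in> carrier_mat N N \<and> Q \<in> carrier_mat N N \<and> P * Q = 1\<^sub>m N \<and> Q * P = 1\<^sub>m N \<and> A = P * B * Q"
proof -
  interpret G: group "GL N" by (rule GL_group)
  obtain g where g: "g \<in> carrier (GL N)" "A = g \<otimes>\<^bsub>GL N\<^esub> B \<otimes>\<^bsub>GL N\<^esub> inv\<^bsub>GL N\<^esub> g"
    using assms(1) by (auto simp: conjugate_in_def)
  show ?thesis
    using g G.r_inv[OF g(1)] G.l_inv[OF g(1)] GL_carrier_mat[OF g(1)] GL_carrier_mat[OF G.inv_closed[OF g(1)]]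
    by (intro exI[of _ g] exI[of _ "inv\<^bsub>GL N\<^esub> g"]) simp
qed

lemma Sp_pow: "s \<in> carrier (Sp l) \<Longrightarrow> s ^\<^sub>m m \<in> carrier (Sp l)"
  by (induction m) (auto simp: Sp_one Sp_mult dest: Sp_carrier_mat)

lemma rational_rep_pow:
  assumes \<rho>: "rational_rep l N \<rho>" and s: "s \<in> carrier (Sp l)"
  shows "\<rho> (s ^\<^sub>m m) = \<rho> s ^\<^sub>m m"
proof (induction m)
  case 0
  have "dim_row s = 2 * l" "dim_row (\<rho> s) = N"
    using Sp_carrier_mat[OF s] rational_rep_carrier(2)[OF \<rho> s] by auto
  then show ?case by (simp add: rational_rep_one[OF \<rho>])
qed (simp add: rational_rep_mult[OF \<rho> Sp_pow[OF s] s])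

text \<open>
The inverse is \<open>J\<^sup>-\<^sup>1 s\<^sup>T J\<close>.
\<close>

lemma mtrace_Sp_inverse:
  assumes s: "s \<in> carrier (Sp l)" and s': "s' \<in> carrier_mat (2 * l) (2 * l)" "s * s' = 1\<^sub>m (2 * l)"
  shows "mtrace s' = mtrace s"
proof -
  let ?n = "2 * l" and ?J = "sympl_form l"
  obtain J' where J': "J' \<in> carrier_mat ?n ?n" "J' = - ?J" "J' * ?J = 1\<^sub>m ?n" "?J * J' = 1\<^sub>m ?n"
    by (rule sympl_form_inverse)
  have sc: "s \<in> carrier_mat ?n ?n" by (rule Sp_carrier_mat[OF s])
  let ?i = "J' * (transpose_mat s * ?J)"
  have ic: "?i \<in> carrier_mat ?n ?n" and inv: "?i * s = 1\<^sub>m ?n"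
    using Sp_inverse[OF s] by (auto simp: J'(2))
  have "s' = (?i * s) * s'" using s' by (simp add: inv)
  also have "\<dots> = ?i * (s * s')" by (rule assoc_mult_mat[OF ic sc s'(1)])
  also have "\<dots> = ?i" using ic by (simp add: s')
  finally have "mtrace s' = mtrace (J' * (transpose_mat s * ?J))" by simp
  also have "\<dots> = mtrace ((transpose_mat s * ?J) * J')"
    by (rule mtrace_comm[of _ ?n]) (use J'(1) sc in \<open>auto intro!: mult_carrier_mat[of _ ?n ?n]\<close>)
  also have "(transpose_mat s * ?J) * J' = transpose_mat s * (?J * J')"
    by (rule assoc_mult_mat[of _ ?n ?n _ ?n _ ?n]) (use J'(1) sc in auto)
  also have "\<dots> = transpose_mat s" using sc by (simp add: J'(4))
  also have "mtrace (transpose_mat s) = mtrace s" using sc by (simp add: mtrace_def)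
  finally show ?thesis .
qed

text \<open>
The second relation is the first one for the inverses, which are conjugate up to the constant \<open>1 / t\<close> and have
the same traces.
\<close>

lemma rep_trace_power:
  assumes \<rho>: "rational_rep l N \<rho>" and s: "s \<in> carrier (Sp l)" and r: "r \<in> carrier (Sp l)"
    and t: "t \<noteq> 0" and conj: "conjugate_in (GL N) (\<rho> s) (t \<cdot>\<^sub>m \<rho> r)"
    and f: "\<And>g. g \<in> carrier (Sp l) \<Longrightarrow> mtrace (\<rho> g) = f g"
    and finv: "\<And>g g'. g \<in> carrier (Sp l) \<Longrightarrow> g' \<in> carrier (Sp l) \<Longrightarrow> g * g' = 1\<^sub>m (2 * l) \<Longrightarrow> f g' = f g"
  shows "f (s ^\<^sub>m m) = t ^ m * f (r ^\<^sub>m m)" and "f (r ^\<^sub>m m) = t ^ m * f (s ^\<^sub>m m)"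
proof -
  have carr: "\<And>g. g \<in> carrier (Sp l) \<Longrightarrow> \<rho> g \<in> carrier_mat N N" by (rule rational_rep_carrier(2)[OF \<rho>])
  obtain P Q where PQ: "P \<in> carrier_mat N N" "Q \<in> carrier_mat N N" "P * Q = 1\<^sub>m N" "Q * P = 1\<^sub>m N"
    "\<rho> s = P * (t \<cdot>\<^sub>m \<rho> r) * Q"
    using conjugate_GL_similar[OF conj] carr[OF r] by auto
  have power: "f (g ^\<^sub>m m) = c ^ m * f (h ^\<^sub>m m)"
    if g: "g \<in> carrier (Sp l)" and h: "h \<in> carrier (Sp l)" and eq: "\<rho> g = P * (c \<cdot>\<^sub>m \<rho> h) * Q" for g h c
  proof -
    have sim: "similar_mat (\<rho> g) (c \<cdot>\<^sub>m \<rho> h)"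
      by (rule similar_matI[of _ _ P Q N]) (use PQ carr[OF g] carr[OF h] eq in auto)
    have "f (g ^\<^sub>m m) = mtrace (\<rho> g ^\<^sub>m m)"
      using f[OF Sp_pow[OF g]] by (simp add: rational_rep_pow[OF \<rho> g])
    also have "\<dots> = mtrace ((c \<cdot>\<^sub>m \<rho> h) ^\<^sub>m m)" by (rule mtrace_similar_pow[OF sim])
    also have "\<dots> = c ^ m * mtrace (\<rho> h ^\<^sub>m m)"
      using carr[OF h] by (simp add: pow_mat_smult[of _ N] mtrace_smult[of _ N])
    also have "mtrace (\<rho> h ^\<^sub>m m) = f (h ^\<^sub>m m)"
      using f[OF Sp_pow[OF h]] by (simp add: rational_rep_pow[OF \<rho> h])
    finally show ?thesis .
  qed
  show "f (s ^\<^sub>m m) = t ^ m * f (r ^\<^sub>m m)" by (rule power[OF s r PQ(5)])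
  interpret S: group "Sp l" by (rule Sp_group)
  let ?s = "inv\<^bsub>Sp l\<^esub> s" and ?r = "inv\<^bsub>Sp l\<^esub> r"
  have si: "?s \<in> carrier (Sp l)" "s * ?s = 1\<^sub>m (2 * l)" using S.r_inv[OF s] s by auto
  have ri: "?r \<in> carrier (Sp l)" "r * ?r = 1\<^sub>m (2 * l)" using S.r_inv[OF r] r by auto
  note as = assoc_mult_mat[of _ N N _ N _ N] and mc = mult_carrier_mat[of _ N N _ N]
  have "\<rho> ?s = P * (inverse t \<cdot>\<^sub>m \<rho> ?r) * Q"
  proof -
    let ?I = "P * (inverse t \<cdot>\<^sub>m \<rho> ?r) * Q"
    have I: "?I \<in> carrier_mat N N" using PQ carr[OF ri(1)] by (auto intro!: mc)
    have "\<rho> s * ?I = P * (t \<cdot>\<^sub>m \<rho> r) * (Q * P) * (inverse t \<cdot>\<^sub>m \<rho> ?r) * Q"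
      unfolding PQ(5) using PQ(1,2) carr[OF r] carr[OF ri(1)] by (simp add: as mc)
    also have "\<dots> = P * ((t \<cdot>\<^sub>m \<rho> r) * (inverse t \<cdot>\<^sub>m \<rho> ?r)) * Q"
      unfolding PQ(4) using PQ(1,2) carr[OF r] carr[OF ri(1)] by (simp add: as mc)
    also have "(t \<cdot>\<^sub>m \<rho> r) * (inverse t \<cdot>\<^sub>m \<rho> ?r) = \<rho> r * \<rho> ?r"
    proof -
      have "(t \<cdot>\<^sub>m \<rho> r) * (inverse t \<cdot>\<^sub>m \<rho> ?r) = inverse t \<cdot>\<^sub>m (t \<cdot>\<^sub>m (\<rho> r * \<rho> ?r))"
        using carr[OF r] carr[OF ri(1)]
        by (simp add: mult_smult_assoc_mat[of _ N N _ N] mult_smult_distrib[of _ N N _ N])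
      also have "\<dots> = \<rho> r * \<rho> ?r" using t by (intro eq_matI) auto
      finally show ?thesis .
    qed
    also have "\<rho> r * \<rho> ?r = 1\<^sub>m N"
      using rational_rep_mult[OF \<rho> r ri(1)] ri(2) rational_rep_one[OF \<rho>] by simp
    finally have sI: "\<rho> s * ?I = 1\<^sub>m N" using PQ by simp
    have "\<rho> s * \<rho> ?s = 1\<^sub>m N"
      using rational_rep_mult[OF \<rho> s si(1)] si(2) rational_rep_one[OF \<rho>] by simp
    then have ss: "\<rho> ?s * \<rho> s = 1\<^sub>m N"
      by (rule mat_mult_left_right_inverse[OF carr[OF s] carr[OF si(1)]])
    have "\<rho> ?s = \<rho> ?s * (\<rho> s * ?I)" unfolding sI using carr[OF si(1)] by simp
    also have "\<dots> = (\<rho> ?s * \<rho> s) * ?I" by (rule as[symmetric]) (use carr[OF s] carr[OF si(1)] I in auto)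
    also have "\<dots> = ?I" unfolding ss by (rule left_mult_one_mat[OF I])
    finally show ?thesis .
  qed
  then have "f (?s ^\<^sub>m m) = inverse t ^ m * f (?r ^\<^sub>m m)" by (rule power[OF si(1) ri(1)])
  moreover have "f (?s ^\<^sub>m m) = f (s ^\<^sub>m m)"
    by (rule finv) (use Sp_pow s si pow_mat_inverse Sp_carrier_mat in blast)+
  moreover have "f (?r ^\<^sub>m m) = f (r ^\<^sub>m m)"
    by (rule finv) (use Sp_pow r ri pow_mat_inverse Sp_carrier_mat in blast)+
  ultimately show "f (r ^\<^sub>m m) = t ^ m * f (s ^\<^sub>m m)" using t by (simp add: power_inverse field_simps)
qed

section \<open>Semisimple elements up to a central sign\<close>

lemma scalar_sign_center:
  assumes "e \<in> {1, -1 :: complex}"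
  shows "e \<cdot>\<^sub>m 1\<^sub>m (2 * l) \<in> group_center (Sp l)"
    and "s \<in> carrier (Sp l) \<Longrightarrow> (e \<cdot>\<^sub>m 1\<^sub>m (2 * l)) * s = e \<cdot>\<^sub>m s"
    and "s \<in> carrier (Sp l) \<Longrightarrow> e \<cdot>\<^sub>m s \<in> carrier (Sp l)"
proof -
  have ee: "e * e = 1" using assms by auto
  show mult: "(e \<cdot>\<^sub>m 1\<^sub>m (2 * l)) * s = e \<cdot>\<^sub>m s" if "s \<in> carrier (Sp l)" for s
    using scalar_mat_arith(5)[OF Sp_carrier_mat[OF that] Sp_carrier_mat[OF that]] .
  show Sp: "e \<cdot>\<^sub>m s \<in> carrier (Sp l)" if "s \<in> carrier (Sp l)" for s
  proof (rule SpI_symp)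
    fix x y :: "complex vec" assume xy: "x \<in> carrier_vec (2 * l)" "y \<in> carrier_vec (2 * l)"
    have s: "s \<in> carrier_mat (2 * l) (2 * l)" by (rule Sp_carrier_mat[OF that])
    have v: "(e \<cdot>\<^sub>m s) *\<^sub>v z = e \<cdot>\<^sub>v (s *\<^sub>v z)" if "z \<in> carrier_vec (2 * l)" for z
      by (rule eq_vecI) (use s that in \<open>auto simp: mult_mat_vec_index[of _ "2*l" "2*l"] sum_distrib_left mult.assoc\<close>)
    have c: "s *\<^sub>v x \<in> carrier_vec (2 * l)" "s *\<^sub>v y \<in> carrier_vec (2 * l)"
      using s xy by (auto intro: mult_mat_vec_carrier)
    have "symp l (e \<cdot>\<^sub>v (s *\<^sub>v x)) (e \<cdot>\<^sub>v (s *\<^sub>v y)) = (e * e) * symp l (s *\<^sub>v x) (s *\<^sub>v y)"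
      using c by (simp add: symp_smult_left symp_smult_right)
    then show "symp l ((e \<cdot>\<^sub>m s) *\<^sub>v x) ((e \<cdot>\<^sub>m s) *\<^sub>v y) = symp l x y"
      using Sp_symp[OF that xy] by (simp add: v xy ee)
  qed (use Sp_carrier_mat[OF that] in auto)
  show "e \<cdot>\<^sub>m 1\<^sub>m (2 * l) \<in> group_center (Sp l)"
  proof -
    have "(e \<cdot>\<^sub>m 1\<^sub>m (2 * l)) * g = g * (e \<cdot>\<^sub>m 1\<^sub>m (2 * l))" if "g \<in> carrier (Sp l)" for g
      unfolding scalar_mat_arith(4,5)[OF Sp_carrier_mat[OF that] Sp_carrier_mat[OF that]] ..
    then show ?thesis using Sp[OF Sp_one] by (simp add: group_center_def)
  qed
qed

lemma semisimple_smult: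
  assumes "A \<in> carrier_mat n n" "semisimple_mat A"
  shows "semisimple_mat (c \<cdot>\<^sub>m A)"
proof -
  obtain D where D: "diagonal_mat D" "similar_mat A D" using assms by (auto simp: semisimple_mat_def)
  then obtain P Q where w: "similar_mat_wit A D P Q" by (auto simp: similar_mat_def)
  note PQ = similar_mat_witD2[OF assms(1) w]
  have "P * (c \<cdot>\<^sub>m D) * Q = c \<cdot>\<^sub>m (P * D * Q)"
    using PQ(5-7) by (simp add: mult_smult_assoc_mat[of _ n n _ n] mult_smult_distrib[of _ n n _ n] mult_carrier_mat[of _ n n _ n])
  then have e: "c \<cdot>\<^sub>m A = P * (c \<cdot>\<^sub>m D) * Q" by (simp only: PQ(3))
  have "similar_mat (c \<cdot>\<^sub>m A) (c \<cdot>\<^sub>m D)"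
    by (rule similar_matI[OF _ PQ(1,2) e]) (use PQ(5-7) assms(1) in simp)
  moreover have "diagonal_mat (c \<cdot>\<^sub>m D)" using D(1) by (auto simp: diagonal_mat_def)
  ultimately show ?thesis by (auto simp: semisimple_mat_def)
qed

lemma wedge2_power_sum_pow:
  assumes "s \<in> carrier_mat n n"
  shows "wedge2_power_sum (\<lambda>m. mtrace (s ^\<^sub>m m)) m = (mtrace (s ^\<^sub>m m) ^ 2 - mtrace (s ^\<^sub>m m * s ^\<^sub>m m)) / 2 - 1"
  using pow_mat_add[OF assms, of m m] by (simp add: wedge2_power_sum_def mult_2)

text \<open>
For \<open>l = 1\<close> there is no second fundamental representation. The relations that it would provide are replaced by
\<open>0 = 0\<close>, because the trace of the exterior square is the determinant, which is 1.
\<close>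

lemma Sp_1_wedge2_trace:
  assumes "g \<in> carrier (Sp 1)"
  shows "(mtrace g ^ 2 - mtrace (g * g)) / 2 - 1 = 0"
proof -
  have g: "g \<in> carrier_mat 2 2" using Sp_carrier_mat[OF assms] by simp
  have "(transpose_mat g * sympl_form 1 * g) $$ (0, 1) = 1"
    using assms by (simp add: Sp_iff sympl_form_index)
  then have "g $$ (0, 0) * g $$ (1, 1) - g $$ (1, 0) * g $$ (0, 1) = 1"
    using form_index_sum[of g 1 0 1] g by (simp add: numeral_2_eq_2 lessThan_Suc)
  then show ?thesis
    using g by (simp add: mtrace_def mult_mat_index[of _ 2 2 _ 2] numeral_2_eq_2 lessThan_Suc power2_eq_square field_simps)
qed

theorem proposition3p13:
  fixes l :: nat
    and n :: "nat \<Rightarrow> nat"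
    and \<rho> :: "nat \<Rightarrow> complex mat \<Rightarrow> complex mat"
    and s\<^sub>1 s\<^sub>2 :: "complex mat"
  assumes "l \<ge> 1"
    and "\<forall>k \<in> {1..l}. fundamental_rep l k (n k) (\<rho> k)"
    and "s\<^sub>1 \<in> carrier (Sp l)" and "semisimple_mat s\<^sub>1"
    and "s\<^sub>2 \<in> carrier (Sp l)" and "semisimple_mat s\<^sub>2"
  shows "(\<exists>c \<in> group_center (Sp l). conjugate_in (Sp l) s\<^sub>1 (c \<otimes>\<^bsub>Sp l\<^esub> s\<^sub>2)) \<longleftrightarrow>
         (\<forall>k \<in> {1..l}. \<exists>t :: complex. t \<noteq> 0 \<and>
            conjugate_in (GL (n k)) (\<rho> k s\<^sub>1) (t \<cdot>\<^sub>m \<rho> k s\<^sub>2))"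
proof
  assume "\<exists>c \<in> group_center (Sp l). conjugate_in (Sp l) s\<^sub>1 (c \<otimes>\<^bsub>Sp l\<^esub> s\<^sub>2)"
  then obtain c where c: "c \<in> group_center (Sp l)" "conjugate_in (Sp l) s\<^sub>1 (c \<otimes>\<^bsub>Sp l\<^esub> s\<^sub>2)" by blast
  show "\<forall>k \<in> {1..l}. \<exists>t. t \<noteq> 0 \<and> conjugate_in (GL (n k)) (\<rho> k s\<^sub>1) (t \<cdot>\<^sub>m \<rho> k s\<^sub>2)"
  proof
    fix k assume "k \<in> {1..l}"
    then have "irreducible_rep l (n k) (\<rho> k)" using assms(2) by (simp add: fundamental_rep_def)
    then show "\<exists>t. t \<noteq> 0 \<and> conjugate_in (GL (n k)) (\<rho> k s\<^sub>1) (t \<cdot>\<^sub>m \<rho> k s\<^sub>2)"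
      by (rule conjugate_rep_if_conjugate_up_to_center[OF _ assms(3,5) c])
  qed
next
  assume conj: "\<forall>k \<in> {1..l}. \<exists>t. t \<noteq> 0 \<and> conjugate_in (GL (n k)) (\<rho> k s\<^sub>1) (t \<cdot>\<^sub>m \<rho> k s\<^sub>2)"
  note s = assms(3,5)
  note sc = Sp_carrier_mat[OF s(1)] Sp_carrier_mat[OF s(2)]
  define a where "a m = mtrace (s\<^sub>1 ^\<^sub>m m)" for m
  define b where "b m = mtrace (s\<^sub>2 ^\<^sub>m m)" for m
  have rep: "rational_rep l (n k) (\<rho> k)" "fundamental_rep l k (n k) (\<rho> k)" if "k \<in> {1..l}" for k
    using assms(2) that by (auto simp: fundamental_rep_def irreducible_rep_def)
  have mtr: "mtrace (\<rho> k g) = (\<Sum>i<n k. \<rho> k g $$ (i, i))" if "k \<in> {1..l}" "g \<in> carrier (Sp l)" for k g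
    using rational_rep_carrier(2)[OF rep(1)[OF that(1)] that(2)] by (simp add: mtrace_def)
  have mtrS: "mtrace g = (\<Sum>i<2*l. g $$ (i, i))" if "g \<in> carrier_mat (2 * l) (2 * l)" for g
    using that by (simp add: mtrace_def)
  have one: "1 \<in> {1..l}" using assms(1) by simp
  obtain t where t: "t \<noteq> 0" "conjugate_in (GL (n 1)) (\<rho> 1 s\<^sub>1) (t \<cdot>\<^sub>m \<rho> 1 s\<^sub>2)" using conj one by blast
  have tr1: "mtrace (\<rho> 1 g) = mtrace g" if "g \<in> carrier (Sp l)" for g
    using trace_fundamental_rep_1[OF assms(1) rep(2)[OF one] that] mtr[OF one that] mtrS[OF Sp_carrier_mat[OF that]] by simp
  have inv1: "mtrace g' = mtrace g"
    if "g \<in> carrier (Sp l)" "g' \<in> carrier (Sp l)" "g * g' = 1\<^sub>m (2 * l)" for g g'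
    using mtrace_Sp_inverse that Sp_carrier_mat by blast
  note ab = rep_trace_power[OF rep(1)[OF one] s t tr1 inv1, folded a_def b_def]
  define w where "w g = (mtrace g ^ 2 - mtrace (g * g)) / 2 - 1" for g
  have wp: "wedge2_power_sum a m = w (s\<^sub>1 ^\<^sub>m m)" "wedge2_power_sum b m = w (s\<^sub>2 ^\<^sub>m m)" for m
    using wedge2_power_sum_pow[OF sc(1), of m] wedge2_power_sum_pow[OF sc(2), of m]
    unfolding a_def[abs_def] b_def[abs_def] w_def by simp_all
  have "\<exists>u. u \<noteq> 0 \<and> (\<forall>m. w (s\<^sub>1 ^\<^sub>m m) = u ^ m * w (s\<^sub>2 ^\<^sub>m m) \<and> w (s\<^sub>2 ^\<^sub>m m) = u ^ m * w (s\<^sub>1 ^\<^sub>m m))"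
  proof (cases "l = 1")
    case True
    have "w (s\<^sub>1 ^\<^sub>m m) = 0" "w (s\<^sub>2 ^\<^sub>m m) = 0" for m
      using Sp_1_wedge2_trace Sp_pow[OF s(1)] Sp_pow[OF s(2)] by (auto simp: w_def True)
    then show ?thesis by (intro exI[of _ 1]) simp
  next
    case False
    then have l2: "2 \<le> l" and two: "2 \<in> {1..l}" using assms(1) by auto
    obtain u where u: "u \<noteq> 0" "conjugate_in (GL (n 2)) (\<rho> 2 s\<^sub>1) (u \<cdot>\<^sub>m \<rho> 2 s\<^sub>2)" using conj two by blast
    have tr2: "mtrace (\<rho> 2 g) = w g" if g: "g \<in> carrier (Sp l)" for g
      using trace_fundamental_rep_2[OF l2 rep(2)[OF two] g] mtr[OF two g] mtrS[OF Sp_carrier_mat[OF g]]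
        mtrS[OF Sp_carrier_mat[OF Sp_mult[OF g g]]] by (simp add: w_def)
    have inv2: "w g' = w g"
      if g: "g \<in> carrier (Sp l)" "g' \<in> carrier (Sp l)" "g * g' = 1\<^sub>m (2 * l)" for g g'
    proof -
      note gc = Sp_carrier_mat[OF g(1)] Sp_carrier_mat[OF g(2)]
      have "(g * g) * (g' * g') = g * (g * g') * g'"
        using gc by (simp add: assoc_mult_mat[of _ "2*l" "2*l" _ "2*l" _ "2*l"] mult_carrier_mat[of _ "2*l" "2*l" _ "2*l"])
      then have "(g * g) * (g' * g') = 1\<^sub>m (2 * l)" using gc g(3) by simp
      then have "mtrace (g' * g') = mtrace (g * g)" using inv1 g(1,2) Sp_mult by blast
      then show ?thesis using inv1[OF g] by (simp add: w_def)
    qed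
    show ?thesis
      using rep_trace_power[OF rep(1)[OF two] s u tr2 inv2] u(1) by blast
  qed
  then obtain u where u: "u \<noteq> 0" "\<And>m. wedge2_power_sum a m = u ^ m * wedge2_power_sum b m"
    "\<And>m. wedge2_power_sum b m = u ^ m * wedge2_power_sum a m" unfolding wp by blast
  obtain e where e: "e \<in> {1, -1}" "\<And>m. a m = e ^ m * b m"
    using power_sums_eq_up_to_sign[OF ab u(2,3,1)] by blast
  note es = scalar_sign_center[OF e(1)]
  have "similar_mat s\<^sub>1 (e \<cdot>\<^sub>m s\<^sub>2)"
  proof (rule semisimple_similar_if_traces_eq[OF sc(1) assms(4)])
    show "e \<cdot>\<^sub>m s\<^sub>2 \<in> carrier_mat (2 * l) (2 * l)" using sc(2) by simp
    show "semisimple_mat (e \<cdot>\<^sub>m s\<^sub>2)" by (rule semisimple_smult[OF sc(2) assms(6)])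
    show "mtrace (s\<^sub>1 ^\<^sub>m m) = mtrace ((e \<cdot>\<^sub>m s\<^sub>2) ^\<^sub>m m)" for m
      using e(2)[of m] sc(2) by (simp add: a_def b_def pow_mat_smult[of _ "2*l"] mtrace_smult[of _ "2*l"])
  qed
  then have "conjugate_in (Sp l) s\<^sub>1 (e \<cdot>\<^sub>m s\<^sub>2)"
    by (rule Sp_conjugate_if_GL_conjugate[OF s(1) es(3)[OF s(2)]])
  then show "\<exists>c \<in> group_center (Sp l). conjugate_in (Sp l) s\<^sub>1 (c \<otimes>\<^bsub>Sp l\<^esub> s\<^sub>2)"
    using es(1) es(2)[OF s(2)] by (intro bexI[of _ "e \<cdot>\<^sub>m 1\<^sub>m (2 * l)"]) auto
qed

end
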